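(* Let $K$ be a perfect field, let $\mathbb{X}=m_1p_1+\cdots+m_tp_t$ be a fat point scheme in $\mathbb{P}^n$ with homogeneous coordinate ring $R$ (as in the context), let $m\in\{1,\dots,n+1\}$, and assume $\mathrm{char}(K)=0$ or $\mathrm{char}(K)>\max\{m_1,\dots,m_t\}$. Then $$\mathrm{HP}(\Omega^m_{R/K})=\begin{cases}\sum_{i=1}^t\left[\binom{n+m_i-1}{n}+(m_i-1)\binom{n+m_i-1}{n-1}\right]&\text{if } m=1,\\[4pt] \sum_{i=1}^t\left[\binom{n+1}{m}\binom{n+m_i-2}{n}+\delta_{i,m}\right]&\text{if } 1<m\le n,\\[4pt] \sum_{i=1}^t\binom{n+m_i-2}{n}&\text{if } m=n+1,\end{cases}$$ where $\delta_{i,m}=\binom{m+m_i-2}{m}\binom{n+m_i-2}{n-m-1}+\binom{m+m_i-3}{m-1}\binom{n+m_i-2}{n-m}$.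
   Context: Let $n\ge 1$ and $P=K[X_0,\dots,X_n]$ with the standard grading. Let $t\ge1$, let $p_1,\dots,p_t$ be distinct $K$-rational points of $\mathbb{P}^n$ with homogeneous vanishing ideals $I_{p_i}\subseteq P$, and let $m_1,\dots,m_t$ be positive integers. The fat point scheme $\mathbb{X}=m_1p_1+\cdots+m_tp_t$ is the $0$-dimensional subscheme of $\mathbb{P}^n$ defined by the saturated homogeneous ideal $I_{\mathbb{X}}=I_{p_1}^{m_1}\cap\cdots\cap I_{p_t}^{m_t}$, and $R=P/I_{\mathbb{X}}$. It is assumed throughout that no point of the support of $\mathbb{X}$ lies on the hyperplane $X_0=0$. $\Omega^m_{R/K}=\Lambda^m_R\Omega^1_{R/K}$ is the module of Kähler differential $m$-forms, graded with $\deg(dx_i)=1$, where $x_i$ is the image of $X_i$ in $R$. For a finitely generated graded $R$-module $M$, $\mathrm{HP}(M)$ denotes the constant value of $\dim_K M_i$ for $i\gg0$. Binomial coefficients $\binom{a}{b}$ are $0$ if $b<0$ or $a<b$. *)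

theory Defs
  imports
    "HOL-Library.Poly_Mapping"
    "HOL-Algebra.Ideal_Product"
    "HOL-Algebra.QuotRing"
    "Jordan_Normal_Form.VS_Connect"
    "HOL-Computational_Algebra.Polynomial_Factorial"
begin

hide_const (open) Multiset.mult Polynomial.smult Modules.module

section \<open>Perfect fields, binomial coefficients\<close>

text \<open>Every irreducible polynomial is separable, i.e.\ coprime to its formal derivative.\<close>

definition perfect_field :: "'k::field itself \<Rightarrow> bool" where
  "perfect_field _ \<longleftrightarrow> (\<forall>f :: 'k poly. irreducible f \<longrightarrow> coprime f (pderiv f))"

text \<open>Integer arguments are needed because the lower argument \<open>n - m - 1\<close> becomes \<open>-1\<close>
  for \<open>m = n\<close>, where the coefficient must vanish.\<close>

definition binom :: "int \<Rightarrow> int \<Rightarrow> nat" where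
  "binom a b = (if b < 0 \<or> a < b then 0 else nat a choose nat b)"


section \<open>Modules over a ring\<close>

definition free_module :: "('r, 'x) ring_scheme \<Rightarrow> 'b set \<Rightarrow> ('r, 'b \<Rightarrow> 'r) module" where
  "free_module R B =
    \<lparr>carrier = {f. (\<forall>b\<in>B. f b \<in> carrier R) \<and> (\<forall>b. b \<notin> B \<longrightarrow> f b = \<zero>\<^bsub>R\<^esub>)
                  \<and> finite {b. f b \<noteq> \<zero>\<^bsub>R\<^esub>}},
     mult = undefined, one = undefined,
     zero = (\<lambda>_. \<zero>\<^bsub>R\<^esub>), add = (\<lambda>f g b. f b \<oplus>\<^bsub>R\<^esub> g b),
     smult = (\<lambda>a f b. a \<otimes>\<^bsub>R\<^esub> f b)\<rparr>"

definition free_gen :: "('r, 'x) ring_scheme \<Rightarrow> 'b \<Rightarrow> 'b \<Rightarrow> 'r" where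
  "free_gen R b = (\<lambda>b'. if b' = b then \<one>\<^bsub>R\<^esub> else \<zero>\<^bsub>R\<^esub>)"

definition quotient_module :: "('r, 'a, 'x) module_scheme \<Rightarrow> 'a set \<Rightarrow> ('r, 'a set) module" where
  "quotient_module M U =
    \<lparr>carrier = a_rcosets\<^bsub>M\<^esub> U, mult = undefined, one = undefined,
     zero = U, add = set_add M,
     smult = (\<lambda>a X. \<Union>x\<in>X. U +>\<^bsub>M\<^esub> (a \<odot>\<^bsub>M\<^esub> x))\<rparr>"

text \<open>The module with generators \<open>B\<close> and relations \<open>S\<close> (a set of elements of the free
  module on \<open>B\<close>), and the class of a generator in it.\<close>

definition presented_module ::
    "('r, 'x) ring_scheme \<Rightarrow> 'b set \<Rightarrow> ('b \<Rightarrow> 'r) set \<Rightarrow> ('r, ('b \<Rightarrow> 'r) set) module" where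
  "presented_module R B S =
    quotient_module (free_module R B) (LinearCombinations.module.span R (free_module R B) S)"

definition presented_gen ::
    "('r, 'x) ring_scheme \<Rightarrow> 'b set \<Rightarrow> ('b \<Rightarrow> 'r) set \<Rightarrow> 'b \<Rightarrow> ('b \<Rightarrow> 'r) set" where
  "presented_gen R B S b =
    LinearCombinations.module.span R (free_module R B) S +>\<^bsub>free_module R B\<^esub> free_gen R b"

definition restrict_scalars ::
    "('k \<Rightarrow> 'r) \<Rightarrow> ('r, 'a, 'x) module_scheme \<Rightarrow> ('k, 'a) module" where
  "restrict_scalars \<phi> M =
    \<lparr>carrier = carrier M, mult = undefined, one = undefined,
     zero = \<zero>\<^bsub>M\<^esub>, add = add M, smult = (\<lambda>c x. \<phi> c \<odot>\<^bsub>M\<^esub> x)\<rparr>"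


section \<open>Exterior powers\<close>

definition exterior_relations ::
    "('r, 'x) ring_scheme \<Rightarrow> ('r, 'a, 'y) module_scheme \<Rightarrow> nat \<Rightarrow> ('a list \<Rightarrow> 'r) set" where
  "exterior_relations R M m =
    (let T = {xs. length xs = m \<and> set xs \<subseteq> carrier M};
         F = free_module R T;
         e = free_gen R
     in {e (xs[i := x \<oplus>\<^bsub>M\<^esub> y]) \<ominus>\<^bsub>F\<^esub> (e (xs[i := x]) \<oplus>\<^bsub>F\<^esub> e (xs[i := y])) | xs i x y.
            xs \<in> T \<and> i < m \<and> x \<in> carrier M \<and> y \<in> carrier M}
      \<union> {e (xs[i := a \<odot>\<^bsub>M\<^esub> x]) \<ominus>\<^bsub>F\<^esub> a \<odot>\<^bsub>F\<^esub> e (xs[i := x]) | xs i a x.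
            xs \<in> T \<and> i < m \<and> a \<in> carrier R \<and> x \<in> carrier M}
      \<union> {e xs | xs i j. xs \<in> T \<and> i < j \<and> j < m \<and> xs ! i = xs ! j})"

definition exterior_power ::
    "('r, 'x) ring_scheme \<Rightarrow> ('r, 'a, 'y) module_scheme \<Rightarrow> nat
      \<Rightarrow> ('r, ('a list \<Rightarrow> 'r) set) module" where
  "exterior_power R M m =
    presented_module R {xs. length xs = m \<and> set xs \<subseteq> carrier M} (exterior_relations R M m)"

text \<open>\<open>wedge R M [y\<^sub>1, \<dots>, y\<^sub>m]\<close> is the element \<open>y\<^sub>1 \<and> \<dots> \<and> y\<^sub>m\<close> of the \<open>m\<close>-th exterior power.\<close>

definition wedge ::
    "('r, 'x) ring_scheme \<Rightarrow> ('r, 'a, 'y) module_scheme \<Rightarrow> 'a list \<Rightarrow> ('a list \<Rightarrow> 'r) set" where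
  "wedge R M xs =
    presented_gen R {ys. length ys = length xs \<and> set ys \<subseteq> carrier M}
      (exterior_relations R M (length xs)) xs"


section \<open>Kaehler differentials\<close>

text \<open>\<open>R\<close> is a commutative \<open>K\<close>-algebra with structure map \<open>\<phi>\<close>. The generator indexed by
  \<open>x \<in> R\<close> is the symbol \<open>d x\<close>.\<close>

definition kaehler_relations ::
    "('k, 'z) ring_scheme \<Rightarrow> ('k \<Rightarrow> 'r) \<Rightarrow> ('r, 'x) ring_scheme \<Rightarrow> ('r \<Rightarrow> 'r) set" where
  "kaehler_relations K \<phi> R =
    (let F = free_module R (carrier R);
         e = free_gen R
     in {e (x \<oplus>\<^bsub>R\<^esub> y) \<ominus>\<^bsub>F\<^esub> (e x \<oplus>\<^bsub>F\<^esub> e y) | x y. x \<in> carrier R \<and> y \<in> carrier R}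
      \<union> {e (x \<otimes>\<^bsub>R\<^esub> y) \<ominus>\<^bsub>F\<^esub> (x \<odot>\<^bsub>F\<^esub> e y \<oplus>\<^bsub>F\<^esub> y \<odot>\<^bsub>F\<^esub> e x) | x y.
            x \<in> carrier R \<and> y \<in> carrier R}
      \<union> {e (\<phi> c) | c. c \<in> carrier K})"

definition kaehler_module ::
    "('k, 'z) ring_scheme \<Rightarrow> ('k \<Rightarrow> 'r) \<Rightarrow> ('r, 'x) ring_scheme
      \<Rightarrow> ('r, ('r \<Rightarrow> 'r) set) module" where
  "kaehler_module K \<phi> R = presented_module R (carrier R) (kaehler_relations K \<phi> R)"

definition kaehler_d ::
    "('k, 'z) ring_scheme \<Rightarrow> ('k \<Rightarrow> 'r) \<Rightarrow> ('r, 'x) ring_scheme \<Rightarrow> 'r \<Rightarrow> ('r \<Rightarrow> 'r) set" where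
  "kaehler_d K \<phi> R x = presented_gen R (carrier R) (kaehler_relations K \<phi> R) x"


section \<open>Polynomials in \<open>X\<^sub>0, \<dots>, X\<^sub>n\<close>\<close>

text \<open>A monomial is its exponent vector.\<close>

type_synonym 'k mpoly = "(nat \<Rightarrow>\<^sub>0 nat) \<Rightarrow>\<^sub>0 'k"

definition poly_ring :: "nat \<Rightarrow> ('k::comm_ring_1) mpoly ring" where
  "poly_ring n =
    \<lparr>carrier = {F. \<forall>\<alpha>\<in>Poly_Mapping.keys F. Poly_Mapping.keys \<alpha> \<subseteq> {..n}},
     mult = (*), one = 1, zero = 0, add = (+)\<rparr>"

definition const_poly :: "'k::comm_ring_1 \<Rightarrow> 'k mpoly" where
  "const_poly c = Poly_Mapping.single 0 c"

definition var_poly :: "nat \<Rightarrow> ('k::comm_ring_1) mpoly" where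
  "var_poly j = Poly_Mapping.single (Poly_Mapping.single j 1) 1"

definition eval_mpoly :: "(nat \<Rightarrow> 'k) \<Rightarrow> ('k::comm_ring_1) mpoly \<Rightarrow> 'k" where
  "eval_mpoly v F =
    (\<Sum>\<alpha>\<in>Poly_Mapping.keys F.
       Poly_Mapping.lookup F \<alpha> * (\<Prod>j\<in>Poly_Mapping.keys \<alpha>. v j ^ Poly_Mapping.lookup \<alpha> j))"

text \<open>The zero polynomial is homogeneous of every degree.\<close>

definition homogeneous :: "nat \<Rightarrow> ('k::comm_ring_1) mpoly \<Rightarrow> bool" where
  "homogeneous d F \<longleftrightarrow>
    (\<forall>\<alpha>\<in>Poly_Mapping.keys F. (\<Sum>j\<in>Poly_Mapping.keys \<alpha>. Poly_Mapping.lookup \<alpha> j) = d)"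


section \<open>Fat points\<close>

text \<open>A \<open>K\<close>-rational point of projective \<open>n\<close>-space is the set of all its vectors of homogeneous
  coordinates. Coordinate vectors are functions on \<open>nat\<close> that vanish beyond \<open>n\<close>.\<close>

definition proj_space :: "nat \<Rightarrow> (nat \<Rightarrow> 'k::field) set set" where
  "proj_space n = {{(\<lambda>j. c * v j) | c. c \<noteq> 0} | v. v \<noteq> (\<lambda>_. 0) \<and> (\<forall>j>n. v j = 0)}"

definition point_ideal :: "nat \<Rightarrow> (nat \<Rightarrow> 'k::field) set \<Rightarrow> 'k mpoly set" where
  "point_ideal n p =
    genideal (poly_ring n)
      {F \<in> carrier (poly_ring n). (\<exists>d. homogeneous d F) \<and> (\<forall>v\<in>p. eval_mpoly v F = 0)}"

definition fat_point_ideal ::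
    "nat \<Rightarrow> nat \<Rightarrow> (nat \<Rightarrow> (nat \<Rightarrow> 'k::field) set) \<Rightarrow> (nat \<Rightarrow> nat) \<Rightarrow> 'k mpoly set" where
  "fat_point_ideal n t p \<mu> =
    (\<Inter>i\<in>{1..t}. point_ideal n (p i) [^]\<^bsub>ideals_set (poly_ring n)\<^esub> \<mu> i)"


section \<open>Differential forms on the coordinate ring\<close>

definition coord_ring :: "nat \<Rightarrow> ('k::field) mpoly set \<Rightarrow> 'k mpoly set ring" where
  "coord_ring n I = poly_ring n Quot I"

definition coord_class :: "nat \<Rightarrow> ('k::field) mpoly set \<Rightarrow> 'k mpoly \<Rightarrow> 'k mpoly set" where
  "coord_class n I F = I +>\<^bsub>poly_ring n\<^esub> F"

definition coord_comp :: "nat \<Rightarrow> ('k::field) mpoly set \<Rightarrow> nat \<Rightarrow> 'k mpoly set set" where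
  "coord_comp n I d = coord_class n I ` {F \<in> carrier (poly_ring n). homogeneous d F}"

definition base_map :: "nat \<Rightarrow> ('k::field) mpoly set \<Rightarrow> 'k \<Rightarrow> 'k mpoly set" where
  "base_map n I c = coord_class n I (const_poly c)"

definition one_forms ::
    "nat \<Rightarrow> ('k::field) mpoly set
      \<Rightarrow> ('k mpoly set, ('k mpoly set \<Rightarrow> 'k mpoly set) set) module" where
  "one_forms n I = kaehler_module (class_ring :: 'k ring) (base_map n I) (coord_ring n I)"

definition dx :: "nat \<Rightarrow> ('k::field) mpoly set \<Rightarrow> nat \<Rightarrow> ('k mpoly set \<Rightarrow> 'k mpoly set) set" where
  "dx n I j = kaehler_d (class_ring :: 'k ring) (base_map n I) (coord_ring n I)
     (coord_class n I (var_poly j))"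

definition diff_forms ::
    "nat \<Rightarrow> ('k::field) mpoly set \<Rightarrow> nat
      \<Rightarrow> ('k mpoly set, (('k mpoly set \<Rightarrow> 'k mpoly set) set list \<Rightarrow> 'k mpoly set) set) module" where
  "diff_forms n I m = exterior_power (coord_ring n I) (one_forms n I) m"

text \<open>The homogeneous component of degree \<open>i\<close> of the module of \<open>m\<close>-forms, as a \<open>K\<close>-vector space:
  since \<open>deg (dx\<^sub>j) = 1\<close>, it is spanned by the forms \<open>r dx\<^sub>j\<^sub>1 \<and> \<dots> \<and> dx\<^sub>j\<^sub>m\<close> with \<open>r\<close> homogeneous of
  degree \<open>i - m\<close>.\<close>

definition diff_forms_comp ::
    "nat \<Rightarrow> ('k::field) mpoly set \<Rightarrow> nat \<Rightarrow> nat
      \<Rightarrow> ('k, (('k mpoly set \<Rightarrow> 'k mpoly set) set list \<Rightarrow> 'k mpoly set) set) module" where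
  "diff_forms_comp n I m i =
    (let V = restrict_scalars (base_map n I) (diff_forms n I m)
     in V\<lparr>carrier := LinearCombinations.module.span class_ring V
           {r \<odot>\<^bsub>diff_forms n I m\<^esub> wedge (coord_ring n I) (one_forms n I) (map (dx n I) js) | r js d.
              d + m = i \<and> r \<in> coord_comp n I d \<and> length js = m \<and> set js \<subseteq> {..n}}\<rparr>)"

text \<open>\<open>V i\<close> is the degree-\<open>i\<close> component of a graded module; \<open>has_HP K V c\<close> says that the
  dimensions of these components are finite and equal to \<open>c\<close> for all large \<open>i\<close>.\<close>

definition has_HP :: "('k, 'z) ring_scheme \<Rightarrow> (nat \<Rightarrow> ('k, 'a, 'x) module_scheme) \<Rightarrow> nat \<Rightarrow> bool" where
  "has_HP K V c \<longleftrightarrow>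
    (\<forall>\<^sub>F i in sequentially.
      vectorspace K (V i) \<and> vectorspace.fin_dim K (V i) \<and> vectorspace.dim K (V i) = c)"

end

theory Submission
  imports Defs "Jordan_Normal_Form.Determinant"
begin

text \<open>
Let \<open>p\<^sub>k = (1 : q\<^sub>k\<^sub>1 : \<dots> : q\<^sub>k\<^sub>n)\<close>, \<open>y\<^sub>0 = X\<^sub>0\<close>, \<open>y\<^sub>j = X\<^sub>j - q\<^sub>k\<^sub>j X\<^sub>0\<close>. For each \<open>k\<close> there is a form \<open>e\<^sub>k\<close> of degree
\<open>S\<close> that is congruent to \<open>X\<^sub>0\<close> to the power \<open>S\<close> modulo the \<open>k\<close>-th primary component and is a product of two
elements of all the other components. By the Leibniz rule \<open>e\<^sub>k dF = 0\<close> for \<open>F\<close> in the \<open>k\<close>-th component, so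
in high degree every differential form is a sum of local contributions \<open>e\<^sub>k y\<^sup>\<alpha> dy\<^sub>J\<close> in which \<open>y\<^sup>\<alpha>\<close> has
degree \<open>s < \<mu>\<^sub>k\<close> in \<open>y\<^sub>1, \<dots>, y\<^sub>n\<close>. For \<open>s + 2 \<le> \<mu>\<^sub>k\<close> there are no further relations. For \<open>s + 1 = \<mu>\<^sub>k\<close> the
relations are \<open>d(y\<^sup>\<beta>) dy\<^sub>K = 0\<close> with \<open>y\<^sup>\<beta>\<close> of degree \<open>\<mu>\<^sub>k\<close>; they eliminate the generators for which \<open>max J\<close> is at
least as large as every index occurring in \<open>\<alpha>\<close>, the form \<open>dy\<^sub>0\<close> for \<open>\<mu>\<^sub>k = 1\<close> excepted. Here one
divides by exponents up to \<open>\<mu>\<^sub>k\<close>, which is where the characteristic is used.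

The remaining generators are independent: the coefficients of \<open>F dG\<^sub>1 \<dots> dG\<^sub>m\<close>, and those of \<open>dF dG\<^sub>1 \<dots> dG\<^sub>m\<close>, with
respect to the \<open>dy\<^sub>J\<close> are Jacobian minors, and their Taylor coefficients of sufficiently low order vanish on the
relations because a derivation lowers the order of vanishing by at most one. These functionals form a
triangular system on the generators, and counting the generators gives the binomial formula.
\<close>

section \<open>Modules given by generators and relations\<close>

text \<open>Taylor coefficients are \<open>K\<close>-linear on differential forms but not
  \<open>R\<close>-linear. The universal property is therefore stated for additive values
  \<open>\<psi> f [g_1, ..., g_m]\<close> that carry the coefficient \<open>f\<close> as an argument
  of its own.

  The obstacle is the top local degree. If \<open>G\<close> vanishes to order \<open>\<mu>\<close>
  at a point, the coefficients of \<open>dG\<close> vanish only to order \<open>\<mu> - 1\<close>,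
  so Taylor coefficients of order \<open>\<mu> - 1\<close> are in general not well defined on forms.
  Passing from \<open>F dG_1 ... dG_m\<close> to its exterior derivative
  \<open>dF dG_1 ... dG_m\<close> kills the relations \<open>d(y^\<beta>) dy_K\<close>; the
  coefficients of order \<open>\<mu> - 2\<close> of the result are well defined and still see the
  terms of order \<open>\<mu> - 1\<close> in \<open>F\<close>. The leading term of
  \<open>d(y^\<alpha> dy_J)\<close> turns the largest variable \<open>y_p\<close> of
  \<open>y^\<alpha>\<close> into a differential, provided that \<open>p\<close> exceeds all of
  \<open>J\<close>; this is the origin of the criterion for surviving generators.

  In a fixed degree a power of \<open>y_0\<close> fills up each local monomial, so the number of
  generators is constant in high degree.\<close>

lemma free_module_simps:
  "zero (free_module R B) = (\<lambda>_. \<zero>\<^bsub>R\<^esub>)"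
  "f \<oplus>\<^bsub>free_module R B\<^esub> g = (\<lambda>b. f b \<oplus>\<^bsub>R\<^esub> g b)"
  "a \<odot>\<^bsub>free_module R B\<^esub> f = (\<lambda>b. a \<otimes>\<^bsub>R\<^esub> f b)"
  by (simp_all add: free_module_def)

lemma free_module_carrier:
  assumes "cring R"
  shows "f \<in> carrier (free_module R B) \<longleftrightarrow>
    (\<forall>b. f b \<in> carrier R) \<and> (\<forall>b. b \<notin> B \<longrightarrow> f b = \<zero>\<^bsub>R\<^esub>) \<and> finite {b. f b \<noteq> \<zero>\<^bsub>R\<^esub>}"
proof -
  interpret cring R by fact
  show ?thesis unfolding free_module_def by (auto; metis zero_closed)
qed

lemma free_module_is_module:
  assumes "cring R"
  shows "module R (free_module R B)"
proof -
  interpret cring R by fact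
  note carr = free_module_carrier[OF assms]
  have add_closed: "(\<lambda>b. f b \<oplus>\<^bsub>R\<^esub> g b) \<in> carrier (free_module R B)"
    if "f \<in> carrier (free_module R B)" "g \<in> carrier (free_module R B)" for f g
  proof -
    have "{b. f b \<oplus>\<^bsub>R\<^esub> g b \<noteq> \<zero>\<^bsub>R\<^esub>} \<subseteq> {b. f b \<noteq> \<zero>\<^bsub>R\<^esub>} \<union> {b. g b \<noteq> \<zero>\<^bsub>R\<^esub>}" by auto
    then show ?thesis using that unfolding carr by (auto intro: finite_subset)
  qed
  have smult_closed: "(\<lambda>b. a \<otimes>\<^bsub>R\<^esub> f b) \<in> carrier (free_module R B)"
    if "a \<in> carrier R" "f \<in> carrier (free_module R B)" for f a
  proof -
    have "{b. a \<otimes>\<^bsub>R\<^esub> f b \<noteq> \<zero>\<^bsub>R\<^esub>} \<subseteq> {b. f b \<noteq> \<zero>\<^bsub>R\<^esub>}" using that by auto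
    then show ?thesis using that unfolding carr by (auto intro: finite_subset)
  qed
  have uminus: "(\<lambda>b. \<ominus>\<^bsub>R\<^esub> f b) \<in> carrier (free_module R B)"
    if "f \<in> carrier (free_module R B)" for f
  proof -
    have "{b. \<ominus>\<^bsub>R\<^esub> f b \<noteq> \<zero>\<^bsub>R\<^esub>} \<subseteq> {b. f b \<noteq> \<zero>\<^bsub>R\<^esub>}" by auto
    then show ?thesis using that unfolding carr by (auto intro: finite_subset)
  qed
  show ?thesis
  proof (rule moduleI)
    show "cring R" by fact
    show "abelian_group (free_module R B)"
    proof (rule abelian_groupI, goal_cases)
      case 1 then show ?case using add_closed by (simp add: free_module_simps)
    next
      case 2 then show ?case by (simp add: carr free_module_simps)
    next
      case 3 then show ?case by (auto simp add: carr free_module_simps a_assoc)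
    next
      case 4 then show ?case by (auto simp add: carr free_module_simps a_comm)
    next
      case 5 then show ?case by (auto simp add: carr free_module_simps)
    next
      case (6 x)
      then have "(\<lambda>b. \<ominus>\<^bsub>R\<^esub> x b) \<oplus>\<^bsub>free_module R B\<^esub> x = \<zero>\<^bsub>free_module R B\<^esub>"
        by (auto simp: free_module_simps carr l_neg)
      then show ?case using uminus[OF 6] by blast
    qed
  qed (auto simp: free_module_simps carr smult_closed[unfolded carr] add_closed l_distr r_distr m_assoc)
qed

lemma free_gen_carrier:
  assumes "cring R" "b \<in> B"
  shows "free_gen R b \<in> carrier (free_module R B)"
proof -
  interpret cring R by fact
  have "{b'. free_gen R b b' \<noteq> \<zero>\<^bsub>R\<^esub>} \<subseteq> {b}" by (auto simp: free_gen_def)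
  then have "finite {b'. free_gen R b b' \<noteq> \<zero>\<^bsub>R\<^esub>}" by (rule finite_subset) simp
  then show ?thesis using assms(2) by (auto simp: free_module_carrier[OF assms(1)] free_gen_def)
qed

text \<open>Bridge between two notions: spans are submodules, while cosets are taken by additive
  subgroups. Negation is scaling by \<open>-1\<close>.\<close>

lemma submodule_abelian_subgroup:
  assumes "submodule R U M"
  shows "abelian_subgroup U M"
proof -
  interpret U: LinearCombinations.submodule R U M by fact
  interpret Module.module R M by (rule U.module)
  have inv: "\<ominus>\<^bsub>M\<^esub> a \<in> U" if "a \<in> U" for a
  proof -
    have "(\<ominus>\<^bsub>R\<^esub> \<one>\<^bsub>R\<^esub>) \<odot>\<^bsub>M\<^esub> a \<in> U" using that by (intro U.smult_closed) auto
    moreover have "a \<in> carrier M" using that U.subset by blast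
    ultimately show ?thesis by (simp only: smult_minus_1)
  qed
  show ?thesis
  proof (rule abelian_subgroupI3)
    show "additive_subgroup U M"
    proof (rule additive_subgroup.intro, rule group.subgroupI[OF a_group])
      show "U \<noteq> {}" using U.zero_closed by blast
    qed (use U.subset inv in \<open>auto simp: a_inv_def\<close>)
    show "abelian_group M" by (rule abelian_group_axioms)
  qed
qed

lemma quotient_module_simps:
  "carrier (quotient_module M U) = a_rcosets\<^bsub>M\<^esub> U"
  "zero (quotient_module M U) = U"
  "add (quotient_module M U) = set_add M"
  by (simp_all add: quotient_module_def)

text \<open>Since \<open>a\<close> maps \<open>U\<close> into itself, the cosets of the multiples
  \<open>a y\<close> agree for all \<open>y\<close> in the given coset, so the union in the
  definition of the quotient collapses to a single coset.\<close>

lemma quotient_module_smult: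
  assumes "submodule R U M" "a \<in> carrier R" "x \<in> carrier M"
  shows "a \<odot>\<^bsub>quotient_module M U\<^esub> (U +>\<^bsub>M\<^esub> x) = U +>\<^bsub>M\<^esub> (a \<odot>\<^bsub>M\<^esub> x)"
proof -
  interpret U: LinearCombinations.submodule R U M by fact
  interpret Module.module R M by (rule U.module)
  interpret S: abelian_subgroup U M by (rule submodule_abelian_subgroup) fact
  have "U +>\<^bsub>M\<^esub> (a \<odot>\<^bsub>M\<^esub> y) = U +>\<^bsub>M\<^esub> (a \<odot>\<^bsub>M\<^esub> x)" if y: "y \<in> U +>\<^bsub>M\<^esub> x" for y
  proof -
    from y obtain u where u: "u \<in> U" "y = u \<oplus>\<^bsub>M\<^esub> x" by (auto simp: a_r_coset_def')
    have uc: "u \<in> carrier M" using u U.subset by auto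
    have "a \<odot>\<^bsub>M\<^esub> y = (a \<odot>\<^bsub>M\<^esub> u) \<oplus>\<^bsub>M\<^esub> (a \<odot>\<^bsub>M\<^esub> x)"
      using u uc assms by (simp add: smult_r_distr)
    moreover have "a \<odot>\<^bsub>M\<^esub> u \<in> U" using u assms by simp
    ultimately have "a \<odot>\<^bsub>M\<^esub> y \<in> U +>\<^bsub>M\<^esub> (a \<odot>\<^bsub>M\<^esub> x)" by (auto simp: a_r_coset_def')
    then show ?thesis
      using S.a_repr_independence'[of "a \<odot>\<^bsub>M\<^esub> y" "a \<odot>\<^bsub>M\<^esub> x"] assms by simp
  qed
  moreover have "x \<in> U +>\<^bsub>M\<^esub> x" using assms S.a_rcos_self by auto
  ultimately have "(\<Union>y\<in>U +>\<^bsub>M\<^esub> x. U +>\<^bsub>M\<^esub> (a \<odot>\<^bsub>M\<^esub> y)) = U +>\<^bsub>M\<^esub> (a \<odot>\<^bsub>M\<^esub> x)"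
    by blast
  then show ?thesis by (simp add: quotient_module_def)
qed

lemma quotient_module_add:
  assumes "submodule R U M" "x \<in> carrier M" "y \<in> carrier M"
  shows "(U +>\<^bsub>M\<^esub> x) \<oplus>\<^bsub>quotient_module M U\<^esub> (U +>\<^bsub>M\<^esub> y) = U +>\<^bsub>M\<^esub> (x \<oplus>\<^bsub>M\<^esub> y)"
proof -
  interpret S: abelian_subgroup U M by (rule submodule_abelian_subgroup) fact
  show ?thesis using assms by (simp add: quotient_module_simps S.a_rcos_sum)
qed

lemma quotient_module_carrier:
  "X \<in> carrier (quotient_module M U) \<longleftrightarrow> (\<exists>x\<in>carrier M. X = U +>\<^bsub>M\<^esub> x)"
  by (auto simp: quotient_module_simps A_RCOSETS_def')

lemma quotient_module_is_module:
  assumes "submodule R U M"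
  shows "module R (quotient_module M U)"
proof -
  interpret U: LinearCombinations.submodule R U M by fact
  interpret Module.module R M by (rule U.module)
  interpret S: abelian_subgroup U M by (rule submodule_abelian_subgroup) fact
  have zero: "\<zero>\<^bsub>quotient_module M U\<^esub> = U +>\<^bsub>M\<^esub> \<zero>\<^bsub>M\<^esub>"
    using U.subset by (simp add: quotient_module_simps)
  have ab: "abelian_group (quotient_module M U)"
  proof (rule abelian_groupI)
    fix X assume "X \<in> carrier (quotient_module M U)"
    then obtain x where "x \<in> carrier M" "X = U +>\<^bsub>M\<^esub> x" by (auto simp: quotient_module_carrier)
    then show "\<exists>Y\<in>carrier (quotient_module M U). Y \<oplus>\<^bsub>quotient_module M U\<^esub> X = \<zero>\<^bsub>quotient_module M U\<^esub>"
      by (intro bexI[of _ "U +>\<^bsub>M\<^esub> (\<ominus>\<^bsub>M\<^esub> x)"])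
        (auto simp: quotient_module_carrier quotient_module_add[OF assms] zero l_neg)
  qed (auto simp: quotient_module_carrier quotient_module_add[OF assms] zero a_ac simp del: S.a_rcos_sum)
  note [simp] = quotient_module_smult[OF assms] quotient_module_add[OF assms]
  show ?thesis
  proof (rule moduleI[OF R.cring_axioms ab], goal_cases)
    case (1 a x)
    then obtain y where "y \<in> carrier M" "x = U +>\<^bsub>M\<^esub> y" by (auto simp: quotient_module_carrier)
    then show ?case using 1 by (auto simp: quotient_module_carrier)
  next
    case (2 a b x)
    then obtain y where "y \<in> carrier M" "x = U +>\<^bsub>M\<^esub> y" by (auto simp: quotient_module_carrier)
    then show ?case using 2 by (simp add: smult_l_distr)
  next
    case (3 a x x')
    then obtain y y' where "y \<in> carrier M" "x = U +>\<^bsub>M\<^esub> y" "y' \<in> carrier M" "x' = U +>\<^bsub>M\<^esub> y'"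
      by (auto simp: quotient_module_carrier)
    then show ?case using 3 by (simp add: smult_r_distr)
  next
    case (4 a b x)
    then obtain y where "y \<in> carrier M" "x = U +>\<^bsub>M\<^esub> y" by (auto simp: quotient_module_carrier)
    then show ?case using 4 by (simp add: smult_assoc1)
  next
    case (5 x)
    then obtain y where "y \<in> carrier M" "x = U +>\<^bsub>M\<^esub> y" by (auto simp: quotient_module_carrier)
    then show ?case by simp
  qed
qed

lemma quotient_module_eq_iff:
  assumes "submodule R U M" "x \<in> carrier M" "y \<in> carrier M"
  shows "U +>\<^bsub>M\<^esub> x = U +>\<^bsub>M\<^esub> y \<longleftrightarrow> x \<ominus>\<^bsub>M\<^esub> y \<in> U"
proof -
  interpret S: abelian_subgroup U M by (rule submodule_abelian_subgroup) fact
  have "U +>\<^bsub>M\<^esub> x = U +>\<^bsub>M\<^esub> y \<longleftrightarrow> x \<in> U +>\<^bsub>M\<^esub> y"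
    using S.a_repr_independence'[of x y] S.a_rcos_self[of x] assms by auto
  also have "\<dots> \<longleftrightarrow> x \<oplus>\<^bsub>M\<^esub> \<ominus>\<^bsub>M\<^esub> y \<in> U"
    using S.a_rcos_module_imp[of y x] S.a_rcos_module_rev[of y x] assms by blast
  finally show ?thesis by (simp add: a_minus_def)
qed

text \<open>The common frame of the module of differentials and of its exterior powers, each of
  which is a free module modulo the span of explicit relations.\<close>

locale presentation =
  fixes R :: "('r, 'x) ring_scheme" and B :: "'b set" and S :: "('b \<Rightarrow> 'r) set"
  assumes cring: "cring R" and rel: "S \<subseteq> carrier (free_module R B)"
begin

abbreviation "F \<equiv> free_module R B"
abbreviation "U \<equiv> LinearCombinations.module.span R F S"
abbreviation "Q \<equiv> presented_module R B S"
abbreviation "cls x \<equiv> U +>\<^bsub>F\<^esub> x"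

sublocale F: Module.module R F by (rule free_module_is_module) (rule cring)

lemma Q_def: "Q = quotient_module F U" by (simp add: presented_module_def)

lemma sub: "submodule R U F" by (rule F.span_is_submodule) (rule rel)

sublocale Q: Module.module R Q unfolding Q_def by (rule quotient_module_is_module) (rule sub)

lemma cls_closed: "x \<in> carrier F \<Longrightarrow> cls x \<in> carrier Q"
  unfolding Q_def by (auto simp: quotient_module_carrier)

lemma cls_add: "x \<in> carrier F \<Longrightarrow> y \<in> carrier F \<Longrightarrow> cls x \<oplus>\<^bsub>Q\<^esub> cls y = cls (x \<oplus>\<^bsub>F\<^esub> y)"
  unfolding Q_def by (rule quotient_module_add) (rule sub)

lemma cls_smult: "a \<in> carrier R \<Longrightarrow> x \<in> carrier F \<Longrightarrow> a \<odot>\<^bsub>Q\<^esub> cls x = cls (a \<odot>\<^bsub>F\<^esub> x)"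
  unfolding Q_def by (rule quotient_module_smult) (rule sub)

lemma cls_eq_iff: "x \<in> carrier F \<Longrightarrow> y \<in> carrier F \<Longrightarrow> cls x = cls y \<longleftrightarrow> x \<ominus>\<^bsub>F\<^esub> y \<in> U"
  by (rule quotient_module_eq_iff) (rule sub)

lemma Q_carrierE:
  assumes "X \<in> carrier Q" obtains x where "x \<in> carrier F" "X = cls x"
  using assms unfolding Q_def by (auto simp: quotient_module_carrier)

lemma cls_self: "x \<in> carrier F \<Longrightarrow> x \<in> cls x"
proof -
  interpret S: abelian_subgroup U F by (rule submodule_abelian_subgroup) (rule sub)
  show "x \<in> carrier F \<Longrightarrow> x \<in> cls x" by (rule S.a_rcos_self)
qed

lemma cls_eqI: "y \<in> cls x \<Longrightarrow> x \<in> carrier F \<Longrightarrow> y \<in> carrier F \<and> cls y = cls x"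
proof -
  interpret S: abelian_subgroup U F by (rule submodule_abelian_subgroup) (rule sub)
  show "y \<in> cls x \<Longrightarrow> x \<in> carrier F \<Longrightarrow> y \<in> carrier F \<and> cls y = cls x"
    using S.a_repr_independence' S.a_elemrcos_carrier by blast
qed

lemma free_gen: "b \<in> B \<Longrightarrow> free_gen R b \<in> carrier F"
  by (rule free_gen_carrier) (rule cring)

lemma rel_zero: "s \<in> S \<Longrightarrow> s \<in> U"
  using F.in_own_span[OF rel] by blast

text \<open>Maps out of the quotient are later defined by a formula at a chosen representative;
  independence of the choice is then proved for each such map.\<close>

definition rep where "rep X = (SOME x. x \<in> X)"

lemma rep:
  assumes "X \<in> carrier Q"
  shows "rep X \<in> carrier F" "cls (rep X) = X"
proof -
  obtain x where x: "x \<in> carrier F" "X = cls x" using Q_carrierE[OF assms] by blast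
  have "rep X \<in> X" unfolding rep_def using someI[of "\<lambda>x. x \<in> X", OF cls_self[OF x(1), folded x(2)]] .
  then show "rep X \<in> carrier F" "cls (rep X) = X" using cls_eqI[of "rep X" x] x by auto
qed

end

section \<open>Multiderivations\<close>

text \<open>The left copy of \<open>x\<close> moves to the right by adjacent swaps, each costing
  only a sign, until the two copies meet. Membership in \<open>C\<close> and the length
  \<open>m\<close> are carried along because the hypotheses speak of admissible lists only.\<close>

lemma alternating_lists:
  fixes \<phi> :: "'a list \<Rightarrow> 'b::ab_group_add"
  assumes swap: "\<And>as x y bs. set (as @ x # y # bs) \<subseteq> C \<Longrightarrow> length (as @ x # y # bs) = m
      \<Longrightarrow> \<phi> (as @ x # y # bs) = - \<phi> (as @ y # x # bs)"
    and adj: "\<And>as x bs. set (as @ x # x # bs) \<subseteq> C \<Longrightarrow> length (as @ x # x # bs) = m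
      \<Longrightarrow> \<phi> (as @ x # x # bs) = 0"
    and "set (as @ x # bs @ x # cs) \<subseteq> C" "length (as @ x # bs @ x # cs) = m"
  shows "\<phi> (as @ x # bs @ x # cs) = 0"
  using assms(3,4)
proof (induction bs arbitrary: as)
  case Nil
  then show ?case using adj[of as x cs] by simp
next
  case (Cons y bs)
  have "\<phi> (as @ x # y # (bs @ x # cs)) = - \<phi> (as @ y # x # (bs @ x # cs))"
    using Cons.prems by (intro swap) auto
  also have "\<phi> ((as @ [y]) @ x # bs @ x # cs) = 0"
    using Cons.prems by (intro Cons.IH) auto
  then have "- \<phi> (as @ y # x # (bs @ x # cs)) = 0" by simp
  finally show ?case by simp
qed

text \<open>Off-diagonal terms cancel in pairs. The diagonal is a separate hypothesis, because
  antisymmetry alone gives only \<open>t x x + t x x = 0\<close>, which is weaker in characteristic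
  2.\<close>

lemma sum_antisymmetric:
  fixes t :: "'a \<Rightarrow> 'a \<Rightarrow> 'b::ab_group_add"
  assumes "finite A" "\<And>x. x \<in> A \<Longrightarrow> t x x = 0" "\<And>x y. x \<in> A \<Longrightarrow> y \<in> A \<Longrightarrow> t x y = - t y x"
  shows "(\<Sum>x\<in>A. \<Sum>y\<in>A. t x y) = 0"
  using assms
proof (induction A rule: finite_induct)
  case (insert a A)
  have "(\<Sum>x\<in>insert a A. \<Sum>y\<in>insert a A. t x y)
      = t a a + (\<Sum>y\<in>A. t a y) + ((\<Sum>x\<in>A. t x a) + (\<Sum>x\<in>A. \<Sum>y\<in>A. t x y))"
    using insert.hyps by (simp add: sum.distrib)
  also have "(\<Sum>x\<in>A. t x a) = - (\<Sum>y\<in>A. t a y)"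
    unfolding sum_negf[symmetric] by (intro sum.cong refl insert.prems(2)) auto
  also have "t a a = 0" by (rule insert.prems(1)) simp
  also have "(\<Sum>x\<in>A. \<Sum>y\<in>A. t x y) = 0"
    by (intro insert.IH insert.prems) auto
  finally show ?case by simp
next
  case empty
  show ?case by simp
qed

text \<open>A value \<open>\<psi> f [g\<^sub>1, \<dots>, g\<^sub>m]\<close> is thought of as a value on \<open>f dg\<^sub>1 \<dots> dg\<^sub>m\<close>; \<open>ev\<close> extends it additively from the
  generators \<open>dg\<close> to elements of the free module in every slot.\<close>

fun ev :: "('r, 'x) ring_scheme \<Rightarrow> ('r \<Rightarrow> 'r list \<Rightarrow> 'v::ab_group_add) \<Rightarrow> 'r \<Rightarrow> ('r \<Rightarrow> 'r) list \<Rightarrow> 'v" where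
  "ev R \<psi> f [] = \<psi> f []"
| "ev R \<psi> f (u # us) = (\<Sum>g | u g \<noteq> \<zero>\<^bsub>R\<^esub>. ev R (\<lambda>f' gs. \<psi> f' (g # gs)) (f \<otimes>\<^bsub>R\<^esub> u g) us)"

text \<open>The values live in a mere abelian group. In place of linearity over \<open>R\<close>, a
  factor of a slot moves into the coefficient argument, as the Leibniz rule prescribes. Alternation
  is asked of adjacent slots only; polarization supplies the antisymmetry.\<close>

locale multiderivation = cring R
  for K :: "('k, 'z) ring_scheme" and \<phi> :: "'k \<Rightarrow> 'r" and R :: "('r, 'x) ring_scheme" (structure) +
  fixes m :: nat and \<psi> :: "'r \<Rightarrow> 'r list \<Rightarrow> 'v::ab_group_add"
  assumes base: "\<And>c. c \<in> carrier K \<Longrightarrow> \<phi> c \<in> carrier R"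
    and coeff_add: "\<And>f f' gs. \<lbrakk>f \<in> carrier R; f' \<in> carrier R; set gs \<subseteq> carrier R; length gs = m\<rbrakk>
      \<Longrightarrow> \<psi> (f \<oplus> f') gs = \<psi> f gs + \<psi> f' gs"
    and slot_add: "\<And>f as x y bs. \<lbrakk>f \<in> carrier R; set (as @ x # y # bs) \<subseteq> carrier R; length (as @ x # bs) = m\<rbrakk>
      \<Longrightarrow> \<psi> f (as @ (x \<oplus> y) # bs) = \<psi> f (as @ x # bs) + \<psi> f (as @ y # bs)"
    and slot_mult: "\<And>f as x y bs. \<lbrakk>f \<in> carrier R; set (as @ x # y # bs) \<subseteq> carrier R; length (as @ x # bs) = m\<rbrakk>
      \<Longrightarrow> \<psi> f (as @ (x \<otimes> y) # bs) = \<psi> (x \<otimes> f) (as @ y # bs) + \<psi> (y \<otimes> f) (as @ x # bs)"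
    and slot_const: "\<And>f as c bs. \<lbrakk>f \<in> carrier R; set (as @ bs) \<subseteq> carrier R; Suc (length (as @ bs)) = m; c \<in> carrier K\<rbrakk>
      \<Longrightarrow> \<psi> f (as @ \<phi> c # bs) = 0"
    and slot_alt: "\<And>f as x bs. \<lbrakk>f \<in> carrier R; set (as @ x # bs) \<subseteq> carrier R; length (as @ x # x # bs) = m\<rbrakk>
      \<Longrightarrow> \<psi> f (as @ x # x # bs) = 0"
begin

lemma slot_swap:
  assumes "f \<in> carrier R" "set (as @ x # y # bs) \<subseteq> carrier R" "length (as @ x # y # bs) = m"
  shows "\<psi> f (as @ x # y # bs) + \<psi> f (as @ y # x # bs) = 0"
proof -
  have "0 = \<psi> f (as @ (x \<oplus> y) # (x \<oplus> y) # bs)"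
    using assms by (intro slot_alt[symmetric]) auto
  also have "\<dots> = \<psi> f (as @ x # (x \<oplus> y) # bs) + \<psi> f (as @ y # (x \<oplus> y) # bs)"
    using assms by (intro slot_add) auto
  also have "\<psi> f (as @ x # (x \<oplus> y) # bs) = \<psi> f (as @ x # x # bs) + \<psi> f (as @ x # y # bs)"
    using assms slot_add[of f "as @ [x]" x y bs] by auto
  also have "\<psi> f (as @ y # (x \<oplus> y) # bs) = \<psi> f (as @ y # x # bs) + \<psi> f (as @ y # y # bs)"
    using assms slot_add[of f "as @ [y]" x y bs] by auto
  also have "\<psi> f (as @ x # x # bs) = 0" using assms by (intro slot_alt) auto
  also have "\<psi> f (as @ y # y # bs) = 0" using assms by (intro slot_alt) auto
  finally show ?thesis by simp
qed

text \<open>Freezing the first slot is the induction step of the arguments on \<open>ev\<close>,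
  which unfolds its list from the front.\<close>

lemma partial:
  assumes "m = Suc m'" "g \<in> carrier R"
  shows "multiderivation K \<phi> R m' (\<lambda>f gs. \<psi> f (g # gs))"
proof (intro multiderivation.intro multiderivation_axioms.intro, goal_cases)
  case 1 then show ?case by (rule cring_axioms)
next
  case 2 then show ?case by (rule base)
next
  case 3 then show ?case using assms by (intro coeff_add) auto
next
  case (4 f as x y bs) then show ?case using assms slot_add[of f "g # as" x y bs] by auto
next
  case (5 f as x y bs) then show ?case using assms slot_mult[of f "g # as" x y bs] by auto
next
  case (6 f as c bs) then show ?case using assms slot_const[of f "g # as" bs c] by auto
next
  case (7 f as x bs) then show ?case using assms slot_alt[of f "g # as" x bs] by auto
qed

end

section \<open>Formal properties of the extension \<open>ev\<close> to the free module\<close>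

context cring begin

abbreviation "F1 \<equiv> free_module R (carrier R)"

lemma F1_iff: "u \<in> carrier F1 \<longleftrightarrow> (\<forall>b. u b \<in> carrier R) \<and> (\<forall>b. u b \<noteq> \<zero> \<longrightarrow> b \<in> carrier R) \<and> finite {b. u b \<noteq> \<zero>}"
  unfolding free_module_carrier[OF cring_axioms] by auto

lemma ev_add_fun: "ev R (\<lambda>f gs. \<psi> f gs + \<psi>' f gs) f us = ev R \<psi> f us + ev R \<psi>' f us"
  by (induction us arbitrary: \<psi> \<psi>' f) (simp_all add: sum.distrib)

lemma ev_cong:
  assumes "\<And>f gs. f \<in> carrier R \<Longrightarrow> set gs \<subseteq> carrier R \<Longrightarrow> length gs = length us \<Longrightarrow> \<psi> f gs = \<psi>' f gs"
    and "f \<in> carrier R" "set us \<subseteq> carrier F1"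
  shows "ev R \<psi> f us = ev R \<psi>' f us"
  using assms
proof (induction us arbitrary: \<psi> \<psi>' f)
  case (Cons u us)
  show ?case
    unfolding ev.simps using Cons.prems by (intro sum.cong refl Cons.IH) (auto simp: F1_iff)
qed simp

lemma ev_zero_fun:
  assumes "\<And>f gs. f \<in> carrier R \<Longrightarrow> set gs \<subseteq> carrier R \<Longrightarrow> length gs = length us \<Longrightarrow> \<psi> f gs = 0"
    and "f \<in> carrier R" "set us \<subseteq> carrier F1"
  shows "ev R \<psi> f us = 0"
proof -
  have z: "ev R (\<lambda>f gs. 0) f us = 0" for f by (induction us arbitrary: f) simp_all
  show ?thesis using ev_cong[of us \<psi> "\<lambda>f gs. 0" f] assms z by simp
qed

lemma ev_hom:
  assumes "\<And>x y. h (x + y) = h x + h y" "f \<in> carrier R" "set us \<subseteq> carrier F1"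
  shows "ev R (\<lambda>f gs. h (\<psi> f gs)) f us = h (ev R \<psi> f us)"
proof -
  have h0: "h 0 = 0" using assms(1)[of 0 0] by simp
  have hs: "h (sum k A) = (\<Sum>x\<in>A. h (k x))" for k and A :: "'a set"
    by (induction A rule: infinite_finite_induct) (simp_all add: h0 assms(1))
  show ?thesis by (induction us arbitrary: \<psi> f) (simp_all add: hs)
qed

text \<open>\<open>ev\<close> only multiplies the coefficient by further entries, so a fixed factor
  can wait until \<open>\<psi>\<close> is applied.\<close>

lemma ev_coeff_mult:
  assumes "a \<in> carrier R" "f \<in> carrier R" "set us \<subseteq> carrier F1"
  shows "ev R \<psi> (a \<otimes> f) us = ev R (\<lambda>f gs. \<psi> (a \<otimes> f) gs) f us"
  using assms
proof (induction us arbitrary: \<psi> f)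
  case (Cons u us)
  have "ev R (\<lambda>f' gs. \<psi> f' (g # gs)) (a \<otimes> f \<otimes> u g) us = ev R (\<lambda>f' gs. \<psi> (a \<otimes> f') (g # gs)) (f \<otimes> u g) us" for g
  proof -
    have "u g \<in> carrier R" using Cons.prems by (auto simp: F1_iff)
    then show ?thesis using Cons by (simp add: m_assoc)
  qed
  then show ?case by simp
qed simp

end

context multiderivation begin

lemma ev_coeff_add:
  assumes "f \<in> carrier R" "f' \<in> carrier R" "set us \<subseteq> carrier F1" "length us = m"
  shows "ev R \<psi> (f \<oplus> f') us = ev R \<psi> f us + ev R \<psi> f' us"
  using assms multiderivation_axioms
proof (induction us arbitrary: \<psi> f f' m)
  case Nil
  interpret multiderivation K \<phi> R m \<psi> by (rule Nil.prems)
  show ?case using Nil by (simp add: coeff_add)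
next
  case (Cons u us)
  interpret multiderivation K \<phi> R m \<psi> by (rule Cons.prems)
  have "ev R (\<lambda>f' gs. \<psi> f' (g # gs)) ((f \<oplus> f') \<otimes> u g) us
     = ev R (\<lambda>f' gs. \<psi> f' (g # gs)) (f \<otimes> u g) us + ev R (\<lambda>f' gs. \<psi> f' (g # gs)) (f' \<otimes> u g) us"
    if "g \<in> {g. u g \<noteq> \<zero>}" for g
  proof -
    have ug: "u g \<in> carrier R" "g \<in> carrier R" using Cons.prems that by (auto simp: F1_iff)
    show ?thesis
      using Cons.prems ug partial[of "length us" g] by (simp add: l_distr) (intro Cons.IH, auto)
  qed
  then show ?case by (simp add: sum.distrib)
qed

lemma ev_coeff_zero:
  assumes "set us \<subseteq> carrier F1" "length us = m"
  shows "ev R \<psi> \<zero> us = 0"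
proof -
  have "ev R \<psi> (\<zero> \<oplus> \<zero>) us = ev R \<psi> \<zero> us + ev R \<psi> \<zero> us"
    by (rule ev_coeff_add) (use assms in auto)
  then show ?thesis by simp
qed

text \<open>Terms outside the support have coefficient zero. The enlarged index set lets the sums
  for \<open>u\<close>, \<open>v\<close> and their sum, whose supports differ, be compared term by
  term.\<close>

lemma ev_Cons_superset:
  assumes "f \<in> carrier R" "u \<in> carrier F1" "set us \<subseteq> carrier F1" "Suc (length us) = m"
    and "finite A" "A \<subseteq> carrier R" "{g. u g \<noteq> \<zero>} \<subseteq> A"
  shows "ev R \<psi> f (u # us) = (\<Sum>g\<in>A. ev R (\<lambda>f' gs. \<psi> f' (g # gs)) (f \<otimes> u g) us)"
proof -
  have "ev R (\<lambda>f' gs. \<psi> f' (g # gs)) (f \<otimes> u g) us = 0" if "g \<in> A - {g. u g \<noteq> \<zero>}" for g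
  proof -
    interpret P: multiderivation K \<phi> R "length us" "\<lambda>f gs. \<psi> f (g # gs)"
      using assms that by (intro partial) auto
    show ?thesis using that assms P.ev_coeff_zero[of us] by simp
  qed
  then show ?thesis
    unfolding ev.simps using assms(5,7) by (intro sum.mono_neutral_left) auto
qed

lemma ev_slot_add:
  assumes "f \<in> carrier R" "set (as @ u # v # bs) \<subseteq> carrier F1" "length (as @ u # bs) = m"
  shows "ev R \<psi> f (as @ (u \<oplus>\<^bsub>F1\<^esub> v) # bs) = ev R \<psi> f (as @ u # bs) + ev R \<psi> f (as @ v # bs)"
  using assms multiderivation_axioms
proof (induction as arbitrary: \<psi> f m)
  case Nil
  interpret multiderivation K \<phi> R m \<psi> by (rule Nil.prems)
  interpret F: Module.module R F1 by (rule free_module_is_module) (rule cring_axioms)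
  let ?A = "{g. u g \<noteq> \<zero>} \<union> {g. v g \<noteq> \<zero>}"
  have A: "finite ?A" "?A \<subseteq> carrier R" "{g. (u \<oplus>\<^bsub>F1\<^esub> v) g \<noteq> \<zero>} \<subseteq> ?A"
    using Nil.prems by (auto simp: F1_iff free_module_simps)
  have uv: "u \<oplus>\<^bsub>F1\<^esub> v \<in> carrier F1" using Nil.prems by (intro F.add.m_closed) auto
  have "ev R (\<lambda>f' gs. \<psi> f' (g # gs)) (f \<otimes> (u \<oplus>\<^bsub>F1\<^esub> v) g) bs =
    ev R (\<lambda>f' gs. \<psi> f' (g # gs)) (f \<otimes> u g) bs + ev R (\<lambda>f' gs. \<psi> f' (g # gs)) (f \<otimes> v g) bs"
    if "g \<in> ?A" for g
  proof -
    have gc: "g \<in> carrier R" "u g \<in> carrier R" "v g \<in> carrier R"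
      using that Nil.prems by (auto simp: F1_iff)
    interpret P: multiderivation K \<phi> R "length bs" "\<lambda>f gs. \<psi> f (g # gs)"
      using Nil.prems gc by (intro partial) auto
    show ?thesis using gc Nil.prems
      by (simp add: free_module_simps r_distr P.ev_coeff_add)
  qed
  then have "(\<Sum>g\<in>?A. ev R (\<lambda>f' gs. \<psi> f' (g # gs)) (f \<otimes> (u \<oplus>\<^bsub>F1\<^esub> v) g) bs) =
    (\<Sum>g\<in>?A. ev R (\<lambda>f' gs. \<psi> f' (g # gs)) (f \<otimes> u g) bs) + (\<Sum>g\<in>?A. ev R (\<lambda>f' gs. \<psi> f' (g # gs)) (f \<otimes> v g) bs)"
    by (simp add: sum.distrib)
  moreover have "ev R \<psi> f ((u \<oplus>\<^bsub>F1\<^esub> v) # bs) = (\<Sum>g\<in>?A. ev R (\<lambda>f' gs. \<psi> f' (g # gs)) (f \<otimes> (u \<oplus>\<^bsub>F1\<^esub> v) g) bs)"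
    using Nil.prems uv A by (intro ev_Cons_superset) auto
  moreover have "ev R \<psi> f (u # bs) = (\<Sum>g\<in>?A. ev R (\<lambda>f' gs. \<psi> f' (g # gs)) (f \<otimes> u g) bs)"
    using Nil.prems uv A by (intro ev_Cons_superset) auto
  moreover have "ev R \<psi> f (v # bs) = (\<Sum>g\<in>?A. ev R (\<lambda>f' gs. \<psi> f' (g # gs)) (f \<otimes> v g) bs)"
    using Nil.prems uv A by (intro ev_Cons_superset) auto
  ultimately show ?case by (simp only: append.simps)
next
  case (Cons w as)
  interpret multiderivation K \<phi> R m \<psi> by (rule Cons.prems)
  have "ev R (\<lambda>f' gs. \<psi> f' (g # gs)) (f \<otimes> w g) (as @ (u \<oplus>\<^bsub>F1\<^esub> v) # bs)
     = ev R (\<lambda>f' gs. \<psi> f' (g # gs)) (f \<otimes> w g) (as @ u # bs) + ev R (\<lambda>f' gs. \<psi> f' (g # gs)) (f \<otimes> w g) (as @ v # bs)"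
    if "g \<in> {g. w g \<noteq> \<zero>}" for g
  proof -
    have ug: "w g \<in> carrier R" "g \<in> carrier R" using Cons.prems that by (auto simp: F1_iff)
    show ?thesis
      using Cons.prems ug by (intro Cons.IH[of _ "m - 1"] partial) auto
  qed
  then show ?case by (simp add: sum.distrib)
qed

lemma ev_slot_smult:
  assumes "f \<in> carrier R" "a \<in> carrier R" "set (as @ u # bs) \<subseteq> carrier F1" "length (as @ u # bs) = m"
  shows "ev R \<psi> f (as @ (a \<odot>\<^bsub>F1\<^esub> u) # bs) = ev R \<psi> (a \<otimes> f) (as @ u # bs)"
  using assms multiderivation_axioms
proof (induction as arbitrary: \<psi> f m)
  case Nil
  interpret multiderivation K \<phi> R m \<psi> by (rule Nil.prems)
  interpret F: Module.module R F1 by (rule free_module_is_module) (rule cring_axioms)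
  let ?A = "{g. u g \<noteq> \<zero>}"
  have A: "finite ?A" "?A \<subseteq> carrier R" "{g. (a \<odot>\<^bsub>F1\<^esub> u) g \<noteq> \<zero>} \<subseteq> ?A"
    using Nil.prems by (auto simp: F1_iff free_module_simps)
  have "ev R \<psi> f ((a \<odot>\<^bsub>F1\<^esub> u) # bs) = (\<Sum>g\<in>?A. ev R (\<lambda>f' gs. \<psi> f' (g # gs)) (f \<otimes> (a \<odot>\<^bsub>F1\<^esub> u) g) bs)"
    using Nil.prems A by (intro ev_Cons_superset) auto
  also have "\<dots> = (\<Sum>g\<in>?A. ev R (\<lambda>f' gs. \<psi> f' (g # gs)) ((a \<otimes> f) \<otimes> u g) bs)"
    using Nil.prems by (intro sum.cong refl) (auto simp: free_module_simps F1_iff m_ac)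
  finally show ?case by simp
next
  case (Cons w as)
  interpret multiderivation K \<phi> R m \<psi> by (rule Cons.prems)
  have "ev R (\<lambda>f' gs. \<psi> f' (g # gs)) (f \<otimes> w g) (as @ (a \<odot>\<^bsub>F1\<^esub> u) # bs)
     = ev R (\<lambda>f' gs. \<psi> f' (g # gs)) ((a \<otimes> f) \<otimes> w g) (as @ u # bs)"
    if "g \<in> {g. w g \<noteq> \<zero>}" for g
  proof -
    have ug: "w g \<in> carrier R" "g \<in> carrier R" using Cons.prems that by (auto simp: F1_iff)
    have "ev R (\<lambda>f' gs. \<psi> f' (g # gs)) (f \<otimes> w g) (as @ (a \<odot>\<^bsub>F1\<^esub> u) # bs)
      = ev R (\<lambda>f' gs. \<psi> f' (g # gs)) (a \<otimes> (f \<otimes> w g)) (as @ u # bs)"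
      using Cons.prems ug by (intro Cons.IH[of _ "m - 1"] partial) auto
    then show ?thesis using Cons.prems ug by (simp add: m_assoc)
  qed
  then show ?case by simp
qed

lemma ev_gen:
  assumes "f \<in> carrier R" "x \<in> carrier R" "set us \<subseteq> carrier F1" "Suc (length us) = m"
  shows "ev R \<psi> f (free_gen R x # us) = ev R (\<lambda>f gs. \<psi> f (x # gs)) f us"
proof -
  have "ev R \<psi> f (free_gen R x # us)
    = (\<Sum>g\<in>{x}. ev R (\<lambda>f' gs. \<psi> f' (g # gs)) (f \<otimes> free_gen R x g) us)"
    using assms free_gen_carrier[OF cring_axioms, of x "carrier R"]
    by (intro ev_Cons_superset) (auto simp: free_gen_def)
  then show ?thesis using assms by (simp add: free_gen_def)
qed

lemma ev_map_gen:
  assumes "f \<in> carrier R" "set gs \<subseteq> carrier R" "length gs = m"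
  shows "ev R \<psi> f (map (free_gen R) gs) = \<psi> f gs"
  using assms multiderivation_axioms
proof (induction gs arbitrary: \<psi> m)
  case (Cons g gs)
  interpret multiderivation K \<phi> R m \<psi> by (rule Cons.prems)
  have "ev R \<psi> f (map (free_gen R) (g # gs)) = ev R (\<lambda>f gs. \<psi> f (g # gs)) f (map (free_gen R) gs)"
    using Cons.prems free_gen_carrier[OF cring_axioms, of _ "carrier R"]
    by (simp only: list.map) (intro ev_gen, auto)
  also have "\<dots> = \<psi> f (g # gs)"
    using Cons.prems by (intro Cons.IH[of "m - 1"] partial) auto
  finally show ?case .
next
  case Nil
  show ?case by simp
qed

lemma ev_slot_minus:
  assumes "f \<in> carrier R" "set (as @ u # v # bs) \<subseteq> carrier F1" "length (as @ u # bs) = m"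
  shows "ev R \<psi> f (as @ (u \<ominus>\<^bsub>F1\<^esub> v) # bs) = ev R \<psi> f (as @ u # bs) - ev R \<psi> f (as @ v # bs)"
proof -
  interpret F: Module.module R F1 by (rule free_module_is_module) (rule cring_axioms)
  have uv: "u \<in> carrier F1" "v \<in> carrier F1" using assms by auto
  then have mc: "u \<ominus>\<^bsub>F1\<^esub> v \<in> carrier F1" by (rule F.minus_closed)
  have "(u \<ominus>\<^bsub>F1\<^esub> v) \<oplus>\<^bsub>F1\<^esub> v = u"
    unfolding F.minus_eq using uv by (subst F.a_assoc) (simp_all add: F.l_neg)
  moreover have "ev R \<psi> f (as @ ((u \<ominus>\<^bsub>F1\<^esub> v) \<oplus>\<^bsub>F1\<^esub> v) # bs)
      = ev R \<psi> f (as @ (u \<ominus>\<^bsub>F1\<^esub> v) # bs) + ev R \<psi> f (as @ v # bs)"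
    by (rule ev_slot_add) (use assms mc in auto)
  ultimately show ?thesis by (simp only: eq_diff_eq)
qed

end

section \<open>Differential forms and their universal property\<close>

lemma kaehler_relations_cases:
  assumes "s \<in> kaehler_relations K \<phi> R"
  obtains
    (add) x y where "x \<in> carrier R" "y \<in> carrier R" "s = free_gen R (x \<oplus>\<^bsub>R\<^esub> y)
      \<ominus>\<^bsub>free_module R (carrier R)\<^esub> (free_gen R x \<oplus>\<^bsub>free_module R (carrier R)\<^esub> free_gen R y)"
  | (mult) x y where "x \<in> carrier R" "y \<in> carrier R" "s = free_gen R (x \<otimes>\<^bsub>R\<^esub> y)
      \<ominus>\<^bsub>free_module R (carrier R)\<^esub> (x \<odot>\<^bsub>free_module R (carrier R)\<^esub> free_gen R y
        \<oplus>\<^bsub>free_module R (carrier R)\<^esub> y \<odot>\<^bsub>free_module R (carrier R)\<^esub> free_gen R x)"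
  | (const) c where "c \<in> carrier K" "s = free_gen R (\<phi> c)"
  using assms unfolding kaehler_relations_def Let_def by blast

lemma (in presentation) cls_rel_zero:
  assumes "s \<in> S"
  shows "cls s = \<zero>\<^bsub>Q\<^esub>"
proof -
  interpret S: abelian_subgroup U F by (rule submodule_abelian_subgroup) (rule sub)
  show ?thesis unfolding Q_def quotient_module_simps by (rule S.a_rcos_const) (rule rel_zero[OF assms])
qed

lemma (in presentation) cls_eq_of_rel:
  assumes "x \<ominus>\<^bsub>F\<^esub> y \<in> S" "x \<in> carrier F" "y \<in> carrier F"
  shows "cls x = cls y"
  using cls_eq_iff[OF assms(2,3)] rel_zero[OF assms(1)] by blast

locale kaehler = cring R
  for K :: "('k, 'z) ring_scheme" and \<phi> :: "'k \<Rightarrow> 'r" and R :: "('r, 'x) ring_scheme" (structure) +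
  assumes base: "\<And>c. c \<in> carrier K \<Longrightarrow> \<phi> c \<in> carrier R"
begin

lemma relations_closed: "kaehler_relations K \<phi> R \<subseteq> carrier F1"
proof
  interpret F: Module.module R F1 by (rule free_module_is_module) (rule cring_axioms)
  note g = free_gen_carrier[OF cring_axioms, of _ "carrier R"]
  fix s assume "s \<in> kaehler_relations K \<phi> R"
  then show "s \<in> carrier F1"
    by (cases rule: kaehler_relations_cases) (auto intro!: F.minus_closed g base)
qed

sublocale D: presentation R "carrier R" "kaehler_relations K \<phi> R"
  by (rule presentation.intro) (rule cring_axioms, rule relations_closed)

abbreviation "\<Omega> \<equiv> kaehler_module K \<phi> R"
abbreviation "d \<equiv> kaehler_d K \<phi> R"

lemma \<Omega>_eq: "\<Omega> = D.Q" by (simp add: kaehler_module_def)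

lemma d_eq: "d x = D.cls (free_gen R x)" by (simp add: kaehler_d_def presented_gen_def)

lemma \<Omega>_module: "module R \<Omega>" unfolding \<Omega>_eq by (rule D.Q.module_axioms)

lemma d_closed: "x \<in> carrier R \<Longrightarrow> d x \<in> carrier \<Omega>"
  unfolding \<Omega>_eq d_eq by (intro D.cls_closed D.free_gen)

lemma d_add:
  assumes "x \<in> carrier R" "y \<in> carrier R"
  shows "d (x \<oplus> y) = d x \<oplus>\<^bsub>\<Omega>\<^esub> d y"
proof -
  have "free_gen R (x \<oplus> y) \<ominus>\<^bsub>F1\<^esub> (free_gen R x \<oplus>\<^bsub>F1\<^esub> free_gen R y) \<in> kaehler_relations K \<phi> R"
    using assms unfolding kaehler_relations_def Let_def by blast
  then have "d (x \<oplus> y) = D.cls (free_gen R x \<oplus>\<^bsub>F1\<^esub> free_gen R y)"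
    unfolding d_eq using assms by (intro D.cls_eq_of_rel D.F.add.m_closed D.F.smult_closed D.free_gen) auto
  also have "\<dots> = d x \<oplus>\<^bsub>\<Omega>\<^esub> d y"
    unfolding d_eq \<Omega>_eq using assms by (intro D.cls_add[symmetric] D.free_gen)
  finally show ?thesis .
qed

lemma d_mult:
  assumes "x \<in> carrier R" "y \<in> carrier R"
  shows "d (x \<otimes> y) = x \<odot>\<^bsub>\<Omega>\<^esub> d y \<oplus>\<^bsub>\<Omega>\<^esub> y \<odot>\<^bsub>\<Omega>\<^esub> d x"
proof -
  have "free_gen R (x \<otimes> y) \<ominus>\<^bsub>F1\<^esub> (x \<odot>\<^bsub>F1\<^esub> free_gen R y \<oplus>\<^bsub>F1\<^esub> y \<odot>\<^bsub>F1\<^esub> free_gen R x) \<in> kaehler_relations K \<phi> R"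
    using assms unfolding kaehler_relations_def Let_def by blast
  then have "d (x \<otimes> y) = D.cls (x \<odot>\<^bsub>F1\<^esub> free_gen R y \<oplus>\<^bsub>F1\<^esub> y \<odot>\<^bsub>F1\<^esub> free_gen R x)"
    unfolding d_eq using assms by (intro D.cls_eq_of_rel D.F.add.m_closed D.F.smult_closed D.free_gen) auto
  also have "\<dots> = x \<odot>\<^bsub>\<Omega>\<^esub> d y \<oplus>\<^bsub>\<Omega>\<^esub> y \<odot>\<^bsub>\<Omega>\<^esub> d x"
    unfolding d_eq \<Omega>_eq using assms D.free_gen by (simp add: D.cls_add D.cls_smult)
  finally show ?thesis .
qed

lemma d_const:
  assumes "c \<in> carrier K"
  shows "d (\<phi> c) = \<zero>\<^bsub>\<Omega>\<^esub>"
proof -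
  have "free_gen R (\<phi> c) \<in> kaehler_relations K \<phi> R"
    using assms unfolding kaehler_relations_def Let_def by blast
  then show ?thesis unfolding d_eq \<Omega>_eq by (rule D.cls_rel_zero)
qed

end

locale exterior = Module.module R M
  for R :: "('r, 'x) ring_scheme" (structure) and M :: "('r, 'a, 'y) module_scheme" +
  fixes m :: nat
begin

abbreviation "T \<equiv> {xs. length xs = m \<and> set xs \<subseteq> carrier M}"

text \<open>The definition addresses slots by list update; splitting the list around the slot gives
  the shape on which \<open>ev\<close> and the axioms of a multiderivation operate.\<close>

lemma relations_cases:
  assumes "s \<in> exterior_relations R M m"
  obtains
    (add) as bs x y where "length (as @ x # bs) = m" "set (as @ x # y # bs) \<subseteq> carrier M"
      "s = free_gen R (as @ (x \<oplus>\<^bsub>M\<^esub> y) # bs) \<ominus>\<^bsub>free_module R T\<^esub>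
        (free_gen R (as @ x # bs) \<oplus>\<^bsub>free_module R T\<^esub> free_gen R (as @ y # bs))"
  | (smult) as bs a x where "length (as @ x # bs) = m" "set (as @ x # bs) \<subseteq> carrier M" "a \<in> carrier R"
      "s = free_gen R (as @ (a \<odot>\<^bsub>M\<^esub> x) # bs) \<ominus>\<^bsub>free_module R T\<^esub>
        a \<odot>\<^bsub>free_module R T\<^esub> free_gen R (as @ x # bs)"
  | (alt) as bs cs x where "length (as @ x # bs @ x # cs) = m" "set (as @ x # bs @ x # cs) \<subseteq> carrier M"
      "s = free_gen R (as @ x # bs @ x # cs)"
proof -
  have upd: "xs[i := z] = take i xs @ z # drop (Suc i) xs" if "i < m" "xs \<in> T" for xs :: "'a list" and i z
    using that by (simp add: upd_conv_take_nth_drop)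
  have sub: "set (take i xs) \<subseteq> carrier M" "set (drop i xs) \<subseteq> carrier M" if "xs \<in> T" for xs :: "'a list" and i
    using that set_take_subset[of i xs] set_drop_subset[of i xs] by auto
  from assms have
      "(\<exists>xs i x y. s = free_gen R (xs[i := x \<oplus>\<^bsub>M\<^esub> y])
        \<ominus>\<^bsub>free_module R T\<^esub> (free_gen R (xs[i := x]) \<oplus>\<^bsub>free_module R T\<^esub> free_gen R (xs[i := y]))
        \<and> xs \<in> T \<and> i < m \<and> x \<in> carrier M \<and> y \<in> carrier M)
    \<or> (\<exists>xs i a x. s = free_gen R (xs[i := a \<odot>\<^bsub>M\<^esub> x])
        \<ominus>\<^bsub>free_module R T\<^esub> a \<odot>\<^bsub>free_module R T\<^esub> free_gen R (xs[i := x])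
        \<and> xs \<in> T \<and> i < m \<and> a \<in> carrier R \<and> x \<in> carrier M)
    \<or> (\<exists>xs i j. s = free_gen R xs \<and> xs \<in> T \<and> i < j \<and> j < m \<and> xs ! i = xs ! j)"
    unfolding exterior_relations_def Let_def Un_iff mem_Collect_eq disj_assoc .
  then show ?thesis
  proof (elim disjE exE)
    fix xs i x y assume 1: "s = free_gen R (xs[i := x \<oplus>\<^bsub>M\<^esub> y])
        \<ominus>\<^bsub>free_module R T\<^esub> (free_gen R (xs[i := x]) \<oplus>\<^bsub>free_module R T\<^esub> free_gen R (xs[i := y]))
        \<and> xs \<in> T \<and> i < m \<and> x \<in> carrier M \<and> y \<in> carrier M"
    then show ?thesis
      using sub[of xs] by (intro that(1)[of "take i xs" x "drop (Suc i) xs" y]) (auto simp: upd)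
  next
    fix xs i a x assume 2: "s = free_gen R (xs[i := a \<odot>\<^bsub>M\<^esub> x])
        \<ominus>\<^bsub>free_module R T\<^esub> a \<odot>\<^bsub>free_module R T\<^esub> free_gen R (xs[i := x])
        \<and> xs \<in> T \<and> i < m \<and> a \<in> carrier R \<and> x \<in> carrier M"
    then show ?thesis
      using sub[of xs] by (intro that(2)[of "take i xs" x "drop (Suc i) xs" a]) (auto simp: upd)
  next
    fix xs i j assume "s = free_gen R xs \<and> xs \<in> T \<and> i < j \<and> j < m \<and> xs ! i = xs ! j"
    then have 3: "xs \<in> T" "i < j" "j < m" "xs ! i = xs ! j" "s = free_gen R xs" by auto
    define bs where "bs = take (j - Suc i) (drop (Suc i) xs)"
    have *: "xs = take i xs @ xs ! i # bs @ xs ! i # drop (Suc j) xs"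
    proof -
      have 1: "xs = take i xs @ xs ! i # drop (Suc i) xs"
        using 3 by (intro id_take_nth_drop) simp
      have 2: "drop (Suc i) xs = bs @ drop (j - Suc i) (drop (Suc i) xs)"
        unfolding bs_def by (rule append_take_drop_id[symmetric])
      have 3: "drop (j - Suc i) (drop (Suc i) xs) = xs ! i # drop (Suc j) xs"
        using 3 by (simp add: Cons_nth_drop_Suc)
      show ?thesis using 1 2 unfolding 3 by metis
    qed
    show ?thesis
      using 3 * by (intro that(3)[of "take i xs" "xs ! i" bs "drop (Suc j) xs"]) auto
  qed
qed

lemma gen_closed: "xs \<in> T \<Longrightarrow> free_gen R xs \<in> carrier (free_module R T)"
  by (rule free_gen_carrier) (rule R.cring_axioms)

lemma relations_closed: "exterior_relations R M m \<subseteq> carrier (free_module R T)"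
proof
  interpret F: Module.module R "free_module R T" by (rule free_module_is_module) (rule R.cring_axioms)
  fix s assume "s \<in> exterior_relations R M m"
  then show "s \<in> carrier (free_module R T)"
  proof (cases rule: relations_cases)
    case (add as bs x y)
    then show ?thesis
      unfolding add(3) by (intro F.minus_closed F.add.m_closed gen_closed) simp_all
  next
    case (smult as bs a x)
    then show ?thesis
      unfolding smult(4) by (intro F.minus_closed F.smult_closed gen_closed) simp_all
  next
    case (alt as bs cs x)
    then show ?thesis unfolding alt(3) by (intro gen_closed) simp_all
  qed
qed

sublocale E: presentation R T "exterior_relations R M m"
  by (rule presentation.intro) (rule R.cring_axioms, rule relations_closed)

abbreviation "\<Lambda> \<equiv> exterior_power R M m"

lemma \<Lambda>_eq: "\<Lambda> = E.Q" by (simp add: exterior_power_def)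

lemma \<Lambda>_module: "module R \<Lambda>" unfolding \<Lambda>_eq by (rule E.Q.module_axioms)

lemma wedge_eq: "length xs = m \<Longrightarrow> wedge R M xs = E.cls (free_gen R xs)"
  by (simp add: wedge_def presented_gen_def)

lemma wedge_closed: "xs \<in> T \<Longrightarrow> wedge R M xs \<in> carrier \<Lambda>"
  by (simp add: wedge_eq \<Lambda>_eq E.cls_closed gen_closed)

lemma wedge_add:
  assumes "length (as @ x # bs) = m" "set (as @ x # y # bs) \<subseteq> carrier M"
  shows "wedge R M (as @ (x \<oplus>\<^bsub>M\<^esub> y) # bs) = wedge R M (as @ x # bs) \<oplus>\<^bsub>\<Lambda>\<^esub> wedge R M (as @ y # bs)"
proof -
  let ?xs = "as @ x # bs" and ?i = "length as"
  have "free_gen R (?xs[?i := x \<oplus>\<^bsub>M\<^esub> y]) \<ominus>\<^bsub>E.F\<^esub>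
      (free_gen R (?xs[?i := x]) \<oplus>\<^bsub>E.F\<^esub> free_gen R (?xs[?i := y])) \<in> exterior_relations R M m"
  proof -
    have "?xs \<in> T" "?i < m" "x \<in> carrier M" "y \<in> carrier M" using assms by auto
    then show ?thesis unfolding exterior_relations_def Let_def by blast
  qed
  then have "E.cls (free_gen R (as @ (x \<oplus>\<^bsub>M\<^esub> y) # bs)) =
      E.cls (free_gen R (as @ x # bs) \<oplus>\<^bsub>E.F\<^esub> free_gen R (as @ y # bs))"
    using assms by (intro E.cls_eq_of_rel gen_closed E.F.add.m_closed) simp_all
  also have "\<dots> = E.cls (free_gen R (as @ x # bs)) \<oplus>\<^bsub>E.Q\<^esub> E.cls (free_gen R (as @ y # bs))"
    using assms by (intro E.cls_add[symmetric] gen_closed) auto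
  finally show ?thesis using assms by (simp add: wedge_eq \<Lambda>_eq)
qed

lemma wedge_smult:
  assumes "length (as @ x # bs) = m" "set (as @ x # bs) \<subseteq> carrier M" "a \<in> carrier R"
  shows "wedge R M (as @ (a \<odot>\<^bsub>M\<^esub> x) # bs) = a \<odot>\<^bsub>\<Lambda>\<^esub> wedge R M (as @ x # bs)"
proof -
  let ?xs = "as @ x # bs" and ?i = "length as"
  have "free_gen R (?xs[?i := a \<odot>\<^bsub>M\<^esub> x]) \<ominus>\<^bsub>E.F\<^esub> a \<odot>\<^bsub>E.F\<^esub> free_gen R (?xs[?i := x])
      \<in> exterior_relations R M m"
  proof -
    have "?xs \<in> T" "?i < m" "x \<in> carrier M" using assms by auto
    then show ?thesis using assms(3) unfolding exterior_relations_def Let_def by blast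
  qed
  then have "E.cls (free_gen R (as @ (a \<odot>\<^bsub>M\<^esub> x) # bs)) = E.cls (a \<odot>\<^bsub>E.F\<^esub> free_gen R (as @ x # bs))"
    using assms by (intro E.cls_eq_of_rel gen_closed E.F.smult_closed) simp_all
  also have "\<dots> = a \<odot>\<^bsub>E.Q\<^esub> E.cls (free_gen R (as @ x # bs))"
    using assms by (intro E.cls_smult[symmetric] gen_closed) auto
  finally show ?thesis using assms by (simp add: wedge_eq \<Lambda>_eq)
qed

lemma wedge_alt:
  assumes "length (as @ x # x # bs) = m" "set (as @ x # bs) \<subseteq> carrier M"
  shows "wedge R M (as @ x # x # bs) = \<zero>\<^bsub>\<Lambda>\<^esub>"
proof -
  let ?xs = "as @ x # x # bs"
  have "free_gen R ?xs \<in> exterior_relations R M m"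
  proof -
    have "?xs \<in> T" "length as < Suc (length as)" "Suc (length as) < m"
        "?xs ! length as = ?xs ! Suc (length as)"
      using assms by (auto simp: nth_append)
    then show ?thesis unfolding exterior_relations_def Let_def by blast
  qed
  then have "E.cls (free_gen R ?xs) = \<zero>\<^bsub>\<Lambda>\<^esub>" unfolding \<Lambda>_eq by (rule E.cls_rel_zero)
  then show ?thesis using assms by (simp add: wedge_eq)
qed

end

context multiderivation begin

sublocale kaehler K \<phi> R
  by unfold_locales (rule base)

text \<open>For a relation in the first slot, each of the three kinds is matched by the
  corresponding axiom of a multiderivation. A relation further back is reached by expanding the
  slots in front of it, which leaves partial multiderivations.\<close>

lemma ev_relation:
  assumes "s \<in> kaehler_relations K \<phi> R" "f \<in> carrier R" "set (as @ bs) \<subseteq> carrier F1" "Suc (length (as @ bs)) = m"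
  shows "ev R \<psi> f (as @ s # bs) = 0"
  using assms(2-) multiderivation_axioms
proof (induction as arbitrary: \<psi> f m)
  case Nil
  interpret multiderivation K \<phi> R m \<psi> by (rule Nil.prems)
  note g = free_gen_carrier[OF cring_axioms, of _ "carrier R"]
  have bs: "set bs \<subseteq> carrier F1" "Suc (length bs) = m" using Nil.prems by auto
  let ?\<psi> = "\<lambda>g f gs. \<psi> f (g # gs)"
  from assms(1) show ?case
  proof (cases rule: kaehler_relations_cases)
    case (add x y)
    have "ev R \<psi> f (s # bs) = ev R \<psi> f (free_gen R (x \<oplus> y) # bs)
        - ev R \<psi> f ((free_gen R x \<oplus>\<^bsub>F1\<^esub> free_gen R y) # bs)"
      unfolding add(3) using add(1,2) Nil.prems ev_slot_minus[of f "[]" "free_gen R (x \<oplus> y)" "free_gen R x \<oplus>\<^bsub>F1\<^esub> free_gen R y" bs]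
      by (simp only: append.simps) (use g in \<open>simp add: D.F.add.m_closed\<close>)
    also have "ev R \<psi> f ((free_gen R x \<oplus>\<^bsub>F1\<^esub> free_gen R y) # bs)
        = ev R \<psi> f (free_gen R x # bs) + ev R \<psi> f (free_gen R y # bs)"
      using add(1,2) Nil.prems g ev_slot_add[of f "[]" "free_gen R x" "free_gen R y" bs] by (simp only: append.simps) simp
    also have "ev R \<psi> f (free_gen R x # bs) = ev R (?\<psi> x) f bs"
      using add Nil.prems by (intro ev_gen) auto
    also have "ev R \<psi> f (free_gen R y # bs) = ev R (?\<psi> y) f bs"
      using add Nil.prems by (intro ev_gen) auto
    also have "ev R \<psi> f (free_gen R (x \<oplus> y) # bs) = ev R (?\<psi> (x \<oplus> y)) f bs"
      using add Nil.prems by (intro ev_gen) auto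
    also have "\<dots> = ev R (\<lambda>f gs. ?\<psi> x f gs + ?\<psi> y f gs) f bs"
      using add(1,2) bs Nil.prems slot_add[of _ "[]" x y] by (intro ev_cong) auto
    also have "\<dots> = ev R (?\<psi> x) f bs + ev R (?\<psi> y) f bs" by (rule ev_add_fun)
    finally show ?thesis by simp
  next
    case (mult x y)
    have "ev R \<psi> f (s # bs) = ev R \<psi> f (free_gen R (x \<otimes> y) # bs)
        - ev R \<psi> f ((x \<odot>\<^bsub>F1\<^esub> free_gen R y \<oplus>\<^bsub>F1\<^esub> y \<odot>\<^bsub>F1\<^esub> free_gen R x) # bs)"
      unfolding mult(3) using mult(1,2) Nil.prems ev_slot_minus[of f "[]" "free_gen R (x \<otimes> y)" "x \<odot>\<^bsub>F1\<^esub> free_gen R y \<oplus>\<^bsub>F1\<^esub> y \<odot>\<^bsub>F1\<^esub> free_gen R x" bs]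
      by (simp only: append.simps) (use g in \<open>simp add: D.F.add.m_closed D.F.smult_closed\<close>)
    also have "ev R \<psi> f ((x \<odot>\<^bsub>F1\<^esub> free_gen R y \<oplus>\<^bsub>F1\<^esub> y \<odot>\<^bsub>F1\<^esub> free_gen R x) # bs)
        = ev R \<psi> f ((x \<odot>\<^bsub>F1\<^esub> free_gen R y) # bs) + ev R \<psi> f ((y \<odot>\<^bsub>F1\<^esub> free_gen R x) # bs)"
      using mult(1,2) Nil.prems g D.F.smult_closed
        ev_slot_add[of f "[]" "x \<odot>\<^bsub>F1\<^esub> free_gen R y" "y \<odot>\<^bsub>F1\<^esub> free_gen R x" bs] by (simp only: append.simps) simp
    also have "ev R \<psi> f ((x \<odot>\<^bsub>F1\<^esub> free_gen R y) # bs) = ev R \<psi> (x \<otimes> f) (free_gen R y # bs)"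
      using mult(1,2) Nil.prems g ev_slot_smult[of f x "[]" "free_gen R y" bs] by (simp only: append.simps) simp
    also have "ev R \<psi> f ((y \<odot>\<^bsub>F1\<^esub> free_gen R x) # bs) = ev R \<psi> (y \<otimes> f) (free_gen R x # bs)"
      using mult(1,2) Nil.prems g ev_slot_smult[of f y "[]" "free_gen R x" bs] by (simp only: append.simps) simp
    also have "ev R \<psi> (x \<otimes> f) (free_gen R y # bs) = ev R (?\<psi> y) (x \<otimes> f) bs"
      using mult Nil.prems by (intro ev_gen) auto
    also have "\<dots> = ev R (\<lambda>f gs. ?\<psi> y (x \<otimes> f) gs) f bs"
      using mult Nil.prems by (intro ev_coeff_mult) auto
    also have "ev R \<psi> (y \<otimes> f) (free_gen R x # bs) = ev R (?\<psi> x) (y \<otimes> f) bs"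
      using mult Nil.prems by (intro ev_gen) auto
    also have "\<dots> = ev R (\<lambda>f gs. ?\<psi> x (y \<otimes> f) gs) f bs"
      using mult Nil.prems by (intro ev_coeff_mult) auto
    also have "ev R \<psi> f (free_gen R (x \<otimes> y) # bs) = ev R (?\<psi> (x \<otimes> y)) f bs"
      using mult Nil.prems by (intro ev_gen) auto
    also have "\<dots> = ev R (\<lambda>f gs. ?\<psi> y (x \<otimes> f) gs + ?\<psi> x (y \<otimes> f) gs) f bs"
      using mult(1,2) bs Nil.prems slot_mult[of _ "[]" x y] by (intro ev_cong) auto
    also have "\<dots> = ev R (\<lambda>f gs. ?\<psi> y (x \<otimes> f) gs) f bs + ev R (\<lambda>f gs. ?\<psi> x (y \<otimes> f) gs) f bs"
      by (rule ev_add_fun)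
    finally show ?thesis by simp
  next
    case (const c)
    have "ev R \<psi> f (s # bs) = ev R (?\<psi> (\<phi> c)) f bs"
      unfolding const(2) using Nil.prems base[OF const(1)] by (intro ev_gen) auto
    also have "\<dots> = 0"
      using Nil.prems const(1) slot_const[of _ "[]"] by (intro ev_zero_fun) auto
    finally show ?thesis by simp
  qed
next
  case (Cons w as)
  interpret multiderivation K \<phi> R m \<psi> by (rule Cons.prems)
  have "ev R (\<lambda>f' gs. \<psi> f' (g # gs)) (f \<otimes> w g) (as @ s # bs) = 0" if "g \<in> {g. w g \<noteq> \<zero>}" for g
  proof -
    have ug: "w g \<in> carrier R" "g \<in> carrier R" using Cons.prems that by (auto simp: F1_iff)
    show ?thesis using Cons.prems ug by (intro Cons.IH[of _ "m - 1"] partial) auto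
  qed
  then show ?case by simp
qed

lemma ev_span:
  assumes "u \<in> D.U" "f \<in> carrier R" "set (as @ bs) \<subseteq> carrier F1" "Suc (length (as @ bs)) = m"
  shows "ev R \<psi> f (as @ u # bs) = 0"
proof -
  \<comment> \<open>The quantifier over all coefficients \<open>f\<close> is what makes
    \<open>N\<close> closed under scalars: a scalar in the slot moves into the coefficient.\<close>
  define N where "N = {u \<in> carrier F1. \<forall>f\<in>carrier R. ev R \<psi> f (as @ u # bs) = 0}"
  have N: "N \<subseteq> carrier F1" by (auto simp: N_def)
  have add: "u \<oplus>\<^bsub>F1\<^esub> v \<in> N" if "u \<in> N" "v \<in> N" for u v
  proof -
    have "u \<in> carrier F1" "v \<in> carrier F1" using that N by auto
    moreover from this have "u \<oplus>\<^bsub>F1\<^esub> v \<in> carrier F1" by (rule D.F.add.m_closed)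
    ultimately show ?thesis
      using that assms unfolding N_def by (simp add: ev_slot_add)
  qed
  have smult: "a \<odot>\<^bsub>F1\<^esub> u \<in> N" if "u \<in> N" "a \<in> carrier R" for u a
  proof -
    have "u \<in> carrier F1" using that N by auto
    moreover from this that(2) have "a \<odot>\<^bsub>F1\<^esub> u \<in> carrier F1" by (intro D.F.smult_closed)
    ultimately show ?thesis
      using that assms unfolding N_def by (simp add: ev_slot_smult)
  qed
  have rel: "kaehler_relations K \<phi> R \<subseteq> N"
    using relations_closed assms ev_relation unfolding N_def by blast
  have zero: "\<zero>\<^bsub>F1\<^esub> \<in> N"
  proof -
    have "\<zero>\<^bsub>F1\<^esub> \<oplus>\<^bsub>F1\<^esub> \<zero>\<^bsub>F1\<^esub> = \<zero>\<^bsub>F1\<^esub>" by simp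
    then have "ev R \<psi> f (as @ \<zero>\<^bsub>F1\<^esub> # bs) = ev R \<psi> f (as @ \<zero>\<^bsub>F1\<^esub> # bs) + ev R \<psi> f (as @ \<zero>\<^bsub>F1\<^esub> # bs)"
      if "f \<in> carrier R" for f
      using ev_slot_add[of f as "\<zero>\<^bsub>F1\<^esub>" "\<zero>\<^bsub>F1\<^esub>" bs] assms that by simp
    then show ?thesis unfolding N_def by simp
  qed
  have "submodule R N F1"
    by (rule LinearCombinations.submodule.intro) (use N add smult zero D.F.module_axioms in auto)
  then have "D.U \<subseteq> N" using rel by (intro D.F.span_is_subset)
  then show ?thesis using assms by (auto simp: N_def)
qed

text \<open>At the front of the list both claims are about a double sum over pairs of generators,
  whose terms are antisymmetric by \<open>slot_swap\<close> and vanish on the diagonal by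
  \<open>slot_alt\<close>.\<close>

lemma ev_swap:
  assumes "f \<in> carrier R" "set (as @ u # v # bs) \<subseteq> carrier F1" "length (as @ u # v # bs) = m"
  shows "ev R \<psi> f (as @ u # v # bs) = - ev R \<psi> f (as @ v # u # bs)"
    and "ev R \<psi> f (as @ u # u # bs) = 0"
  using assms multiderivation_axioms
proof (induction as arbitrary: \<psi> f m)
  case (Cons w as)
  {
    case 1
    interpret multiderivation K \<phi> R m \<psi> by (rule 1)
    have "ev R (\<lambda>f' gs. \<psi> f' (g # gs)) (f \<otimes> w g) (as @ u # v # bs)
      = - ev R (\<lambda>f' gs. \<psi> f' (g # gs)) (f \<otimes> w g) (as @ v # u # bs)" if "g \<in> {g. w g \<noteq> \<zero>}" for g
    proof -
      have ug: "w g \<in> carrier R" "g \<in> carrier R" using 1 that by (auto simp: F1_iff)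
      show ?thesis using 1 ug by (intro Cons.IH[of _ "m - 1"] partial) auto
    qed
    then show ?case by (simp add: sum_negf)
  next
    case 2
    interpret multiderivation K \<phi> R m \<psi> by (rule 2)
    have "ev R (\<lambda>f' gs. \<psi> f' (g # gs)) (f \<otimes> w g) (as @ u # u # bs) = 0" if "g \<in> {g. w g \<noteq> \<zero>}" for g
    proof -
      have ug: "w g \<in> carrier R" "g \<in> carrier R" using 2 that by (auto simp: F1_iff)
      show ?thesis using 2 ug by (intro Cons.IH[of _ "m - 1"] partial) auto
    qed
    then show ?case by simp
  }
next
  case Nil
  let ?\<psi> = "\<lambda>\<psi> g h f gs. \<psi> f (g # h # gs)"
  have swap: "ev R (?\<psi> \<psi> g h) ((f \<otimes> u g) \<otimes> v h) bs = - ev R (?\<psi> \<psi> h g) ((f \<otimes> v h) \<otimes> u g) bs"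
    if "multiderivation K \<phi> R m \<psi>" "f \<in> carrier R" "set (u # v # bs) \<subseteq> carrier F1" "length (u # v # bs) = m"
      "g \<in> carrier R" "h \<in> carrier R" for g h f u v \<psi> m
  proof -
    interpret multiderivation K \<phi> R m \<psi> by fact
    have c: "u g \<in> carrier R" "v h \<in> carrier R" using that by (auto simp: F1_iff)
    have "ev R (?\<psi> \<psi> g h) ((f \<otimes> u g) \<otimes> v h) bs + ev R (?\<psi> \<psi> h g) ((f \<otimes> u g) \<otimes> v h) bs
      = ev R (\<lambda>f gs. \<psi> f (g # h # gs) + \<psi> f (h # g # gs)) ((f \<otimes> u g) \<otimes> v h) bs"
      by (rule ev_add_fun[symmetric])
    also have "\<dots> = 0"
      using that c slot_swap[of _ "[]" g h] by (intro ev_zero_fun) auto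
    also have "(f \<otimes> u g) \<otimes> v h = (f \<otimes> v h) \<otimes> u g" using that c by (simp add: m_ac)
    finally show ?thesis using that c by (simp add: eq_neg_iff_add_eq_0 m_ac)
  qed
  {
    case 1
    have "ev R \<psi> f (u # v # bs) = (\<Sum>g | u g \<noteq> \<zero>. \<Sum>h | v h \<noteq> \<zero>. - ev R (?\<psi> \<psi> h g) ((f \<otimes> v h) \<otimes> u g) bs)"
      unfolding ev.simps using 1 by (intro sum.cong refl swap) (auto simp: F1_iff)
    also have "\<dots> = - (\<Sum>h | v h \<noteq> \<zero>. \<Sum>g | u g \<noteq> \<zero>. ev R (?\<psi> \<psi> h g) ((f \<otimes> v h) \<otimes> u g) bs)"
      unfolding sum_negf by (subst sum.swap) simp
    finally show ?case by simp
  next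
    case 2
    interpret multiderivation K \<phi> R m \<psi> by (rule 2)
    have "ev R \<psi> f (u # u # bs) = (\<Sum>g | u g \<noteq> \<zero>. \<Sum>h | u h \<noteq> \<zero>. ev R (?\<psi> \<psi> g h) ((f \<otimes> u g) \<otimes> u h) bs)"
      by simp
    also have "\<dots> = 0"
    proof (rule sum_antisymmetric)
      show "finite {g. u g \<noteq> \<zero>}" using 2 by (auto simp: F1_iff)
      fix g h assume gh: "g \<in> {g. u g \<noteq> \<zero>}" "h \<in> {g. u g \<noteq> \<zero>}"
      then show "ev R (?\<psi> \<psi> g h) ((f \<otimes> u g) \<otimes> u h) bs = - ev R (?\<psi> \<psi> h g) ((f \<otimes> u h) \<otimes> u g) bs"
        using 2 by (intro swap) (auto simp: F1_iff)
      show "ev R (?\<psi> \<psi> g g) ((f \<otimes> u g) \<otimes> u g) bs = 0"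
        using 2 gh slot_alt[of _ "[]" g] by (intro ev_zero_fun) (auto simp: F1_iff)
    qed
    finally show ?case by simp
  }
qed

lemma ev_alt:
  assumes "f \<in> carrier R" "set (as @ u # bs @ u # cs) \<subseteq> carrier F1" "length (as @ u # bs @ u # cs) = m"
  shows "ev R \<psi> f (as @ u # bs @ u # cs) = 0"
proof (rule alternating_lists[where C = "carrier F1" and m = m])
  show "ev R \<psi> f (as @ x # y # bs) = - ev R \<psi> f (as @ y # x # bs)"
    if "set (as @ x # y # bs) \<subseteq> carrier F1" "length (as @ x # y # bs) = m" for as x y bs
    using that by (rule ev_swap(1)[OF assms(1)])
  show "ev R \<psi> f (as @ x # x # bs) = 0"
    if "set (as @ x # x # bs) \<subseteq> carrier F1" "length (as @ x # x # bs) = m" for as x bs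
    using that by (rule ev_swap(2)[OF assms(1)])
qed (use assms in auto)

end

locale forms = kaehler +
  fixes m :: nat
begin

sublocale X: exterior R \<Omega> m
  by (rule exterior.intro) (rule \<Omega>_module)

sublocale L: Module.module R X.\<Lambda>
  by (rule X.\<Lambda>_module)

definition form where "form r gs = r \<odot>\<^bsub>X.\<Lambda>\<^esub> wedge R \<Omega> (map d gs)"

lemma map_d_T: "set gs \<subseteq> carrier R \<Longrightarrow> length gs = m \<Longrightarrow> map d gs \<in> X.T"
  by (auto intro: d_closed)

lemma form_closed:
  "r \<in> carrier R \<Longrightarrow> set gs \<subseteq> carrier R \<Longrightarrow> length gs = m \<Longrightarrow> form r gs \<in> carrier X.\<Lambda>"
  unfolding form_def by (intro L.smult_closed X.wedge_closed map_d_T)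

lemma form_smult:
  "\<lbrakk>a \<in> carrier R; r \<in> carrier R; set gs \<subseteq> carrier R; length gs = m\<rbrakk> \<Longrightarrow> a \<odot>\<^bsub>X.\<Lambda>\<^esub> form r gs = form (a \<otimes> r) gs"
  unfolding form_def by (intro L.smult_assoc1[symmetric] X.wedge_closed map_d_T)

lemma form_coeff_add:
  "\<lbrakk>r \<in> carrier R; r' \<in> carrier R; set gs \<subseteq> carrier R; length gs = m\<rbrakk>
    \<Longrightarrow> form (r \<oplus> r') gs = form r gs \<oplus>\<^bsub>X.\<Lambda>\<^esub> form r' gs"
  unfolding form_def by (intro L.smult_l_distr X.wedge_closed map_d_T)

lemma form_slot_add:
  assumes "r \<in> carrier R" "set (as @ x # y # bs) \<subseteq> carrier R" "length (as @ x # bs) = m"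
  shows "form r (as @ (x \<oplus> y) # bs) = form r (as @ x # bs) \<oplus>\<^bsub>X.\<Lambda>\<^esub> form r (as @ y # bs)"
proof -
  have c: "map d as @ d x # map d bs \<in> X.T" "map d as @ d y # map d bs \<in> X.T"
    using assms by (auto intro: d_closed)
  have "wedge R \<Omega> (map d (as @ (x \<oplus> y) # bs)) = wedge R \<Omega> (map d as @ (d x \<oplus>\<^bsub>\<Omega>\<^esub> d y) # map d bs)"
    using assms by (simp add: d_add)
  also have "\<dots> = wedge R \<Omega> (map d as @ d x # map d bs) \<oplus>\<^bsub>X.\<Lambda>\<^esub> wedge R \<Omega> (map d as @ d y # map d bs)"
    using c by (intro X.wedge_add) auto
  finally show ?thesis
    unfolding form_def using assms(1) c[THEN X.wedge_closed] by (simp add: L.smult_r_distr)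
qed

lemma form_slot_mult:
  assumes "r \<in> carrier R" "set (as @ x # y # bs) \<subseteq> carrier R" "length (as @ x # bs) = m"
  shows "form r (as @ (x \<otimes> y) # bs) = form (x \<otimes> r) (as @ y # bs) \<oplus>\<^bsub>X.\<Lambda>\<^esub> form (y \<otimes> r) (as @ x # bs)"
proof -
  have c: "map d as @ d x # map d bs \<in> X.T" "map d as @ d y # map d bs \<in> X.T"
    using assms by (auto intro: d_closed)
  have xy: "x \<in> carrier R" "y \<in> carrier R" using assms by auto
  have sm: "x \<odot>\<^bsub>\<Omega>\<^esub> d y \<in> carrier \<Omega>" "y \<odot>\<^bsub>\<Omega>\<^esub> d x \<in> carrier \<Omega>"
    using xy d_closed by (auto intro: X.smult_closed)
  have "wedge R \<Omega> (map d (as @ (x \<otimes> y) # bs)) = wedge R \<Omega> (map d as @ (x \<odot>\<^bsub>\<Omega>\<^esub> d y \<oplus>\<^bsub>\<Omega>\<^esub> y \<odot>\<^bsub>\<Omega>\<^esub> d x) # map d bs)"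
    using xy by (simp add: d_mult)
  also have "\<dots> = wedge R \<Omega> (map d as @ (x \<odot>\<^bsub>\<Omega>\<^esub> d y) # map d bs) \<oplus>\<^bsub>X.\<Lambda>\<^esub> wedge R \<Omega> (map d as @ (y \<odot>\<^bsub>\<Omega>\<^esub> d x) # map d bs)"
    using c sm by (intro X.wedge_add) auto
  also have "wedge R \<Omega> (map d as @ (x \<odot>\<^bsub>\<Omega>\<^esub> d y) # map d bs) = x \<odot>\<^bsub>X.\<Lambda>\<^esub> wedge R \<Omega> (map d as @ d y # map d bs)"
    using c xy by (intro X.wedge_smult) auto
  also have "wedge R \<Omega> (map d as @ (y \<odot>\<^bsub>\<Omega>\<^esub> d x) # map d bs) = y \<odot>\<^bsub>X.\<Lambda>\<^esub> wedge R \<Omega> (map d as @ d x # map d bs)"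
    using c xy by (intro X.wedge_smult) auto
  finally show ?thesis
    unfolding form_def using assms(1) xy c[THEN X.wedge_closed]
    by (simp add: L.smult_r_distr L.smult_assoc1[symmetric] m_comm)
qed

lemma form_slot_const:
  assumes "r \<in> carrier R" "set (as @ bs) \<subseteq> carrier R" "Suc (length (as @ bs)) = m" "c \<in> carrier K"
  shows "form r (as @ \<phi> c # bs) = \<zero>\<^bsub>X.\<Lambda>\<^esub>"
proof -
  have T: "map d as @ \<zero>\<^bsub>\<Omega>\<^esub> # map d bs \<in> X.T"
    using assms d_closed by auto
  have "wedge R \<Omega> (map d (as @ \<phi> c # bs)) = wedge R \<Omega> (map d as @ (\<zero> \<odot>\<^bsub>\<Omega>\<^esub> \<zero>\<^bsub>\<Omega>\<^esub>) # map d bs)"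
    using assms by (simp add: d_const)
  also have "\<dots> = \<zero> \<odot>\<^bsub>X.\<Lambda>\<^esub> wedge R \<Omega> (map d as @ \<zero>\<^bsub>\<Omega>\<^esub> # map d bs)"
    using T by (intro X.wedge_smult) auto
  finally show ?thesis
    unfolding form_def using assms(1) X.wedge_closed[OF T] by simp
qed

lemma form_slot_alt:
  assumes "r \<in> carrier R" "set (as @ x # bs) \<subseteq> carrier R" "length (as @ x # x # bs) = m"
  shows "form r (as @ x # x # bs) = \<zero>\<^bsub>X.\<Lambda>\<^esub>"
proof -
  have "wedge R \<Omega> (map d as @ d x # d x # map d bs) = \<zero>\<^bsub>X.\<Lambda>\<^esub>"
    using assms d_closed by (intro X.wedge_alt) auto
  then show ?thesis unfolding form_def using assms(1) by simp
qed

end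

section \<open>The functional on forms induced by a multiderivation\<close>

context multiderivation begin

sublocale forms K \<phi> R m
  by unfold_locales

lemma ev_cls_cong:
  assumes "f \<in> carrier R" "set (as @ u # v # bs) \<subseteq> carrier F1" "length (as @ u # bs) = m" "D.cls u = D.cls v"
  shows "ev R \<psi> f (as @ u # bs) = ev R \<psi> f (as @ v # bs)"
proof -
  have "u \<ominus>\<^bsub>F1\<^esub> v \<in> D.U" using D.cls_eq_iff[of u v] assms by auto
  then have "ev R \<psi> f (as @ (u \<ominus>\<^bsub>F1\<^esub> v) # bs) = 0"
    using assms by (intro ev_span) auto
  then show ?thesis using ev_slot_minus[OF assms(1-3)] by simp
qed

lemma ev_cls_cong_map:
  assumes "f \<in> carrier R" "set as \<subseteq> carrier F1" "length (as @ map u gs) = m"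
    and "\<And>g. g \<in> set gs \<Longrightarrow> u g \<in> carrier F1 \<and> v g \<in> carrier F1 \<and> D.cls (u g) = D.cls (v g)"
  shows "ev R \<psi> f (as @ map u gs) = ev R \<psi> f (as @ map v gs)"
  using assms(2-)
proof (induction gs arbitrary: as)
  case (Cons g gs)
  have "ev R \<psi> f (as @ u g # map u gs) = ev R \<psi> f (as @ v g # map u gs)"
    using assms(1) Cons.prems by (intro ev_cls_cong) auto
  also have "ev R \<psi> f ((as @ [v g]) @ map u gs) = ev R \<psi> f ((as @ [v g]) @ map v gs)"
    using Cons.prems by (intro Cons.IH) auto
  then have "ev R \<psi> f (as @ v g # map u gs) = ev R \<psi> f (as @ v g # map v gs)" by simp
  finally show ?case by simp
qed simp

text \<open>A basis element of the free module under the exterior power is a list of cosets in the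
  module of differentials; \<open>\<psi>\<close> is extended to it through representatives of these
  cosets. By \<open>ev_cls_cong\<close> the value does not depend on them.\<close>

definition lam where
  "lam F = (\<Sum>ys | F ys \<noteq> \<zero>. ev R \<psi> (F ys) (map D.rep ys))"

abbreviation "F2 \<equiv> free_module R X.T"

lemma F2_iff: "F \<in> carrier F2 \<longleftrightarrow>
    (\<forall>b. F b \<in> carrier R) \<and> (\<forall>b. F b \<noteq> \<zero> \<longrightarrow> b \<in> X.T) \<and> finite {b. F b \<noteq> \<zero>}"
  unfolding free_module_carrier[OF cring_axioms] by auto

lemma rep_F1: "ys \<in> X.T \<Longrightarrow> set (map D.rep ys) \<subseteq> carrier F1"
  using D.rep(1) by (auto simp: \<Omega>_eq)

lemma lam_superset:
  assumes "finite A" "A \<subseteq> X.T" "{ys. F ys \<noteq> \<zero>} \<subseteq> A"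
  shows "lam F = (\<Sum>ys\<in>A. ev R \<psi> (F ys) (map D.rep ys))"
proof -
  have "ev R \<psi> (F ys) (map D.rep ys) = 0" if "ys \<in> A - {ys. F ys \<noteq> \<zero>}" for ys
    using that assms(2) rep_F1[of ys] ev_coeff_zero[of "map D.rep ys"] by auto
  then show ?thesis
    unfolding lam_def using assms by (intro sum.mono_neutral_left) auto
qed

lemma lam_add:
  assumes "F \<in> carrier F2" "G \<in> carrier F2"
  shows "lam (F \<oplus>\<^bsub>F2\<^esub> G) = lam F + lam G"
proof -
  let ?A = "{ys. F ys \<noteq> \<zero>} \<union> {ys. G ys \<noteq> \<zero>}"
  have A: "finite ?A" "?A \<subseteq> X.T" using assms unfolding F2_iff by auto
  have "lam (F \<oplus>\<^bsub>F2\<^esub> G) = (\<Sum>ys\<in>?A. ev R \<psi> ((F \<oplus>\<^bsub>F2\<^esub> G) ys) (map D.rep ys))"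
    using A by (intro lam_superset) (auto simp: free_module_simps)
  also have "\<dots> = (\<Sum>ys\<in>?A. ev R \<psi> (F ys) (map D.rep ys) + ev R \<psi> (G ys) (map D.rep ys))"
  proof (intro sum.cong refl)
    fix ys assume "ys \<in> ?A"
    then have "ys \<in> X.T" using A by blast
    then show "ev R \<psi> ((F \<oplus>\<^bsub>F2\<^esub> G) ys) (map D.rep ys) = ev R \<psi> (F ys) (map D.rep ys) + ev R \<psi> (G ys) (map D.rep ys)"
      unfolding free_module_simps using assms rep_F1[of ys] unfolding F2_iff by (intro ev_coeff_add) auto
  qed
  also have "\<dots> = (\<Sum>ys\<in>?A. ev R \<psi> (F ys) (map D.rep ys)) + (\<Sum>ys\<in>?A. ev R \<psi> (G ys) (map D.rep ys))"
    by (rule sum.distrib)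
  also have "(\<Sum>ys\<in>?A. ev R \<psi> (F ys) (map D.rep ys)) = lam F"
    using A by (intro lam_superset[symmetric]) auto
  also have "(\<Sum>ys\<in>?A. ev R \<psi> (G ys) (map D.rep ys)) = lam G"
    using A by (intro lam_superset[symmetric]) auto
  finally show ?thesis .
qed

lemma lam_gen:
  assumes "ys \<in> X.T" "a \<in> carrier R"
  shows "lam (a \<odot>\<^bsub>F2\<^esub> free_gen R ys) = ev R \<psi> a (map D.rep ys)"
proof -
  have "lam (a \<odot>\<^bsub>F2\<^esub> free_gen R ys) = (\<Sum>zs\<in>{ys}. ev R \<psi> ((a \<odot>\<^bsub>F2\<^esub> free_gen R ys) zs) (map D.rep zs))"
    using assms by (intro lam_superset) (auto simp: free_module_simps free_gen_def)
  then show ?thesis using assms by (simp add: free_module_simps free_gen_def)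
qed

text \<open>\<open>lam\<close> is additive but not linear over \<open>R\<close>, so vanishing on the
  span of the relations requires vanishing on every multiple of a relation.\<close>

lemma lam_relation:
  assumes "s \<in> exterior_relations R \<Omega> m" "a \<in> carrier R"
  shows "lam (a \<odot>\<^bsub>F2\<^esub> s) = 0"
proof -
  have diff: "lam (a \<odot>\<^bsub>F2\<^esub> (F \<ominus>\<^bsub>F2\<^esub> G)) = 0"
    if "F \<in> carrier F2" "G \<in> carrier F2" "lam (a \<odot>\<^bsub>F2\<^esub> F) = lam (a \<odot>\<^bsub>F2\<^esub> G)" for F G
  proof -
    have mc: "F \<ominus>\<^bsub>F2\<^esub> G \<in> carrier F2" using that by (intro X.E.F.minus_closed)
    have "(F \<ominus>\<^bsub>F2\<^esub> G) \<oplus>\<^bsub>F2\<^esub> G = F"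
      unfolding X.E.F.minus_eq using that by (subst X.E.F.a_assoc) (simp_all add: X.E.F.l_neg)
    then have "a \<odot>\<^bsub>F2\<^esub> F = a \<odot>\<^bsub>F2\<^esub> (F \<ominus>\<^bsub>F2\<^esub> G) \<oplus>\<^bsub>F2\<^esub> a \<odot>\<^bsub>F2\<^esub> G"
      using X.E.F.smult_r_distr[OF assms(2) mc that(2)] by simp
    then have "lam (a \<odot>\<^bsub>F2\<^esub> F) = lam (a \<odot>\<^bsub>F2\<^esub> (F \<ominus>\<^bsub>F2\<^esub> G)) + lam (a \<odot>\<^bsub>F2\<^esub> G)"
      using lam_add X.E.F.smult_closed assms(2) mc that(2) by simp
    then show ?thesis using that by simp
  qed
  note rep = D.rep[folded \<Omega>_eq]
  from assms(1) show ?thesis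
  proof (cases rule: X.relations_cases)
    case (add as bs x y)
    have T: "as @ x # bs \<in> X.T" "as @ y # bs \<in> X.T" "as @ (x \<oplus>\<^bsub>\<Omega>\<^esub> y) # bs \<in> X.T"
      using add by auto
    have c: "x \<in> carrier \<Omega>" "y \<in> carrier \<Omega>" "x \<oplus>\<^bsub>\<Omega>\<^esub> y \<in> carrier \<Omega>" using add by auto
    let ?r = "map D.rep"
    have "lam (a \<odot>\<^bsub>F2\<^esub> (free_gen R (as @ x # bs) \<oplus>\<^bsub>F2\<^esub> free_gen R (as @ y # bs)))
      = lam (a \<odot>\<^bsub>F2\<^esub> free_gen R (as @ x # bs)) + lam (a \<odot>\<^bsub>F2\<^esub> free_gen R (as @ y # bs))"
      using T[THEN X.gen_closed] assms(2) by (simp add: X.E.F.smult_r_distr lam_add X.E.F.smult_closed)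
    also have "\<dots> = ev R \<psi> a (?r as @ D.rep x # ?r bs) + ev R \<psi> a (?r as @ D.rep y # ?r bs)"
      using T assms(2) by (simp add: lam_gen)
    also have "\<dots> = ev R \<psi> a (?r as @ (D.rep x \<oplus>\<^bsub>F1\<^esub> D.rep y) # ?r bs)"
      using add(1,2) assms(2) rep_F1[OF T(1)] rep_F1[OF T(2)] by (intro ev_slot_add[symmetric]) auto
    also have "\<dots> = ev R \<psi> a (?r as @ D.rep (x \<oplus>\<^bsub>\<Omega>\<^esub> y) # ?r bs)"
    proof (rule ev_cls_cong)
      show "D.cls (D.rep x \<oplus>\<^bsub>F1\<^esub> D.rep y) = D.cls (D.rep (x \<oplus>\<^bsub>\<Omega>\<^esub> y))"
        using c rep by (simp add: \<Omega>_eq D.cls_add[symmetric])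
      show "set (?r as @ (D.rep x \<oplus>\<^bsub>F1\<^esub> D.rep y) # D.rep (x \<oplus>\<^bsub>\<Omega>\<^esub> y) # ?r bs) \<subseteq> carrier F1"
        using c rep rep_F1[OF T(1)] D.F.add.m_closed by simp
    qed (use add assms in auto)
    also have "\<dots> = lam (a \<odot>\<^bsub>F2\<^esub> free_gen R (as @ (x \<oplus>\<^bsub>\<Omega>\<^esub> y) # bs))"
      using T assms(2) by (simp add: lam_gen)
    finally show ?thesis
      unfolding add(3) using T[THEN X.gen_closed] by (intro diff X.E.F.add.m_closed) simp_all
  next
    case (smult as bs b x)
    have T: "as @ x # bs \<in> X.T" "as @ (b \<odot>\<^bsub>\<Omega>\<^esub> x) # bs \<in> X.T"
      using smult by auto
    have c: "x \<in> carrier \<Omega>" "b \<odot>\<^bsub>\<Omega>\<^esub> x \<in> carrier \<Omega>" using smult by auto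
    let ?r = "map D.rep"
    have "lam (a \<odot>\<^bsub>F2\<^esub> (b \<odot>\<^bsub>F2\<^esub> free_gen R (as @ x # bs))) = lam ((b \<otimes> a) \<odot>\<^bsub>F2\<^esub> free_gen R (as @ x # bs))"
      using T[THEN X.gen_closed] assms(2) smult(3) by (simp add: X.E.F.smult_assoc1[symmetric] m_comm)
    also have "\<dots> = ev R \<psi> (b \<otimes> a) (?r as @ D.rep x # ?r bs)"
      using T assms(2) smult(3) by (simp add: lam_gen)
    also have "\<dots> = ev R \<psi> a (?r as @ (b \<odot>\<^bsub>F1\<^esub> D.rep x) # ?r bs)"
      using smult(1-3) assms(2) rep_F1[OF T(1)] by (intro ev_slot_smult[symmetric]) auto
    also have "\<dots> = ev R \<psi> a (?r as @ D.rep (b \<odot>\<^bsub>\<Omega>\<^esub> x) # ?r bs)"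
    proof (rule ev_cls_cong)
      show "D.cls (b \<odot>\<^bsub>F1\<^esub> D.rep x) = D.cls (D.rep (b \<odot>\<^bsub>\<Omega>\<^esub> x))"
        using c rep smult(3) by (simp add: \<Omega>_eq D.cls_smult[symmetric])
      show "set (?r as @ (b \<odot>\<^bsub>F1\<^esub> D.rep x) # D.rep (b \<odot>\<^bsub>\<Omega>\<^esub> x) # ?r bs) \<subseteq> carrier F1"
        using c rep rep_F1[OF T(1)] smult(3) by simp
    qed (use smult assms in auto)
    also have "\<dots> = lam (a \<odot>\<^bsub>F2\<^esub> free_gen R (as @ (b \<odot>\<^bsub>\<Omega>\<^esub> x) # bs))"
      using T assms(2) by (simp add: lam_gen)
    finally show ?thesis
      unfolding smult(4) using T[THEN X.gen_closed] smult(3) by (intro diff X.E.F.smult_closed) simp_all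
  next
    case (alt as bs cs x)
    have T: "as @ x # bs @ x # cs \<in> X.T" using alt by auto
    have "lam (a \<odot>\<^bsub>F2\<^esub> s) = ev R \<psi> a (map D.rep as @ D.rep x # map D.rep bs @ D.rep x # map D.rep cs)"
      unfolding alt(3) using T assms(2) by (simp add: lam_gen)
    also have "\<dots> = 0"
      using alt(1,2) rep_F1[OF T] assms(2) by (intro ev_alt) auto
    finally show ?thesis .
  qed
qed

lemma lam_span:
  assumes "F \<in> X.E.U" "a \<in> carrier R"
  shows "lam (a \<odot>\<^bsub>F2\<^esub> F) = 0"
proof -
  define N where "N = {F \<in> carrier F2. \<forall>a\<in>carrier R. lam (a \<odot>\<^bsub>F2\<^esub> F) = 0}"
  have zero: "lam \<zero>\<^bsub>F2\<^esub> = 0" by (simp add: lam_def free_module_simps)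
  have "submodule R N F2"
    by (rule LinearCombinations.submodule.intro)
      (auto simp: N_def X.E.F.module_axioms X.E.F.smult_r_distr lam_add zero X.E.F.smult_assoc1[symmetric])
  moreover have "exterior_relations R \<Omega> m \<subseteq> N"
    using X.relations_closed lam_relation unfolding N_def by blast
  ultimately have "X.E.U \<subseteq> N" by (intro X.E.F.span_is_subset)
  then show ?thesis using assms unfolding N_def by blast
qed

definition lift where "lift Z = lam (X.E.rep Z)"

lemma lift_cls:
  assumes "F \<in> carrier F2"
  shows "lift (X.E.cls F) = lam F"
proof -
  let ?G = "X.E.rep (X.E.cls F)"
  have G: "?G \<in> carrier F2" "X.E.cls ?G = X.E.cls F"
    using X.E.rep[OF X.E.cls_closed[OF assms]] by auto
  then have "?G \<ominus>\<^bsub>F2\<^esub> F \<in> X.E.U" using assms X.E.cls_eq_iff by blast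
  then have "lam (\<one> \<odot>\<^bsub>F2\<^esub> (?G \<ominus>\<^bsub>F2\<^esub> F)) = 0" by (intro lam_span) auto
  moreover have mc: "?G \<ominus>\<^bsub>F2\<^esub> F \<in> carrier F2" using G assms by (intro X.E.F.minus_closed)
  ultimately have "lam (?G \<ominus>\<^bsub>F2\<^esub> F) = 0" by simp
  moreover have "(?G \<ominus>\<^bsub>F2\<^esub> F) \<oplus>\<^bsub>F2\<^esub> F = ?G"
    unfolding X.E.F.minus_eq using G assms by (subst X.E.F.a_assoc) (simp_all add: X.E.F.l_neg)
  ultimately have "lam ?G = lam F" using lam_add[OF mc assms] by simp
  then show ?thesis unfolding lift_def .
qed

lemma lift_add:
  assumes "Y \<in> carrier X.\<Lambda>" "Z \<in> carrier X.\<Lambda>"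
  shows "lift (Y \<oplus>\<^bsub>X.\<Lambda>\<^esub> Z) = lift Y + lift Z"
proof -
  obtain F where "F \<in> carrier F2" "Y = X.E.cls F"
    by (rule X.E.Q_carrierE[OF assms(1)[unfolded X.\<Lambda>_eq]])
  moreover obtain G where "G \<in> carrier F2" "Z = X.E.cls G"
    by (rule X.E.Q_carrierE[OF assms(2)[unfolded X.\<Lambda>_eq]])
  ultimately show ?thesis
    unfolding X.\<Lambda>_eq by (simp add: X.E.cls_add lift_cls lam_add X.E.F.add.m_closed)
qed

text \<open>Together with \<open>lift_add\<close> this is the existence half of the universal
  property. The representative chosen for \<open>d g\<close> need not be the generator itself, but
  it has the same class, which is all that \<open>ev\<close> sees.\<close>

lemma lift_form:
  assumes "r \<in> carrier R" "set gs \<subseteq> carrier R" "length gs = m"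
  shows "lift (form r gs) = \<psi> r gs"
proof -
  have T: "map d gs \<in> X.T" using assms by (intro map_d_T)
  have "form r gs = X.E.cls (r \<odot>\<^bsub>F2\<^esub> free_gen R (map d gs))"
    unfolding form_def using T assms X.E.cls_smult X.gen_closed[OF T] by (simp add: X.wedge_eq X.\<Lambda>_eq)
  then have "lift (form r gs) = ev R \<psi> r (map D.rep (map d gs))"
    using lift_cls[OF X.E.F.smult_closed[OF assms(1) X.gen_closed[OF T]]] lam_gen[OF T assms(1)] by simp
  also have "\<dots> = ev R \<psi> r ([] @ map (\<lambda>g. D.rep (d g)) gs)" by (simp add: comp_def)
  also have "\<dots> = ev R \<psi> r ([] @ map (free_gen R) gs)"
  proof (rule ev_cls_cong_map)
    fix g assume "g \<in> set gs"
    then have g: "g \<in> carrier R" using assms by auto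
    show "D.rep (d g) \<in> carrier F1 \<and> free_gen R g \<in> carrier F1 \<and> D.cls (D.rep (d g)) = D.cls (free_gen R g)"
      using D.rep[OF d_closed[OF g, unfolded \<Omega>_eq]] D.free_gen[OF g] by (simp add: d_eq)
  qed (use assms in auto)
  also have "\<dots> = \<psi> r gs" using assms by (simp add: ev_map_gen)
  finally show ?thesis .
qed

text \<open>The map \<open>h\<close> stands for the action of the scalar on the values. It is later
  multiplication by an element of \<open>K\<close>, with \<open>a\<close> its image in
  \<open>R\<close>, which makes the lift \<open>K\<close>-linear.\<close>

lemma lift_smult:
  assumes a: "a \<in> carrier R" and h: "\<And>x y. h (x + y) = h x + h y"
    and eq: "\<And>f gs. \<lbrakk>f \<in> carrier R; set gs \<subseteq> carrier R; length gs = m\<rbrakk> \<Longrightarrow> \<psi> (a \<otimes> f) gs = h (\<psi> f gs)"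
    and Z: "Z \<in> carrier X.\<Lambda>"
  shows "lift (a \<odot>\<^bsub>X.\<Lambda>\<^esub> Z) = h (lift Z)"
proof -
  obtain F where F: "F \<in> carrier F2" "Z = X.E.cls F"
    by (rule X.E.Q_carrierE[OF Z[unfolded X.\<Lambda>_eq]])
  have h0: "h 0 = 0" using h[of 0 0] by simp
  have hs: "h (sum k A) = (\<Sum>x\<in>A. h (k x))" for k and A :: "('b \<Rightarrow> 'b) set list set"
    by (induction A rule: infinite_finite_induct) (simp_all add: h0 h)
  have "lift (a \<odot>\<^bsub>X.\<Lambda>\<^esub> Z) = lam (a \<odot>\<^bsub>F2\<^esub> F)"
    unfolding F(2) X.\<Lambda>_eq using a F(1) by (simp add: X.E.cls_smult lift_cls X.E.F.smult_closed)
  also have "\<dots> = (\<Sum>ys | F ys \<noteq> \<zero>. ev R \<psi> ((a \<odot>\<^bsub>F2\<^esub> F) ys) (map D.rep ys))"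
    using F(1) a unfolding F2_iff by (intro lam_superset) (auto simp: free_module_simps)
  also have "\<dots> = (\<Sum>ys | F ys \<noteq> \<zero>. h (ev R \<psi> (F ys) (map D.rep ys)))"
  proof (intro sum.cong refl)
    fix ys assume "ys \<in> {ys. F ys \<noteq> \<zero>}"
    then have ys: "ys \<in> X.T" "F ys \<in> carrier R" using F(1) unfolding F2_iff by auto
    have "ev R \<psi> ((a \<odot>\<^bsub>F2\<^esub> F) ys) (map D.rep ys) = ev R (\<lambda>f gs. \<psi> (a \<otimes> f) gs) (F ys) (map D.rep ys)"
      unfolding free_module_simps using a ys rep_F1 by (intro ev_coeff_mult) auto
    also have "\<dots> = ev R (\<lambda>f gs. h (\<psi> f gs)) (F ys) (map D.rep ys)"
      using ys rep_F1 eq by (intro ev_cong) auto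
    also have "\<dots> = h (ev R \<psi> (F ys) (map D.rep ys))"
      using ys rep_F1 h by (intro ev_hom) auto
    finally show "ev R \<psi> ((a \<odot>\<^bsub>F2\<^esub> F) ys) (map D.rep ys) = h (ev R \<psi> (F ys) (map D.rep ys))" .
  qed
  also have "\<dots> = h (lift Z)"
    unfolding F(2) lift_cls[OF F(1)] lam_def hs ..
  finally show ?thesis .
qed

end

section \<open>Degrees, substitutions and Jacobian minors\<close>

abbreviation "keys \<equiv> Poly_Mapping.keys"
abbreviation "lookup \<equiv> Poly_Mapping.lookup"
abbreviation "single \<equiv> Poly_Mapping.single"

text \<open>The common shape of what is defined monomial by monomial: degrees, substitutions and
  partial derivatives.\<close>

definition lin_ext :: "('a \<Rightarrow> 'b::zero \<Rightarrow> 'c::comm_monoid_add) \<Rightarrow> ('a \<Rightarrow>\<^sub>0 'b) \<Rightarrow> 'c" where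
  "lin_ext g F = (\<Sum>\<alpha>\<in>keys F. g \<alpha> (lookup F \<alpha>))"

lemma lin_ext_add:
  fixes g :: "'a \<Rightarrow> 'b::monoid_add \<Rightarrow> 'c::comm_monoid_add"
  assumes "\<And>\<alpha>. g \<alpha> 0 = 0" "\<And>\<alpha> a b. g \<alpha> (a + b) = g \<alpha> a + g \<alpha> b"
  shows "lin_ext g (F + G) = lin_ext g F + lin_ext g G"
  unfolding lin_ext_def by (rule setsum_keys_plus_distrib) (simp_all add: assms)

lemma lin_ext_single: "g \<alpha> 0 = 0 \<Longrightarrow> lin_ext g (single \<alpha> c) = g \<alpha> c"
  by (simp add: lin_ext_def)

lemma lin_ext_0 [simp]: "lin_ext g 0 = 0"
  by (simp add: lin_ext_def)

lemma mpoly_sum_single: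
  fixes F :: "'a \<Rightarrow>\<^sub>0 'b::comm_monoid_add"
  shows "F = (\<Sum>\<alpha>\<in>keys F. single \<alpha> (lookup F \<alpha>))"
proof (rule poly_mapping_eqI)
  fix \<beta>
  have "lookup (\<Sum>\<alpha>\<in>keys F. single \<alpha> (lookup F \<alpha>)) \<beta>
    = (\<Sum>\<alpha>\<in>keys F. if \<alpha> = \<beta> then lookup F \<alpha> else 0)"
    unfolding lookup_sum by (intro sum.cong) (auto simp: lookup_single when_def)
  also have "\<dots> = lookup F \<beta>"
    by (simp add: sum.delta in_keys_iff)
  finally show "lookup F \<beta> = lookup (\<Sum>\<alpha>\<in>keys F. single \<alpha> (lookup F \<alpha>)) \<beta>" ..
qed

lemma poly_mapping_sum_induct [case_names single add]:
  fixes F :: "'a \<Rightarrow>\<^sub>0 'b::comm_monoid_add"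
  assumes "\<And>\<alpha> c. P (single \<alpha> c)" "\<And>F G. P F \<Longrightarrow> P G \<Longrightarrow> P (F + G)"
  shows "P F"
proof -
  have "P (\<Sum>\<alpha>\<in>A. single \<alpha> (lookup F \<alpha>))" if "finite A" for A
    using that by (induction A) (use assms assms(1)[of undefined 0] in auto)
  then show ?thesis using mpoly_sum_single[of F] by (metis finite_keys)
qed

definition tdeg :: "(nat \<Rightarrow>\<^sub>0 nat) \<Rightarrow> nat" where
  "tdeg = lin_ext (\<lambda>j k. k)"

text \<open>The variable \<open>X\<^sub>0\<close> is the homogenizing one, so the local degree ignores it.\<close>

definition ydeg :: "(nat \<Rightarrow>\<^sub>0 nat) \<Rightarrow> nat" where
  "ydeg = lin_ext (\<lambda>j k. if j = 0 then 0 else k)"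

lemma tdeg_simps [simp]:
  "tdeg 0 = 0" "tdeg (\<alpha> + \<beta>) = tdeg \<alpha> + tdeg \<beta>" "tdeg (single j k) = k"
  by (simp_all add: tdeg_def lin_ext_add lin_ext_single)

lemma ydeg_simps [simp]:
  "ydeg 0 = 0" "ydeg (\<alpha> + \<beta>) = ydeg \<alpha> + ydeg \<beta>" "ydeg (single j k) = (if j = 0 then 0 else k)"
  by (simp_all add: ydeg_def lin_ext_add lin_ext_single)

lemma tdeg_ydeg: "tdeg \<alpha> = lookup \<alpha> 0 + ydeg \<alpha>"
  by (induction \<alpha> rule: poly_mapping_sum_induct) (auto simp: lookup_single lookup_add when_def)

lemma ydeg_0_iff: "ydeg \<alpha> = 0 \<longleftrightarrow> keys \<alpha> \<subseteq> {0}"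
  unfolding ydeg_def lin_ext_def by (auto simp: in_keys_iff)

lemma homogeneous_tdeg: "homogeneous d F \<longleftrightarrow> (\<forall>\<alpha>\<in>keys F. tdeg \<alpha> = d)"
  by (simp add: homogeneous_def tdeg_def lin_ext_def)

lemma keys_diff_single: "\<alpha> = (\<alpha> - single j 1) + single j 1"
  if "j \<in> keys \<alpha>" for \<alpha> :: "nat \<Rightarrow>\<^sub>0 nat"
  using that by (intro poly_mapping_eqI) (auto simp: lookup_add lookup_minus lookup_single when_def in_keys_iff)

lemma homogeneous_simps:
  "homogeneous d 0"
  "homogeneous d F \<Longrightarrow> homogeneous d G \<Longrightarrow> homogeneous d (F + G)"
  "homogeneous d F \<Longrightarrow> homogeneous d (- F)"
  "homogeneous d F \<Longrightarrow> homogeneous d G \<Longrightarrow> homogeneous d (F - G)"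
  "homogeneous d F \<Longrightarrow> homogeneous e G \<Longrightarrow> homogeneous (d + e) (F * G)"
  "homogeneous (tdeg \<alpha>) (single \<alpha> c)"
  unfolding homogeneous_tdeg
  using keys_add[of F G] keys_mult[of F G] keys_diff[of F G]
  by (fastforce split: if_splits)+

lemma homogeneous_sum: "(\<And>x. x \<in> A \<Longrightarrow> homogeneous d (f x)) \<Longrightarrow> homogeneous d (sum f A)"
  by (induction A rule: infinite_finite_induct) (auto intro: homogeneous_simps)

lemma homogeneous_power: "homogeneous d F \<Longrightarrow> homogeneous (k * d) (F ^ k)"
proof (induction k)
  case 0
  then show ?case using homogeneous_simps(6)[of 0 "1::'a"] by simp
next
  case (Suc k)
  then show ?case using homogeneous_simps(5)[of d F "k * d" "F ^ k"] by simp
qed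

section \<open>Evaluation of monomials and substitution into polynomials\<close>

definition pw :: "('a \<Rightarrow> 'b::comm_monoid_mult) \<Rightarrow> ('a \<Rightarrow>\<^sub>0 nat) \<Rightarrow> 'b" where
  "pw v \<alpha> = (\<Prod>j\<in>keys \<alpha>. v j ^ lookup \<alpha> j)"

lemma pw_superset:
  assumes "finite A" "keys \<alpha> \<subseteq> A"
  shows "pw v \<alpha> = (\<Prod>j\<in>A. v j ^ lookup \<alpha> j)"
  unfolding pw_def using assms by (intro prod.mono_neutral_left) (auto simp: in_keys_iff)

lemma pw_0 [simp]: "pw v 0 = 1"
  by (simp add: pw_def)

lemma pw_add: "pw v (\<alpha> + \<beta>) = pw v \<alpha> * pw v \<beta>"
proof -
  let ?A = "keys \<alpha> \<union> keys \<beta>"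
  have "pw v (\<alpha> + \<beta>) = (\<Prod>j\<in>?A. v j ^ lookup (\<alpha> + \<beta>) j)"
    using keys_add[of \<alpha> \<beta>] by (intro pw_superset) auto
  also have "\<dots> = (\<Prod>j\<in>?A. v j ^ lookup \<alpha> j) * (\<Prod>j\<in>?A. v j ^ lookup \<beta> j)"
    by (simp add: lookup_add power_add prod.distrib)
  also have "(\<Prod>j\<in>?A. v j ^ lookup \<alpha> j) = pw v \<alpha>" by (intro pw_superset[symmetric]) auto
  also have "(\<Prod>j\<in>?A. v j ^ lookup \<beta> j) = pw v \<beta>" by (intro pw_superset[symmetric]) auto
  finally show ?thesis .
qed

lemma pw_single [simp]: "pw v (single j k) = v j ^ k"
  by (simp add: pw_def)

text \<open>Applied with \<open>h = const_poly\<close> for a change of coordinates and with the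
  identity for evaluation at a point.\<close>

definition subst :: "('k \<Rightarrow> 'b) \<Rightarrow> (nat \<Rightarrow> 'b) \<Rightarrow> 'k::comm_ring_1 mpoly \<Rightarrow> 'b::comm_ring_1" where
  "subst h v = lin_ext (\<lambda>\<alpha> c. h c * pw v \<alpha>)"

locale coeff_hom =
  fixes h :: "'k::comm_ring_1 \<Rightarrow> 'b::comm_ring_1"
  assumes h_add: "h (a + b) = h a + h b" and h_mult: "h (a * b) = h a * h b" and h_one: "h 1 = 1"
begin

lemma h_zero: "h 0 = 0"
  using h_add[of 0 0] by simp

lemma subst_add: "subst h v (F + G) = subst h v F + subst h v G"
  unfolding subst_def by (intro lin_ext_add) (simp_all add: h_zero h_add distrib_right)

lemma subst_single: "subst h v (single \<alpha> c) = h c * pw v \<alpha>"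
  unfolding subst_def by (intro lin_ext_single) (simp_all add: h_zero)

lemma subst_mult: "subst h v (F * G) = subst h v F * subst h v G"
proof (induction F rule: poly_mapping_sum_induct)
  case (single \<alpha> c)
  show ?case
  proof (induction G rule: poly_mapping_sum_induct)
    case (single \<beta> e)
    show ?case by (simp add: mult_single subst_single h_mult pw_add mult_ac)
  qed (simp add: subst_add distrib_left)
qed (simp add: subst_add distrib_right)

lemma subst_0 [simp]: "subst h v 0 = 0"
  by (simp add: subst_def)

lemma subst_1 [simp]: "subst h v 1 = 1"
  using subst_single[of v 0 1] by (simp add: h_one)

lemma subst_uminus: "subst h v (- F) = - subst h v F"
  using subst_add[of v F "- F"] by (simp add: eq_neg_iff_add_eq_0 add.commute)

lemma subst_diff: "subst h v (F - G) = subst h v F - subst h v G"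
  using subst_add[of v F "- G"] by (simp add: subst_uminus)

lemma subst_power: "subst h v (F ^ k) = subst h v F ^ k"
  by (induction k) (simp_all add: subst_mult)

lemma subst_const: "subst h v (const_poly c) = h c"
  by (simp add: const_poly_def subst_single)

lemma subst_var: "subst h v (var_poly j) = v j"
  by (simp add: var_poly_def subst_single h_one)

end

lemma const_poly_simps:
  "const_poly (a + b) = const_poly a + const_poly b"
  "const_poly (a * b) = const_poly a * const_poly b"
  "const_poly 1 = 1" "const_poly 0 = 0" "const_poly (- a) = - const_poly a"
  by (simp_all add: const_poly_def single_add mult_single single_uminus)

interpretation const: coeff_hom const_poly
  by unfold_locales (simp_all add: const_poly_simps)

interpretation ident: coeff_hom "\<lambda>x. x"
  by unfold_locales simp_all

lemma eval_mpoly_subst: "eval_mpoly v = subst (\<lambda>x. x) v"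
  by (rule ext) (simp add: eval_mpoly_def subst_def lin_ext_def pw_def)

lemma single_const_pw:
  fixes c :: "'k::comm_ring_1"
  shows "single \<alpha> c = const_poly c * pw var_poly \<alpha>"
proof -
  have *: "single \<alpha> (1::'k) = pw var_poly \<alpha>" for \<alpha> :: "nat \<Rightarrow>\<^sub>0 nat"
  proof (induction \<alpha> rule: poly_mapping_sum_induct)
    case (single j k)
    have "single (single j k) (1::'k) = var_poly j ^ k"
    proof (induction k)
      case (Suc k)
      have "single (single j (Suc k)) (1::'k)
          = single (single j 1) 1 * single (single j k) 1"
        by (simp add: mult_single single_add[symmetric])
      then show ?case using Suc by (simp add: var_poly_def)
    qed simp
    then show ?case by simp
  next
    case (add \<alpha> \<beta>)
    have "single (\<alpha> + \<beta>) (1::'k) = single \<alpha> 1 * single \<beta> 1"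
      by (simp add: mult_single)
    then show ?case using add by (simp add: pw_add)
  qed
  have "single \<alpha> c = const_poly c * single \<alpha> 1"
    by (simp add: const_poly_def mult_single)
  then show ?thesis by (simp only: *)
qed

lemma coeff_const_mult: "lookup (const_poly c * F) \<alpha> = c * lookup F \<alpha>"
proof (induction F rule: poly_mapping_sum_induct)
  case (single \<beta> e)
  show ?case by (simp add: const_poly_def mult_single lookup_single when_def)
qed (simp add: distrib_left lookup_add)

text \<open>Subtraction of exponents is truncated: if \<open>X_j\<close> does not occur in the
  monomial, the exponent is left unchanged and the factor \<open>0\<close> removes the term.\<close>

definition pderiv_mpoly :: "nat \<Rightarrow> 'k::comm_ring_1 mpoly \<Rightarrow> 'k mpoly" where
  "pderiv_mpoly j = lin_ext (\<lambda>\<alpha> c. single (\<alpha> - single j 1) (of_nat (lookup \<alpha> j) * c))"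

lemma pd_add: "pderiv_mpoly j (F + G) = pderiv_mpoly j F + pderiv_mpoly j G"
  unfolding pderiv_mpoly_def by (rule lin_ext_add) (simp_all add: distrib_left single_add)

lemma pd_single: "pderiv_mpoly j (single \<alpha> c) =
    single (\<alpha> - single j 1) (of_nat (lookup \<alpha> j) * c)"
  unfolding pderiv_mpoly_def by (rule lin_ext_single) simp

lemma pd_mult: "pderiv_mpoly j (F * G) = F * pderiv_mpoly j G + G * pderiv_mpoly j F"
proof (induction F rule: poly_mapping_sum_induct)
  case (single \<alpha> a)
  show ?case
  proof (induction G rule: poly_mapping_sum_induct)
    case (single \<beta> b)
    \<comment> \<open>Truncated subtraction does not commute with addition when \<open>X_j\<close>
      is absent from \<open>\<delta>\<close>; then both sides have coefficient
      \<open>0\<close>.\<close>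
    have *: "single (\<gamma> + (\<delta> - single j 1)) (of_nat (lookup \<delta> j) * c)
      = single (\<gamma> + \<delta> - single j 1) (of_nat (lookup \<delta> j) * c)"
      for \<gamma> \<delta> :: "nat \<Rightarrow>\<^sub>0 nat" and c :: 'a
    proof (cases "j \<in> keys \<delta>")
      case True
      then have "\<gamma> + (\<delta> - single j 1) = \<gamma> + \<delta> - single j 1"
        by (intro poly_mapping_eqI) (auto simp: lookup_add lookup_minus lookup_single when_def in_keys_iff)
      then show ?thesis by simp
    qed (simp add: in_keys_iff)
    have "single \<alpha> a * pderiv_mpoly j (single \<beta> b) =
        single (\<alpha> + (\<beta> - single j 1)) (of_nat (lookup \<beta> j) * (a * b))"
      by (simp add: pd_single mult_single mult_ac)
    moreover have "single \<beta> b * pderiv_mpoly j (single \<alpha> a) =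
        single (\<beta> + (\<alpha> - single j 1)) (of_nat (lookup \<alpha> j) * (a * b))"
      by (simp add: pd_single mult_single mult_ac)
    ultimately show ?case
      unfolding * by (simp add: mult_single pd_single lookup_add distrib_right add.commute[of \<beta> \<alpha>] add.commute single_add)
  qed (simp add: pd_add distrib_left distrib_right add_ac)
qed (simp add: pd_add distrib_left distrib_right add_ac)

lemma pd_const: "pderiv_mpoly j (const_poly c) = 0"
  by (simp add: const_poly_def pd_single)

lemma pd_var: "pderiv_mpoly j (var_poly i) = (if i = j then 1 else 0)"
  by (simp add: var_poly_def pd_single lookup_single when_def)

lemma pd_keys:
  assumes "\<beta> \<in> keys (pderiv_mpoly j F)"
  obtains \<alpha> where "\<alpha> \<in> keys F" "\<alpha> = \<beta> + single j 1"
proof -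
  have "\<beta> \<in> (\<Union>\<alpha>\<in>keys F. keys
      (single (\<alpha> - single j 1) (of_nat (lookup \<alpha> j) * lookup F \<alpha>)))"
    using assms keys_sum unfolding pderiv_mpoly_def lin_ext_def by fast
  then obtain \<alpha> where "\<alpha> \<in> keys F" "\<beta> \<in> keys
      (single (\<alpha> - single j 1) (of_nat (lookup \<alpha> j) * lookup F \<alpha>))"
    by blast
  then have \<alpha>: "\<alpha> \<in> keys F" "\<beta> = \<alpha> - single j 1"
      "of_nat (lookup \<alpha> j) * lookup F \<alpha> \<noteq> 0"
    by (auto split: if_splits)
  then have "j \<in> keys \<alpha>" by (metis in_keys_iff of_nat_0 mult_zero_left)
  then show ?thesis using keys_diff_single[of j \<alpha>] \<alpha> that by metis
qed

text \<open>The ideal \<open>(X\<^sub>1, X\<^sub>2, \<dots>)\<^sup>s\<close>, that is, the polynomials vanishing to order \<open>s\<close> at \<open>(1 : 0 : \<dots> : 0)\<close>.\<close>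

definition vord :: "nat \<Rightarrow> 'k::comm_ring_1 mpoly set" where
  "vord s = {F. \<forall>\<alpha>\<in>keys F. s \<le> ydeg \<alpha>}"

lemma vord_0 [simp]: "0 \<in> vord s" "vord 0 = UNIV"
  by (simp_all add: vord_def)

lemma vord_add: "F \<in> vord s \<Longrightarrow> G \<in> vord s \<Longrightarrow> F + G \<in> vord s"
  unfolding vord_def using keys_add[of F G] by auto

lemma vord_sum: "(\<And>x. x \<in> A \<Longrightarrow> f x \<in> vord s) \<Longrightarrow> sum f A \<in> vord s"
  by (induction A rule: infinite_finite_induct) (auto intro: vord_add)

lemma vord_mult: "F \<in> vord s \<Longrightarrow> G \<in> vord r \<Longrightarrow> F * G \<in> vord (s + r)"
  unfolding vord_def using keys_mult[of F G] by (fastforce intro: add_mono)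

lemma vord_mult_right: "F \<in> vord s \<Longrightarrow> F * G \<in> vord s"
  using vord_mult[of F s G 0] by simp

lemma vord_mult_left: "F \<in> vord s \<Longrightarrow> G * F \<in> vord s"
  using vord_mult_right[of F s G] by (simp add: mult.commute)

lemma vord_mono: "F \<in> vord s \<Longrightarrow> r \<le> s \<Longrightarrow> F \<in> vord r"
  unfolding vord_def by auto

lemma vord_uminus: "F \<in> vord s \<Longrightarrow> - F \<in> vord s"
  unfolding vord_def by simp

lemma vord_lookup: "F \<in> vord s \<Longrightarrow> ydeg \<alpha> < s \<Longrightarrow> lookup F \<alpha> = 0"
  unfolding vord_def by (metis (no_types, lifting) in_keys_iff mem_Collect_eq not_le)

lemma vord_pd:
  assumes "F \<in> vord s"
  shows "pderiv_mpoly j F \<in> vord (s - 1)"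
  unfolding vord_def
proof safe
  fix \<beta> assume "\<beta> \<in> keys (pderiv_mpoly j F)"
  then obtain \<alpha> where "\<alpha> \<in> keys F" "\<alpha> = \<beta> + single j 1" by (rule pd_keys)
  then have "s \<le> ydeg (\<beta> + single j 1)" using assms by (auto simp: vord_def)
  then show "s - 1 \<le> ydeg \<beta>" by (simp split: if_splits)
qed

text \<open>The local degree ignores \<open>X_0\<close>, so this derivative, unlike the others, does
  not lower the order. This is what saves the form \<open>dy_0\<close> at a point of multiplicity
  1.\<close>

lemma vord_pd0:
  assumes "F \<in> vord s"
  shows "pderiv_mpoly 0 F \<in> vord s"
  unfolding vord_def
proof safe
  fix \<beta> assume "\<beta> \<in> keys (pderiv_mpoly 0 F)"
  then obtain \<alpha> where "\<alpha> \<in> keys F" "\<alpha> = \<beta> + single 0 1" by (rule pd_keys)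
  then have "s \<le> ydeg (\<beta> + single 0 1)" using assms by (auto simp: vord_def)
  then show "s \<le> ydeg \<beta>" by simp
qed

text \<open>The coefficient of \<open>dX_L\<close> in \<open>dG_1 ... dG_m\<close>, for an index
  list \<open>L\<close> of the same length.\<close>

definition jac :: "nat list \<Rightarrow> 'k::comm_ring_1 mpoly list \<Rightarrow> 'k mpoly" where
  "jac L Gs = det (mat (length L) (length L) (\<lambda>(a, b). pderiv_mpoly (L ! b) (Gs ! a)))"

text \<open>Expansion along the row of \<open>x\<close>: the cofactors do not involve that row and
  can be computed with \<open>0\<close> in place of \<open>x\<close>. Thus a minor behaves in one
  slot as the partial derivatives do.\<close>

lemma jac_row:
  assumes "length (as @ x # bs) = length L"
  shows "\<exists>C. \<forall>x. jac L (as @ x # bs) = (\<Sum>b<length L. pderiv_mpoly (L ! b) x * C b)"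
proof -
  let ?M = "\<lambda>x. mat (length L) (length L) (\<lambda>(a, b). pderiv_mpoly (L ! b) ((as @ x # bs) ! a))"
  let ?i = "length as"
  have "jac L (as @ x # bs) = (\<Sum>b<length L. pderiv_mpoly (L ! b) x * cofactor (?M 0) ?i b)" for x
  proof -
    have i: "?i < length L" using assms by auto
    have "jac L (as @ x # bs) = (\<Sum>b<length L. ?M x $$ (?i, b) * cofactor (?M x) ?i b)"
      unfolding jac_def using i by (intro laplace_expansion_row) auto
    also have "\<dots> = (\<Sum>b<length L. pderiv_mpoly (L ! b) x * cofactor (?M 0) ?i b)"
    proof (intro sum.cong refl)
      fix b assume "b \<in> {..<length L}"
      moreover have "mat_delete (?M x) ?i b = mat_delete (?M 0) ?i b"
        using i \<open>b \<in> _\<close> by (intro eq_matI) (auto simp: mat_delete_def nth_append nth_Cons')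
      ultimately show "?M x $$ (?i, b) * cofactor (?M x) ?i b = pderiv_mpoly (L ! b) x * cofactor (?M 0) ?i b"
        using i by (simp add: cofactor_def)
    qed
    finally show ?thesis .
  qed
  then show ?thesis by blast
qed

lemma jac_add:
  assumes "length (as @ x # bs) = length L"
  shows "jac L (as @ (x + y) # bs) = jac L (as @ x # bs) + jac L (as @ y # bs)"
proof -
  obtain C where "\<And>x. jac L (as @ x # bs) = (\<Sum>b<length L. pderiv_mpoly (L ! b) x * C b)"
    using jac_row[OF assms] by blast
  then show ?thesis by (simp add: pd_add distrib_right sum.distrib)
qed

lemma jac_mult:
  assumes "length (as @ x # bs) = length L"
  shows "jac L (as @ (x * y) # bs) = x * jac L (as @ y # bs) + y * jac L (as @ x # bs)"
proof -
  obtain C where "\<And>x. jac L (as @ x # bs) = (\<Sum>b<length L. pderiv_mpoly (L ! b) x * C b)"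
    using jac_row[OF assms] by blast
  then show ?thesis by (simp add: pd_mult distrib_right sum.distrib sum_distrib_left mult.assoc)
qed

lemma jac_const:
  assumes "Suc (length (as @ bs)) = length L"
  shows "jac L (as @ const_poly c # bs) = 0"
proof -
  have "length (as @ (0::'a mpoly) # bs) = length L" using assms by simp
  then obtain C where "\<And>x. jac L (as @ x # bs) = (\<Sum>b<length L. pderiv_mpoly (L ! b) x * C b)"
    using jac_row by blast
  then show ?thesis by (simp add: pd_const)
qed

lemma jac_alt:
  assumes "length (as @ x # x # bs) = length L"
  shows "jac L (as @ x # x # bs) = 0"
  unfolding jac_def using assms
  by (intro det_identical_rows[of _ "length L" "length as" "Suc (length as)"])
    (auto intro!: eq_vecI simp: nth_append)

lemma jac_vord:
  assumes "length (as @ x # bs) = length L" "x \<in> vord s"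
  shows "jac L (as @ x # bs) \<in> vord (s - 1)"
proof -
  obtain C where "\<And>x. jac L (as @ x # bs) = (\<Sum>b<length L. pderiv_mpoly (L ! b) x * C b)"
    using jac_row[OF assms(1)] by blast
  then show ?thesis using assms(2) by (auto intro!: vord_sum vord_mult_right vord_pd[unfolded One_nat_def])
qed

lemma jac_swap:
  assumes "length (as @ x # y # bs) = length L"
  shows "jac L (as @ x # y # bs) = - jac L (as @ y # x # bs)"
proof -
  have "0 = jac L (as @ (x + y) # (x + y) # bs)" using assms by (intro jac_alt[symmetric]) simp
  also have "\<dots> = jac L (as @ x # (x + y) # bs) + jac L (as @ y # (x + y) # bs)"
    using assms by (intro jac_add) simp
  also have "jac L (as @ x # (x + y) # bs) = jac L (as @ x # x # bs) + jac L (as @ x # y # bs)"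
    using assms jac_add[of "as @ [x]" x bs L y] by simp
  also have "jac L (as @ y # (x + y) # bs) = jac L (as @ y # x # bs) + jac L (as @ y # y # bs)"
    using assms jac_add[of "as @ [y]" x bs L y] by simp
  also have "jac L (as @ x # x # bs) = 0" using assms by (intro jac_alt) simp
  also have "jac L (as @ y # y # bs) = 0" using assms by (intro jac_alt) simp
  finally show ?thesis by (simp add: eq_neg_iff_add_eq_0)
qed

text \<open>Expansion along the first row, which expresses the coefficients of
  \<open>dx dG_1 ... dG_m\<close> through those of \<open>dG_1 ... dG_m\<close>.\<close>

lemma jac_Cons:
  assumes "Suc (length Gs) = length L"
  shows "jac L (x # Gs) = (\<Sum>b<length L. (- 1) ^ b * pderiv_mpoly (L ! b) x * jac (take b L @ drop (Suc b) L) Gs)"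
proof -
  let ?M = "mat (length L) (length L) (\<lambda>(a, b). pderiv_mpoly (L ! b) ((x # Gs) ! a))"
  have "jac L (x # Gs) = (\<Sum>b<length L. ?M $$ (0, b) * cofactor ?M 0 b)"
    unfolding jac_def using assms by (intro laplace_expansion_row) auto
  also have "\<dots> = (\<Sum>b<length L. (- 1) ^ b * pderiv_mpoly (L ! b) x * jac (take b L @ drop (Suc b) L) Gs)"
  proof (intro sum.cong refl)
    fix b assume b: "b \<in> {..<length L}"
    have "mat_delete ?M 0 b = mat (length L - 1) (length L - 1)
        (\<lambda>(i, j). pderiv_mpoly ((take b L @ drop (Suc b) L) ! j) (Gs ! i))"
      using assms b by (intro eq_matI) (auto simp: mat_delete_def nth_append min_def)
    then show "?M $$ (0, b) * cofactor ?M 0 b = (- 1) ^ b * pderiv_mpoly (L ! b) x * jac (take b L @ drop (Suc b) L) Gs"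
      using assms b by (subst index_mat) (auto simp: cofactor_def jac_def)
  qed
  finally show ?thesis .
qed

lemma jac_vars:
  assumes "length L = length js" "sorted_wrt (<) L" "sorted_wrt (<) js"
  shows "jac L (map var_poly js) = (if L = js then 1 else 0)"
  using assms
proof (induction js arbitrary: L)
  case Nil
  then show ?case by (simp add: jac_def)
next
  case (Cons j js)
  obtain l L' where L: "L = l # L'" using Cons.prems by (cases L) auto
  have summand: "(- 1) ^ b * pderiv_mpoly (L ! b) (var_poly j) * jac (take b L @ drop (Suc b) L) (map var_poly js)
      = (if b = 0 \<and> L = j # js then 1 else (0 :: 'a mpoly))" if b: "b < length L" for b
  proof -
    have sub: "sorted_wrt (<) (take b L @ drop (Suc b) L)"
    proof -
      have "sorted_wrt (<) (take b L @ L ! b # drop (Suc b) L)"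
        using Cons.prems b by (simp add: id_take_nth_drop[symmetric])
      then show ?thesis by (simp add: sorted_wrt_append)
    qed
    have IH: "jac (take b L @ drop (Suc b) L) (map var_poly js) = (if take b L @ drop (Suc b) L = js then 1 else (0 :: 'a mpoly))"
      using Cons.prems sub b by (intro Cons.IH) auto
    show ?thesis
    proof (cases "L ! b = j \<and> take b L @ drop (Suc b) L = js")
      case True
      \<comment> \<open>For \<open>b > 0\<close> the head \<open>l\<close> of \<open>L\<close> would
        belong to \<open>js\<close>, giving \<open>j < l < L ! b = j\<close>.\<close>
      have "b = 0"
      proof (rule ccontr)
        assume "b \<noteq> 0"
        then have "l \<in> set js" using True L by (cases b) auto
        then have "j < l" using Cons.prems by simp
        moreover have "l < L ! b"
          using Cons.prems(2) b \<open>b \<noteq> 0\<close> sorted_wrt_nth_less[of "(<)" L 0 b] L by simp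
        ultimately show False using True by simp
      qed
      then show ?thesis using True IH L by (simp add: pd_var)
    next
      case False
      then have "\<not> (b = 0 \<and> L = j # js)" by auto
      then show ?thesis using False IH by (auto simp: pd_var)
    qed
  qed
  have "jac L (var_poly j # map var_poly js) = (\<Sum>b<length L. if b = 0 \<and> L = j # js then 1 else (0 :: 'a mpoly))"
    using Cons.prems summand by (subst jac_Cons) (auto intro!: sum.cong)
  also have "\<dots> = (if L = j # js then 1 else 0)"
    using L by (cases "L = j # js") (auto simp: sum.delta)
  finally show ?case by simp
qed

section \<open>Forms over a coordinate ring\<close>

abbreviation PR :: "nat \<Rightarrow> 'k::comm_ring_1 mpoly set" where
  "PR n \<equiv> carrier (poly_ring n)"

lemma PR_iff: "F \<in> PR n \<longleftrightarrow> (\<forall>\<alpha>\<in>keys F. keys \<alpha> \<subseteq> {..n})"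
  by (simp add: poly_ring_def)

lemma poly_ring_simps [simp]:
  "F \<otimes>\<^bsub>poly_ring n\<^esub> G = F * G" "F \<oplus>\<^bsub>poly_ring n\<^esub> G = F + G"
  "\<one>\<^bsub>poly_ring n\<^esub> = 1" "\<zero>\<^bsub>poly_ring n\<^esub> = 0"
  by (simp_all add: poly_ring_def)

lemma PR_add: "F \<in> PR n \<Longrightarrow> G \<in> PR n \<Longrightarrow> F + G \<in> PR n"
  using keys_add[of F G] unfolding PR_iff by blast

lemma PR_uminus: "F \<in> PR n \<Longrightarrow> - F \<in> PR n"
  unfolding PR_iff by simp

lemma PR_diff: "F \<in> PR n \<Longrightarrow> G \<in> PR n \<Longrightarrow> F - G \<in> PR n"
  using PR_add[of F n "- G"] PR_uminus[of G n] by simp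

lemma PR_mult:
  assumes "F \<in> PR n" "G \<in> PR n"
  shows "F * G \<in> PR n"
  unfolding PR_iff
proof
  fix \<gamma> assume "\<gamma> \<in> keys (F * G)"
  then obtain \<alpha> \<beta> where "\<gamma> = \<alpha> + \<beta>" "\<alpha> \<in> keys F" "\<beta> \<in> keys G"
    using keys_mult[of F G] by blast
  then show "keys \<gamma> \<subseteq> {..n}"
    using assms keys_add[of \<alpha> \<beta>] unfolding PR_iff by blast
qed

lemma PR_0 [simp]: "0 \<in> PR n"
  by (simp add: PR_iff)

lemma PR_const [simp]: "const_poly c \<in> PR n"
  by (simp add: PR_iff const_poly_def)

lemma PR_1 [simp]: "1 \<in> PR n"
  using PR_const[of 1 n] by (simp add: const_poly_simps)

lemma PR_var: "j \<le> n \<Longrightarrow> var_poly j \<in> PR n"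
  by (simp add: PR_iff var_poly_def)

lemma PR_power: "F \<in> PR n \<Longrightarrow> F ^ k \<in> PR n"
  by (induction k) (auto intro: PR_mult)

lemma PR_sum: "(\<And>x. x \<in> A \<Longrightarrow> f x \<in> PR n) \<Longrightarrow> sum f A \<in> PR n"
  by (induction A rule: infinite_finite_induct) (auto intro: PR_add)

lemma PR_prod: "(\<And>x. x \<in> A \<Longrightarrow> f x \<in> PR n) \<Longrightarrow> prod f A \<in> PR n"
  by (induction A rule: infinite_finite_induct) (auto intro: PR_mult)

lemma poly_ring_cring: "cring (poly_ring n :: 'k::comm_ring_1 mpoly ring)"
proof (rule cringI)
  show "abelian_group (poly_ring n :: 'k mpoly ring)"
  proof (rule abelian_groupI)
    fix F :: "'k mpoly" assume "F \<in> PR n"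
    then show "\<exists>G\<in>PR n. G \<oplus>\<^bsub>poly_ring n\<^esub> F = \<zero>\<^bsub>poly_ring n\<^esub>"
      by (intro bexI[of _ "- F"]) (simp_all add: PR_uminus)
  qed (simp_all add: PR_add add_ac)
  show "comm_monoid (poly_ring n :: 'k mpoly ring)"
    by (rule comm_monoidI) (simp_all add: PR_mult mult_ac)
qed (simp_all add: distrib_right)

lemma poly_ring_a_inv:
  assumes "F \<in> PR n"
  shows "\<ominus>\<^bsub>poly_ring n\<^esub> F = - (F :: 'k::comm_ring_1 mpoly)"
proof -
  interpret cring "poly_ring n :: 'k mpoly ring" by (rule poly_ring_cring)
  show ?thesis using assms by (intro minus_equality) (simp_all add: PR_uminus)
qed

locale coord =
  fixes n m :: nat and I :: "'k::field mpoly set"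
  assumes ideal: "ideal I (poly_ring n)"
begin

abbreviation "P \<equiv> PR n :: 'k mpoly set"
abbreviation "R \<equiv> coord_ring n I"
abbreviation "cls \<equiv> coord_class n I"

sublocale I: ideal I "poly_ring n" by (rule ideal)

lemma R_cring: "cring R"
  unfolding coord_ring_def by (rule I.quotient_is_cring) (rule poly_ring_cring)

lemma cls_hom: "cls \<in> Ring.ring_hom (poly_ring n) R"
proof -
  have "cls = (+>\<^bsub>poly_ring n\<^esub>) I" by (rule ext) (simp add: coord_class_def)
  then show ?thesis unfolding coord_ring_def using I.rcos_ring_hom by simp
qed

lemma cls_closed: "F \<in> P \<Longrightarrow> cls F \<in> carrier R"
  using cls_hom by (rule ring_hom_closed)

lemma cls_add: "F \<in> P \<Longrightarrow> G \<in> P \<Longrightarrow> cls F \<oplus>\<^bsub>R\<^esub> cls G = cls (F + G)"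
  using ring_hom_add[OF cls_hom, of F G] by simp

lemma cls_mult: "F \<in> P \<Longrightarrow> G \<in> P \<Longrightarrow> cls F \<otimes>\<^bsub>R\<^esub> cls G = cls (F * G)"
  using ring_hom_mult[OF cls_hom, of F G] by simp

lemma cls_surj: "r \<in> carrier R \<Longrightarrow> \<exists>F\<in>P. r = cls F"
  by (auto simp: coord_ring_def FactRing_def A_RCOSETS_def' coord_class_def)

lemma cls_eq_iff: "F \<in> P \<Longrightarrow> G \<in> P \<Longrightarrow> cls F = cls G \<longleftrightarrow> F - G \<in> I"
proof -
  assume FG: "F \<in> P" "G \<in> P"
  have "cls F = cls G \<longleftrightarrow> F \<in> I +>\<^bsub>poly_ring n\<^esub> G"
    using I.a_repr_independence'[of F G] I.a_rcos_self[of F] FG by (auto simp: coord_class_def)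
  also have "\<dots> \<longleftrightarrow> F \<oplus>\<^bsub>poly_ring n\<^esub> (\<ominus>\<^bsub>poly_ring n\<^esub> G) \<in> I"
    using FG by (intro I.a_rcos_module)
  finally show ?thesis using FG by (simp add: poly_ring_a_inv)
qed

lemma I_subset: "F \<in> I \<Longrightarrow> F \<in> P"
  using I.a_subset by blast

lemma I_add: "F \<in> I \<Longrightarrow> G \<in> I \<Longrightarrow> F + G \<in> I"
  using additive_subgroup.a_closed[OF I.additive_subgroup_axioms, of F G] by simp

lemma I_mult: "F \<in> I \<Longrightarrow> G \<in> P \<Longrightarrow> G * F \<in> I" "F \<in> I \<Longrightarrow> G \<in> P \<Longrightarrow> F * G \<in> I"
  using I.I_l_closed[of F G] I.I_r_closed[of F G] by simp_all

lemma I_0 [simp]: "0 \<in> I"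
  using additive_subgroup.zero_closed[OF I.additive_subgroup_axioms] by simp

lemma cls_zero: "F \<in> I \<Longrightarrow> cls F = \<zero>\<^bsub>R\<^esub>"
  unfolding coord_class_def coord_ring_def FactRing_def by (simp add: I.a_rcos_const)

definition rp :: "'k mpoly set \<Rightarrow> 'k mpoly" where
  "rp r = (SOME F. F \<in> P \<and> cls F = r)"

lemma rp: "r \<in> carrier R \<Longrightarrow> rp r \<in> P" "r \<in> carrier R \<Longrightarrow> cls (rp r) = r"
  using someI_ex[of "\<lambda>F. F \<in> P \<and> cls F = r"] cls_surj[of r] unfolding rp_def by blast+

sublocale forms "class_ring :: 'k ring" "base_map n I" R m
proof (rule forms.intro, rule kaehler.intro, rule R_cring, rule kaehler_axioms.intro)
  show "base_map n I c \<in> carrier R" for c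
    unfolding base_map_def by (rule cls_closed) simp
qed

abbreviation "\<Lambda>m \<equiv> diff_forms n I m"

lemma diff_forms_eq: "\<Lambda>m = X.\<Lambda>"
  by (simp add: diff_forms_def one_forms_def)

text \<open>Polynomial representatives in all arguments keep the later computations out of the
  residue ring.\<close>

definition pform :: "'k mpoly \<Rightarrow> 'k mpoly list \<Rightarrow> _" where
  "pform F Gs = form (cls F) (map cls Gs)"

lemma map_cls: "set Gs \<subseteq> P \<Longrightarrow> set (map cls Gs) \<subseteq> carrier R"
  using cls_closed by auto

lemma pform_closed: "F \<in> P \<Longrightarrow> set Gs \<subseteq> P \<Longrightarrow> length Gs = m \<Longrightarrow> pform F Gs \<in> carrier \<Lambda>m"
  unfolding pform_def diff_forms_eq by (intro form_closed cls_closed map_cls) auto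

lemma pform_coeff_add:
  assumes "F \<in> P" "F' \<in> P" "set Gs \<subseteq> P" "length Gs = m"
  shows "pform (F + F') Gs = pform F Gs \<oplus>\<^bsub>\<Lambda>m\<^esub> pform F' Gs"
  unfolding pform_def diff_forms_eq cls_add[OF assms(1,2), symmetric]
  using assms by (intro form_coeff_add cls_closed map_cls) auto

lemma pform_scale:
  assumes "F \<in> P" "set Gs \<subseteq> P" "length Gs = m"
  shows "pform (const_poly c * F) Gs = base_map n I c \<odot>\<^bsub>\<Lambda>m\<^esub> pform F Gs"
proof -
  have "base_map n I c \<odot>\<^bsub>X.\<Lambda>\<^esub> form (cls F) (map cls Gs) = form (base_map n I c \<otimes>\<^bsub>R\<^esub> cls F) (map cls Gs)"
    using assms cls_closed[of F] map_cls[OF assms(2)] by (intro form_smult) (auto simp: base_map_def cls_closed)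
  then show ?thesis
    unfolding pform_def diff_forms_eq using assms by (simp add: base_map_def cls_mult)
qed

lemma pform_slot_add:
  assumes "F \<in> P" "set (as @ x # y # bs) \<subseteq> P" "length (as @ x # bs) = m"
  shows "pform F (as @ (x + y) # bs) = pform F (as @ x # bs) \<oplus>\<^bsub>\<Lambda>m\<^esub> pform F (as @ y # bs)"
proof -
  have c: "cls F \<in> carrier R" "set (map cls as @ cls x # cls y # map cls bs) \<subseteq> carrier R" "x \<in> P" "y \<in> P"
    using assms cls_closed by auto
  show ?thesis
    unfolding pform_def diff_forms_eq using assms(3) form_slot_add[OF c(1,2)] c(3,4) by (simp add: cls_add)
qed

lemma pform_slot_mult:
  assumes "F \<in> P" "set (as @ x # y # bs) \<subseteq> P" "length (as @ x # bs) = m"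
  shows "pform F (as @ (x * y) # bs) = pform (x * F) (as @ y # bs) \<oplus>\<^bsub>\<Lambda>m\<^esub> pform (y * F) (as @ x # bs)"
proof -
  have c: "cls F \<in> carrier R" "set (map cls as @ cls x # cls y # map cls bs) \<subseteq> carrier R" "x \<in> P" "y \<in> P"
    using assms cls_closed by auto
  show ?thesis
    unfolding pform_def diff_forms_eq using assms(1,3) form_slot_mult[OF c(1,2)] c(3,4) by (simp add: cls_mult)
qed

lemma pform_slot_const:
  assumes "F \<in> P" "set (as @ bs) \<subseteq> P" "Suc (length (as @ bs)) = m"
  shows "pform F (as @ const_poly c # bs) = \<zero>\<^bsub>\<Lambda>m\<^esub>"
proof -
  have c: "cls F \<in> carrier R" "set (map cls as @ map cls bs) \<subseteq> carrier R"
    using assms cls_closed by auto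
  show ?thesis
    unfolding pform_def diff_forms_eq using assms(3) form_slot_const[OF c(1,2), of c] by (simp add: base_map_def)
qed

lemma pform_slot_alt:
  assumes "F \<in> P" "set (as @ x # bs) \<subseteq> P" "length (as @ x # x # bs) = m"
  shows "pform F (as @ x # x # bs) = \<zero>\<^bsub>\<Lambda>m\<^esub>"
proof -
  have c: "cls F \<in> carrier R" "set (map cls as @ cls x # map cls bs) \<subseteq> carrier R"
    using assms cls_closed by auto
  show ?thesis
    unfolding pform_def diff_forms_eq using assms(3) form_slot_alt[OF c(1,2)] by simp
qed

lemma pform_cong:
  assumes "F \<in> P" "F' \<in> P" "F - F' \<in> I"
  shows "pform F Gs = pform F' Gs"
proof -
  have "cls F = cls F'" using cls_eq_iff[OF assms(1,2)] assms(3) by blast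
  then show ?thesis unfolding pform_def by simp
qed

lemma pform_coeff_I:
  assumes "F \<in> I" "set Gs \<subseteq> P" "length Gs = m"
  shows "pform F Gs = \<zero>\<^bsub>\<Lambda>m\<^esub>"
proof -
  have "form \<zero>\<^bsub>R\<^esub> (map cls Gs) = \<zero>\<^bsub>X.\<Lambda>\<^esub>"
    unfolding form_def using map_cls[OF assms(2)] assms(3) by (intro L.lmult_0 X.wedge_closed map_d_T) auto
  then show ?thesis unfolding pform_def diff_forms_eq cls_zero[OF assms(1)] .
qed

lemma pform_slot_I:
  assumes "F \<in> P" "x \<in> I" "set (as @ bs) \<subseteq> P" "Suc (length (as @ bs)) = m"
  shows "pform F (as @ x # bs) = \<zero>\<^bsub>\<Lambda>m\<^esub>"
proof -
  have "cls x = cls (const_poly 0)"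
    using assms(2) by (subst cls_eq_iff) (auto simp: const_poly_simps I_subset)
  then show ?thesis
    using pform_slot_const[of F as bs 0] assms unfolding pform_def by simp
qed

end

text \<open>The counterpart of \<open>multiderivation\<close> on polynomials, where Jacobian minors
  live; \<open>coeff_I\<close> and \<open>slot_I\<close> are the conditions for
  \<open>\<psi>\<close> to descend to the residue ring.\<close>

locale pmultider = coord n m I
  for n m :: nat and I :: "'k::field mpoly set" +
  fixes \<psi> :: "'k mpoly \<Rightarrow> 'k mpoly list \<Rightarrow> 'k"
  assumes coeff_add: "\<And>f f' gs. \<lbrakk>f \<in> PR n; f' \<in> PR n; set gs \<subseteq> PR n; length gs = m\<rbrakk>
      \<Longrightarrow> \<psi> (f + f') gs = \<psi> f gs + \<psi> f' gs"
    and coeff_scale: "\<And>c f gs. \<lbrakk>f \<in> PR n; set gs \<subseteq> PR n; length gs = m\<rbrakk>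
      \<Longrightarrow> \<psi> (const_poly c * f) gs = c * \<psi> f gs"
    and slot_add: "\<And>f as x y bs. \<lbrakk>f \<in> PR n; set (as @ x # y # bs) \<subseteq> PR n; length (as @ x # bs) = m\<rbrakk>
      \<Longrightarrow> \<psi> f (as @ (x + y) # bs) = \<psi> f (as @ x # bs) + \<psi> f (as @ y # bs)"
    and slot_mult: "\<And>f as x y bs. \<lbrakk>f \<in> PR n; set (as @ x # y # bs) \<subseteq> PR n; length (as @ x # bs) = m\<rbrakk>
      \<Longrightarrow> \<psi> f (as @ (x * y) # bs) = \<psi> (x * f) (as @ y # bs) + \<psi> (y * f) (as @ x # bs)"
    and slot_const: "\<And>f as c bs. \<lbrakk>f \<in> PR n; set (as @ bs) \<subseteq> PR n; Suc (length (as @ bs)) = m\<rbrakk>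
      \<Longrightarrow> \<psi> f (as @ const_poly c # bs) = 0"
    and slot_alt: "\<And>f as x bs. \<lbrakk>f \<in> PR n; set (as @ x # bs) \<subseteq> PR n; length (as @ x # x # bs) = m\<rbrakk>
      \<Longrightarrow> \<psi> f (as @ x # x # bs) = 0"
    and coeff_I: "\<And>f gs. \<lbrakk>f \<in> I; set gs \<subseteq> PR n; length gs = m\<rbrakk> \<Longrightarrow> \<psi> f gs = 0"
    and slot_I: "\<And>f as x bs. \<lbrakk>f \<in> PR n; x \<in> I; set (as @ bs) \<subseteq> PR n; Suc (length (as @ bs)) = m\<rbrakk>
      \<Longrightarrow> \<psi> f (as @ x # bs) = 0"
begin

lemma coeff_cong:
  assumes "f \<in> PR n" "f' \<in> PR n" "f - f' \<in> I" "set gs \<subseteq> PR n" "length gs = m"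
  shows "\<psi> f gs = \<psi> f' gs"
proof -
  have "\<psi> ((f - f') + f') gs = \<psi> (f - f') gs + \<psi> f' gs"
    using assms by (intro coeff_add PR_diff) auto
  then show ?thesis using coeff_I assms by simp
qed

lemma slot_cong:
  assumes "f \<in> PR n" "x \<in> PR n" "x' \<in> PR n" "x - x' \<in> I" "set (as @ bs) \<subseteq> PR n" "Suc (length (as @ bs)) = m"
  shows "\<psi> f (as @ x # bs) = \<psi> f (as @ x' # bs)"
proof -
  have "\<psi> f (as @ ((x - x') + x') # bs) = \<psi> f (as @ (x - x') # bs) + \<psi> f (as @ x' # bs)"
    using assms by (intro slot_add) (auto intro: PR_diff)
  then show ?thesis using slot_I assms by simp
qed

lemma slots_cong:
  assumes "f \<in> PR n" "set as \<subseteq> PR n" "length (as @ gs) = m"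
    "list_all2 (\<lambda>x y. x \<in> PR n \<and> y \<in> PR n \<and> x - y \<in> I) gs gs'"
  shows "\<psi> f (as @ gs) = \<psi> f (as @ gs')"
  using assms(4,2,3)
proof (induction arbitrary: as rule: list_all2_induct)
  case (Cons x xs y ys)
  have sub: "set xs \<subseteq> PR n" using Cons.hyps(2) by (induction rule: list_all2_induct) auto
  have "\<psi> f (as @ x # xs) = \<psi> f (as @ y # xs)"
    using assms(1) Cons sub by (intro slot_cong) auto
  also have "\<psi> f ((as @ [y]) @ xs) = \<psi> f ((as @ [y]) @ ys)"
    using Cons.prems Cons.hyps by (intro Cons.IH) auto
  then have "\<psi> f (as @ y # xs) = \<psi> f (as @ y # ys)" by simp
  finally show ?case .
qed simp

definition \<psi>R where "\<psi>R r gs = \<psi> (rp r) (map rp gs)"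

lemma \<psi>R_eq:
  assumes "f \<in> PR n" "set gs \<subseteq> PR n" "length gs = m"
  shows "\<psi>R (cls f) (map cls gs) = \<psi> f gs"
proof -
  have 1: "rp (cls g) - g \<in> I \<and> rp (cls g) \<in> PR n" if "g \<in> PR n" for g
    using rp[OF cls_closed[OF that]] cls_eq_iff[of "rp (cls g)" g] that by auto
  have s: "set (map rp (map cls gs)) \<subseteq> PR n" using assms(2) 1 by auto
  have "\<psi>R (cls f) (map cls gs) = \<psi> f (map rp (map cls gs))"
    unfolding \<psi>R_def using assms 1 s by (intro coeff_cong) auto
  also have "\<dots> = \<psi> f gs"
    using assms slots_cong[of f "[]" "map rp (map cls gs)" gs] 1 by (auto simp: list_all2_map1 subset_iff intro!: list.rel_refl_strong)
  finally show ?thesis .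
qed

lemma list_lift: "set gs \<subseteq> carrier R \<Longrightarrow> \<exists>hs. gs = map cls hs \<and> set hs \<subseteq> PR n"
  using rp by (intro exI[of _ "map rp gs"]) (auto simp: map_idI subset_iff)

lemma \<psi>R_multiderivation: "multiderivation class_ring (base_map n I) R m \<psi>R"
proof (intro multiderivation.intro multiderivation_axioms.intro R_cring, goal_cases)
  case (1 c)
  show ?case by (simp add: base_map_def cls_closed)
next
  case (2 f f' gs)
  obtain F F' hs where *: "f = cls F" "F \<in> PR n" "f' = cls F'" "F' \<in> PR n" "gs = map cls hs" "set hs \<subseteq> PR n"
    using 2 cls_surj list_lift by metis
  show ?case using 2(4) * by (simp add: cls_add \<psi>R_eq PR_add coeff_add)
next
  case (3 f as x y bs)
  obtain F X Y where *: "f = cls F" "F \<in> PR n" "x = cls X" "X \<in> PR n" "y = cls Y" "Y \<in> PR n"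
    using 3 cls_surj[of f] cls_surj[of x] cls_surj[of y] by auto
  obtain As Bs where **: "as = map cls As" "set As \<subseteq> PR n" "bs = map cls Bs" "set Bs \<subseteq> PR n"
    using 3 list_lift[of as] list_lift[of bs] by auto
  have "\<psi>R f (as @ (x \<oplus>\<^bsub>R\<^esub> y) # bs) = \<psi>R (cls F) (map cls (As @ (X + Y) # Bs))"
    using * ** by (simp add: cls_add)
  also have "\<dots> = \<psi> F (As @ (X + Y) # Bs)" using 3(3) * ** by (intro \<psi>R_eq) (auto intro: PR_add)
  also have "\<dots> = \<psi> F (As @ X # Bs) + \<psi> F (As @ Y # Bs)" using 3(3) * ** by (intro slot_add) auto
  also have "\<psi> F (As @ X # Bs) = \<psi>R (cls F) (map cls (As @ X # Bs))" using 3(3) * ** by (intro \<psi>R_eq[symmetric]) auto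
  also have "\<psi> F (As @ Y # Bs) = \<psi>R (cls F) (map cls (As @ Y # Bs))" using 3(3) * ** by (intro \<psi>R_eq[symmetric]) auto
  finally show ?case using * ** by simp
next
  case (4 f as x y bs)
  obtain F X Y where *: "f = cls F" "F \<in> PR n" "x = cls X" "X \<in> PR n" "y = cls Y" "Y \<in> PR n"
    using 4 cls_surj[of f] cls_surj[of x] cls_surj[of y] by auto
  obtain As Bs where **: "as = map cls As" "set As \<subseteq> PR n" "bs = map cls Bs" "set Bs \<subseteq> PR n"
    using 4 list_lift[of as] list_lift[of bs] by auto
  have "\<psi>R f (as @ (x \<otimes>\<^bsub>R\<^esub> y) # bs) = \<psi>R (cls F) (map cls (As @ (X * Y) # Bs))"
    using * ** by (simp add: cls_mult)
  also have "\<dots> = \<psi> F (As @ (X * Y) # Bs)" using 4(3) * ** by (intro \<psi>R_eq) (auto intro: PR_mult)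
  also have "\<dots> = \<psi> (X * F) (As @ Y # Bs) + \<psi> (Y * F) (As @ X # Bs)" using 4(3) * ** by (intro slot_mult) auto
  also have "\<psi> (X * F) (As @ Y # Bs) = \<psi>R (cls (X * F)) (map cls (As @ Y # Bs))"
    using 4(3) * ** by (intro \<psi>R_eq[symmetric]) (auto intro: PR_mult)
  also have "\<psi> (Y * F) (As @ X # Bs) = \<psi>R (cls (Y * F)) (map cls (As @ X # Bs))"
    using 4(3) * ** by (intro \<psi>R_eq[symmetric]) (auto intro: PR_mult)
  finally show ?case using * ** by (simp add: cls_mult)
next
  case (5 f as c bs)
  obtain F As Bs where *: "f = cls F" "F \<in> PR n" "as = map cls As" "set As \<subseteq> PR n" "bs = map cls Bs" "set Bs \<subseteq> PR n"
    using 5 cls_surj[of f] list_lift[of as] list_lift[of bs] by auto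
  have "\<psi>R f (as @ base_map n I c # bs) = \<psi>R (cls F) (map cls (As @ const_poly c # Bs))"
    using * by (simp add: base_map_def)
  also have "\<dots> = \<psi> F (As @ const_poly c # Bs)" using 5(3) * by (intro \<psi>R_eq) auto
  also have "\<dots> = 0" using 5(3) * by (intro slot_const) auto
  finally show ?case .
next
  case (6 f as x bs)
  obtain F As X Bs where *: "f = cls F" "F \<in> PR n" "as = map cls As" "set As \<subseteq> PR n" "bs = map cls Bs" "set Bs \<subseteq> PR n"
      "x = cls X" "X \<in> PR n"
    using 6 cls_surj[of f] cls_surj[of x] list_lift[of as] list_lift[of bs] by auto
  have "\<psi>R f (as @ x # x # bs) = \<psi>R (cls F) (map cls (As @ X # X # Bs))"
    using * by simp
  also have "\<dots> = \<psi> F (As @ X # X # Bs)" using 6(3) * by (intro \<psi>R_eq) auto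
  also have "\<dots> = 0" using 6(3) * by (intro slot_alt) auto
  finally show ?case .
qed

text \<open>The form in which the universal property is used from here on: a multiderivation on
  polynomials that respects \<open>I\<close> prescribes the values of a \<open>K\<close>-linear
  functional on the \<open>m\<close>-forms.\<close>

lemma functional:
  obtains l where "\<And>Y Z. Y \<in> carrier \<Lambda>m \<Longrightarrow> Z \<in> carrier \<Lambda>m \<Longrightarrow> l (Y \<oplus>\<^bsub>\<Lambda>m\<^esub> Z) = l Y + l Z"
    "\<And>c Z. Z \<in> carrier \<Lambda>m \<Longrightarrow> l (base_map n I c \<odot>\<^bsub>\<Lambda>m\<^esub> Z) = c * l Z"
    "\<And>F Gs. F \<in> PR n \<Longrightarrow> set Gs \<subseteq> PR n \<Longrightarrow> length Gs = m \<Longrightarrow> l (pform F Gs) = \<psi> F Gs"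
proof -
  interpret M: multiderivation "class_ring :: 'k ring" "base_map n I" R m \<psi>R by (rule \<psi>R_multiderivation)
  have scale: "\<psi>R (base_map n I c \<otimes>\<^bsub>R\<^esub> f) gs = c * \<psi>R f gs"
    if A: "f \<in> carrier R" "set gs \<subseteq> carrier R" "length gs = m" for c f gs
  proof -
    obtain F hs where *: "f = cls F" "F \<in> PR n" "gs = map cls hs" "set hs \<subseteq> PR n"
      using A cls_surj[of f] list_lift[of gs] by auto
    then show ?thesis using A(3)
      by (simp add: base_map_def cls_mult \<psi>R_eq PR_mult coeff_scale)
  qed
  show ?thesis
  proof (rule that[of M.lift])
    show "M.lift (Y \<oplus>\<^bsub>\<Lambda>m\<^esub> Z) = M.lift Y + M.lift Z" if "Y \<in> carrier \<Lambda>m" "Z \<in> carrier \<Lambda>m" for Y Z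
      using that unfolding diff_forms_eq by (rule M.lift_add)
    show "M.lift (base_map n I c \<odot>\<^bsub>\<Lambda>m\<^esub> Z) = c * M.lift Z" if "Z \<in> carrier \<Lambda>m" for c Z
      using that unfolding diff_forms_eq
      by (intro M.lift_smult scale) (auto simp: base_map_def cls_closed distrib_left)
    show "M.lift (pform F Gs) = \<psi> F Gs" if "F \<in> PR n" "set Gs \<subseteq> PR n" "length Gs = m" for F Gs
      unfolding pform_def using that
      by (subst M.lift_form) (auto simp: cls_closed \<psi>R_eq subset_iff)
  qed
qed

end

section \<open>Fat points\<close>

lemma (in coeff_hom) subst_pw: "subst h v (pw w \<alpha>) = pw (\<lambda>j. subst h v (w j)) \<alpha>"
proof (induction \<alpha> rule: poly_mapping_sum_induct)
  case (single j k)
  then show ?case by (simp add: subst_power)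
qed (simp add: pw_add subst_mult)

text \<open>\<open>yv q\<close> are the local coordinates at the point \<open>q\<close>, and \<open>tau q\<close> moves \<open>q\<close> to \<open>(1 : 0 : \<dots> : 0)\<close>, mapping
  \<open>yv q j\<close> to \<open>X\<^sub>j\<close>.\<close>

definition yv :: "(nat \<Rightarrow> 'k::field) \<Rightarrow> nat \<Rightarrow> 'k mpoly" where
  "yv q j = (if j = 0 then var_poly 0 else var_poly j - const_poly (q j) * var_poly 0)"

definition tau_var :: "(nat \<Rightarrow> 'k::field) \<Rightarrow> nat \<Rightarrow> 'k mpoly" where
  "tau_var q j = (if j = 0 then var_poly 0 else var_poly j + const_poly (q j) * var_poly 0)"

definition tau :: "(nat \<Rightarrow> 'k::field) \<Rightarrow> 'k mpoly \<Rightarrow> 'k mpoly" where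
  "tau q = subst const_poly (tau_var q)"

lemma tau_simps:
  "tau q (F + G) = tau q F + tau q G" "tau q (F - G) = tau q F - tau q G" "tau q (- F) = - tau q F"
  "tau q (F * G) = tau q F * tau q G" "tau q (F ^ k) = tau q F ^ k"
  "tau q 0 = 0" "tau q 1 = 1" "tau q (const_poly c) = const_poly c" "tau q (var_poly j) = tau_var q j"
  unfolding tau_def
  by (simp_all add: const.subst_add const.subst_diff const.subst_uminus const.subst_mult const.subst_power
      const.subst_const const.subst_var)

lemma tau_pw: "tau q (pw w \<alpha>) = pw (\<lambda>j. tau q (w j)) \<alpha>"
  unfolding tau_def by (rule const.subst_pw)

lemma tau_yv: "tau q (yv q j) = var_poly j"
  by (simp add: yv_def tau_simps tau_var_def)

lemma tau_sum: "tau q (sum f A) = (\<Sum>x\<in>A. tau q (f x))"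
  by (induction A rule: infinite_finite_induct) (simp_all add: tau_simps)

lemma tau_prod: "tau q (prod f A) = (\<Prod>x\<in>A. tau q (f x))"
  by (induction A rule: infinite_finite_induct) (simp_all add: tau_simps)

lemma subst_yv_tau: "subst const_poly (yv q) (tau q F) = F"
proof (induction F rule: poly_mapping_sum_induct)
  case (single \<alpha> c)
  have "subst const_poly (yv q) (tau_var q j) = var_poly j" for j
    by (simp add: tau_var_def yv_def const.subst_add const.subst_mult const.subst_const const.subst_var)
  then show ?case
    by (simp add: single_const_pw tau_simps tau_pw const.subst_mult const.subst_const const.subst_pw)
qed (simp add: tau_simps const.subst_add)

text \<open>Taylor expansion at \<open>q\<close>: the coefficients of \<open>tau q F\<close> are
  those of \<open>F\<close> in the local coordinates.\<close>

lemma y_expansion: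
  "F = (\<Sum>\<alpha>\<in>keys (tau q F). const_poly (lookup (tau q F) \<alpha>) * pw (yv q) \<alpha>)"
  using subst_yv_tau[of q F] unfolding subst_def lin_ext_def by simp

lemma pw_PR: "(\<And>j. j \<in> keys \<alpha> \<Longrightarrow> w j \<in> PR n) \<Longrightarrow> pw w \<alpha> \<in> PR n"
  unfolding pw_def by (intro PR_prod PR_power) auto

lemma homogeneous_const: "homogeneous 0 (const_poly c)"
  using homogeneous_simps(6)[of 0 c] by (simp add: const_poly_def)

lemma homogeneous_var: "homogeneous 1 (var_poly j)"
  unfolding var_poly_def using homogeneous_simps(6)[of "single j 1"] by simp

lemma homogeneous_const_mult: "homogeneous d F \<Longrightarrow> homogeneous d (const_poly c * F)"
  using homogeneous_simps(5)[OF homogeneous_const, of d F c] by simp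

lemma homogeneous_pw:
  assumes "\<And>j. homogeneous 1 (w j)"
  shows "homogeneous (tdeg \<alpha>) (pw w \<alpha>)"
proof (induction \<alpha> rule: poly_mapping_sum_induct)
  case (single j k)
  then show ?case using homogeneous_power[OF assms, of k j] by simp
qed (simp add: pw_add homogeneous_simps)

lemma tau_var_PR: "j \<le> n \<Longrightarrow> tau_var q j \<in> PR n"
  by (auto simp: tau_var_def intro!: PR_add PR_mult PR_var)

lemma yv_PR: "j \<le> n \<Longrightarrow> yv q j \<in> PR n"
  by (auto simp: yv_def intro!: PR_diff PR_mult PR_var)

lemma homogeneous_tau_var: "homogeneous 1 (tau_var q j)"
  by (auto simp: tau_var_def intro!: homogeneous_simps homogeneous_const_mult homogeneous_var[unfolded One_nat_def])

lemma homogeneous_yv: "homogeneous 1 (yv q j)"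
  by (auto simp: yv_def intro!: homogeneous_simps homogeneous_const_mult homogeneous_var[unfolded One_nat_def])

lemma tau_PR:
  assumes "F \<in> PR n"
  shows "tau q F \<in> PR n"
  unfolding tau_def subst_def lin_ext_def
  using assms by (intro PR_sum PR_mult PR_const pw_PR tau_var_PR) (auto simp: PR_iff)

lemma homogeneous_tau:
  assumes "homogeneous d F"
  shows "homogeneous d (tau q F)"
  unfolding tau_def subst_def lin_ext_def
proof (intro homogeneous_sum homogeneous_const_mult)
  fix \<alpha> assume "\<alpha> \<in> keys F"
  then have "tdeg \<alpha> = d" using assms by (simp add: homogeneous_tdeg)
  then show "homogeneous d (pw (tau_var q) \<alpha>)" using homogeneous_pw[of "tau_var q" \<alpha>, OF homogeneous_tau_var] by simp
qed

lemma pw_var_vord: "pw var_poly \<alpha> \<in> vord (ydeg \<alpha>)"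
  using single_const_pw[of \<alpha> "1::'a"] by (simp add: vord_def const_poly_simps split: if_splits)
    (metis (no_types) insertE keys_single keys_zero mult_1 order.refl singletonD empty_iff zero_neq_one)

lemma var_vord: "j \<noteq> 0 \<Longrightarrow> var_poly j \<in> vord 1"
  by (simp add: vord_def var_poly_def)

lemma vord_power: "F \<in> vord s \<Longrightarrow> F ^ k \<in> vord (k * s)"
  by (induction k) (auto intro: vord_mult)

lemma vord_mult_cong:
  assumes "F - F' \<in> vord s" "G - G' \<in> vord s"
  shows "F * G - F' * G' \<in> vord s"
proof -
  have "F * G - F' * G' = (F - F') * G + F' * (G - G')" by (simp add: algebra_simps)
  then show ?thesis
    using vord_add[OF vord_mult_right[OF assms(1), of G] vord_mult_left[OF assms(2), of F']] by simp
qed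

lemma vord_power_cong: "F - F' \<in> vord s \<Longrightarrow> F ^ k - F' ^ k \<in> vord s"
  by (induction k) (auto intro: vord_mult_cong)

lemma vord_prod_cong: "(\<And>x. x \<in> A \<Longrightarrow> f x - g x \<in> vord s) \<Longrightarrow> prod f A - prod g A \<in> vord s"
  by (induction A rule: infinite_finite_induct) (auto intro: vord_mult_cong)

lemma vord_diff: "F \<in> vord s \<Longrightarrow> G \<in> vord s \<Longrightarrow> F - G \<in> vord s"
  using vord_add[of F s "- G"] vord_uminus[of G s] by simp

text \<open>For \<open>q 0 = 1\<close> this is the \<open>s\<close>-th power of the vanishing ideal
  of the point, as \<open>fatI_eq_power\<close> shows, in a form in which membership is read off the
  Taylor expansion.\<close>

definition fatI :: "nat \<Rightarrow> (nat \<Rightarrow> 'k::field) \<Rightarrow> nat \<Rightarrow> 'k mpoly set" where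
  "fatI n q s = {F \<in> PR n. tau q F \<in> vord s}"

lemma fatI_ideal: "ideal (fatI n q s) (poly_ring n)"
proof (rule idealI)
  show "ring (poly_ring n :: 'a mpoly ring)" using poly_ring_cring by (rule cring.axioms)
  interpret cring "poly_ring n :: 'a mpoly ring" by (rule poly_ring_cring)
  show "subgroup (fatI n q s) (add_monoid (poly_ring n))"
  proof (rule subgroup.intro)
    fix F assume F: "F \<in> fatI n q s"
    then have "inv\<^bsub>add_monoid (poly_ring n)\<^esub> F = - F"
      by (simp only: a_inv_def[symmetric]) (simp add: fatI_def poly_ring_a_inv)
    then show "inv\<^bsub>add_monoid (poly_ring n)\<^esub> F \<in> fatI n q s"
      using F by (simp add: fatI_def tau_simps PR_uminus vord_uminus)
  qed (auto simp: fatI_def tau_simps PR_add vord_add)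
qed (auto simp: fatI_def tau_simps PR_mult vord_mult_left vord_mult_right)

lemma pw_e0: "pw (\<lambda>j. if j = 0 then 1 else (0::'k::field)) \<alpha> = (if ydeg \<alpha> = 0 then 1 else 0)"
proof (induction \<alpha> rule: poly_mapping_sum_induct)
  case (single j k)
  then show ?case by (cases "k = 0") auto
qed (simp add: pw_add)

text \<open>Only one monomial of degree \<open>d\<close> has local degree \<open>0\<close>, namely
  \<open>X_0^d\<close>. Its coefficient in \<open>tau q F\<close> is the value of \<open>F\<close>
  at \<open>q\<close>.\<close>

lemma tau_vord_of_vanishing:
  assumes "homogeneous d F" "eval_mpoly q F = 0" "q 0 = 1"
  shows "tau q F \<in> vord 1"
proof -
  let ?e = "\<lambda>j. if j = 0 then 1 else (0::'a)"
  have comp: "subst (\<lambda>x. x) ?e (tau q G) = subst (\<lambda>x. x) q G" for G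
  proof (induction G rule: poly_mapping_sum_induct)
    case (single \<alpha> c)
    have "(\<lambda>j. subst (\<lambda>x. x) ?e (tau_var q j)) = q"
      by (rule ext) (simp add: tau_var_def ident.subst_add ident.subst_mult ident.subst_const ident.subst_var assms(3))
    then show ?case
      by (simp add: single_const_pw tau_simps tau_pw ident.subst_mult ident.subst_const ident.subst_pw ident.subst_var)
  qed (simp add: tau_simps ident.subst_add)
  have sum0: "(\<Sum>\<alpha>\<in>keys (tau q F). lookup (tau q F) \<alpha> * (if ydeg \<alpha> = 0 then 1 else 0)) = 0"
    using comp[of F] assms(2) unfolding eval_mpoly_subst by (simp add: subst_def lin_ext_def pw_e0)
  have hom: "homogeneous d (tau q F)" using assms(1) by (rule homogeneous_tau)
  show ?thesis
    unfolding vord_def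
  proof safe
    fix \<alpha> assume \<alpha>: "\<alpha> \<in> keys (tau q F)"
    show "1 \<le> ydeg \<alpha>"
    proof (rule ccontr)
      assume "\<not> 1 \<le> ydeg \<alpha>"
      then have y0: "ydeg \<alpha> = 0" by simp
      have uniq: "\<beta> = \<alpha>" if \<beta>: "\<beta> \<in> keys (tau q F)" "ydeg \<beta> = 0" for \<beta>
      proof -
        have "lookup \<beta> 0 = lookup \<alpha> 0"
          using hom \<alpha> \<beta> y0 tdeg_ydeg[of \<alpha>] tdeg_ydeg[of \<beta>] by (simp add: homogeneous_tdeg)
        moreover have "lookup \<beta> j = lookup \<alpha> j" if "j \<noteq> 0" for j
          using y0 \<beta>(2) that unfolding ydeg_0_iff by (metis in_keys_iff singletonD subsetD)
        ultimately show ?thesis by (intro poly_mapping_eqI) metis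
      qed
      have "(\<Sum>\<beta>\<in>keys (tau q F). lookup (tau q F) \<beta> * (if ydeg \<beta> = 0 then 1 else 0))
        = (\<Sum>\<beta>\<in>keys (tau q F). if \<beta> = \<alpha> then lookup (tau q F) \<beta> else 0)"
      proof (intro sum.cong refl)
        fix \<beta> assume "\<beta> \<in> keys (tau q F)"
        then show "lookup (tau q F) \<beta> * (if ydeg \<beta> = 0 then 1 else 0)
            = (if \<beta> = \<alpha> then lookup (tau q F) \<beta> else 0)"
          using uniq[of \<beta>] y0 by (cases "ydeg \<beta> = 0") auto
      qed
      also have "\<dots> = lookup (tau q F) \<alpha>" using \<alpha> by (simp add: sum.delta)
      finally show False using \<alpha> sum0 by (simp add: in_keys_iff)
    qed
  qed
qed

text \<open>One local coordinate with positive index is split off for each factor \<open>J\<close>;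
  the powers of \<open>X_0\<close> stay in the remaining monomial.\<close>

lemma pw_yv_mem:
  assumes "keys_sub": "keys \<alpha> \<subseteq> {..n}" and q: "q 0 = 1"
    and J: "ideal J (poly_ring n)" "\<And>j. 1 \<le> j \<Longrightarrow> j \<le> n \<Longrightarrow> yv q j \<in> J"
  shows "s \<le> ydeg \<alpha> \<Longrightarrow> pw (yv q) \<alpha> \<in> J [^]\<^bsub>ideals_set (poly_ring n)\<^esub> s"
  using keys_sub
proof (induction s arbitrary: \<alpha>)
  case 0
  interpret cring "poly_ring n :: 'a mpoly ring" by (rule poly_ring_cring)
  interpret S: semiring "ideals_set (poly_ring n :: 'a mpoly ring)" by (rule ideals_set_is_semiring)
  have "pw (yv q) \<alpha> \<in> PR n" using 0 by (intro pw_PR yv_PR) auto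
  then show ?case by (simp add: S.nat_pow_0 ideals_set_def)
next
  case (Suc s)
  interpret cring "poly_ring n :: 'a mpoly ring" by (rule poly_ring_cring)
  interpret S: semiring "ideals_set (poly_ring n :: 'a mpoly ring)" by (rule ideals_set_is_semiring)
  have "\<not> keys \<alpha> \<subseteq> {0}" using Suc.prems ydeg_0_iff[of \<alpha>] by linarith
  then obtain j where j: "j \<in> keys \<alpha>" "j \<noteq> 0" by auto
  let ?\<beta> = "\<alpha> - single j 1"
  have \<alpha>: "\<alpha> = ?\<beta> + single j 1" using j by (intro keys_diff_single)
  have "ydeg \<alpha> = ydeg ?\<beta> + 1" using j by (subst \<alpha>) simp
  moreover have "keys ?\<beta> \<subseteq> {..n}"
    using Suc.prems(2) by (auto simp: in_keys_iff lookup_minus subset_iff)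
  ultimately have "pw (yv q) ?\<beta> \<in> J [^]\<^bsub>ideals_set (poly_ring n)\<^esub> s" using Suc.prems by (intro Suc.IH) auto
  moreover have "yv q j \<in> J" using j Suc.prems J(2) by auto
  ultimately have "pw (yv q) ?\<beta> \<otimes>\<^bsub>poly_ring n\<^esub> yv q j \<in> ideal_prod (poly_ring n) (J [^]\<^bsub>ideals_set (poly_ring n)\<^esub> s) J"
    by (rule ideal_prod.prod)
  moreover have "pw (yv q) \<alpha> = pw (yv q) ?\<beta> * yv q j" by (subst \<alpha>) (simp only: pw_add pw_single power_one_right)
  ultimately show ?case by (simp add: S.nat_pow_Suc) (simp add: ideals_set_def)
qed

text \<open>One inclusion holds because orders of vanishing add under multiplication and the
  vanishing ideal has order at least 1. For the other, every term of the Taylor expansion of order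
  at least \<open>s\<close> contains \<open>s\<close> local coordinates, each of which lies in the
  vanishing ideal.\<close>

lemma fatI_eq_power:
  fixes q :: "nat \<Rightarrow> 'k::field"
  assumes q: "q 0 = 1" and p: "p = {(\<lambda>j. c * q j) | c. c \<noteq> 0}"
  shows "point_ideal n p [^]\<^bsub>ideals_set (poly_ring n)\<^esub> s = fatI n q s"
proof -
  interpret cring "poly_ring n :: 'k mpoly ring" by (rule poly_ring_cring)
  interpret S: semiring "ideals_set (poly_ring n :: 'k mpoly ring)" by (rule ideals_set_is_semiring)
  let ?J = "point_ideal n p"
  have sub: "{F \<in> PR n. (\<exists>d. homogeneous d F) \<and> (\<forall>v\<in>p. eval_mpoly v F = 0)} \<subseteq> PR n" by auto
  have J: "ideal ?J (poly_ring n)" unfolding point_ideal_def by (rule genideal_ideal) (rule sub)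
  have qp: "q \<in> p" unfolding p by (auto intro: exI[of _ 1])
  have J1: "?J \<subseteq> fatI n q 1"
    unfolding point_ideal_def
    by (rule genideal_minimal[OF fatI_ideal]) (use qp q in \<open>auto simp: fatI_def intro: tau_vord_of_vanishing[unfolded One_nat_def]\<close>)
  have yJ: "yv q j \<in> ?J" if "1 \<le> j" "j \<le> n" for j
  proof -
    have "eval_mpoly v (yv q j) = 0" if "v \<in> p" for v
      using that \<open>1 \<le> j\<close> q unfolding p eval_mpoly_subst
      by (auto simp: yv_def ident.subst_diff ident.subst_mult ident.subst_const ident.subst_var)
    then show ?thesis
      unfolding point_ideal_def using that homogeneous_yv
      by (intro subsetD[OF genideal_self[OF sub]]) (auto intro: yv_PR)
  qed
  have pow_ideal: "ideal (?J [^]\<^bsub>ideals_set (poly_ring n)\<^esub> s) (poly_ring n)" for s :: nat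
    using S.nat_pow_closed[of ?J s] J by (simp add: ideals_set_def)
  show ?thesis
  proof
    show "?J [^]\<^bsub>ideals_set (poly_ring n)\<^esub> s \<subseteq> fatI n q s"
    proof (induction s)
      case 0
      then show ?case by (auto simp: S.nat_pow_0 fatI_def) (simp add: ideals_set_def)
    next
      case (Suc s)
      have "?J [^]\<^bsub>ideals_set (poly_ring n)\<^esub> Suc s = ideal_prod (poly_ring n) (?J [^]\<^bsub>ideals_set (poly_ring n)\<^esub> s) ?J"
        by (simp add: S.nat_pow_Suc) (simp add: ideals_set_def)
      moreover have "F \<in> fatI n q (Suc s)" if "F \<in> ideal_prod (poly_ring n) (?J [^]\<^bsub>ideals_set (poly_ring n)\<^esub> s) ?J" for F
        using that
      proof induction
        case (prod F G)
        then have "F \<in> fatI n q s" "G \<in> fatI n q 1" using Suc J1 by auto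
        then show ?case using vord_mult[of "tau q F" s "tau q G" 1] by (auto simp: fatI_def tau_simps PR_mult)
      next
        case (sum F G)
        then show ?case by (auto simp: fatI_def tau_simps PR_add vord_add)
      qed
      ultimately show ?case by auto
    qed
    show "fatI n q s \<subseteq> ?J [^]\<^bsub>ideals_set (poly_ring n)\<^esub> s"
    proof
      fix F assume F: "F \<in> fatI n q s"
      interpret C: coord n 0 "?J [^]\<^bsub>ideals_set (poly_ring n)\<^esub> s" by (rule coord.intro) (rule pow_ideal)
      have "(\<Sum>\<alpha>\<in>A. const_poly (lookup (tau q F) \<alpha>) * pw (yv q) \<alpha>) \<in> ?J [^]\<^bsub>ideals_set (poly_ring n)\<^esub> s"
        if "finite A" "A \<subseteq> keys (tau q F)" for A
        using that
      proof (induction A)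
        case (insert \<alpha> A)
        have "keys \<alpha> \<subseteq> {..n}" using insert.prems tau_PR[of F n q] F unfolding fatI_def PR_iff by auto
        moreover have "s \<le> ydeg \<alpha>" using insert.prems F by (auto simp: fatI_def vord_def)
        ultimately have "pw (yv q) \<alpha> \<in> ?J [^]\<^bsub>ideals_set (poly_ring n)\<^esub> s" using q J yJ by (intro pw_yv_mem)
        then have "const_poly (lookup (tau q F) \<alpha>) * pw (yv q) \<alpha> \<in> ?J [^]\<^bsub>ideals_set (poly_ring n)\<^esub> s"
          by (intro C.I_mult(1)) auto
        then show ?case using insert by (simp add: C.I_add)
      qed simp
      from this[of "keys (tau q F)"] show "F \<in> ?J [^]\<^bsub>ideals_set (poly_ring n)\<^esub> s"
        using y_expansion[of F q] by simp
    qed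
  qed
qed

lemma proj_space_normal:
  fixes p :: "(nat \<Rightarrow> 'k::field) set"
  assumes "p \<in> proj_space n" "\<And>v. v \<in> p \<Longrightarrow> v 0 \<noteq> 0"
  obtains q where "q 0 = 1" "\<And>j. j > n \<Longrightarrow> q j = 0" "p = {(\<lambda>j. c * q j) | c. c \<noteq> 0}"
proof -
  obtain v where v: "p = {(\<lambda>j. c * v j) | c. c \<noteq> 0}" "\<forall>j>n. v j = 0" using assms(1) unfolding proj_space_def by auto
  have "v \<in> p" unfolding v(1) by (auto intro: exI[of _ 1])
  then have v0: "v 0 \<noteq> 0" by (rule assms(2))
  define q where "q = (\<lambda>j. v j / v 0)"
  have "p = {(\<lambda>j. c * q j) | c. c \<noteq> 0}"
    unfolding v(1) q_def
  proof (safe, goal_cases)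
    case (1 _ c)
    then show ?case using v0 by (intro exI[of _ "c * v 0"]) auto
  next
    case (2 _ c)
    then show ?case using v0 by (intro exI[of _ "c / v 0"]) auto
  qed
  then show ?thesis using that[of q] v v0 by (auto simp: q_def)
qed

text \<open>Two lists with the same multiset differ by adjacent swaps. Meant for \<open>Z\<close> a
  membership statement about an alternating form, which ignores the sign of a permutation.\<close>

lemma swap_invariant_mset:
  assumes swap: "\<And>as x y bs. length (as @ x # y # bs) = N \<Longrightarrow> set (as @ x # y # bs) \<subseteq> A
      \<Longrightarrow> Z (as @ x # y # bs) = Z (as @ y # x # bs)"
    and "mset xs = mset ys" "length (as @ xs) = N" "set (as @ xs) \<subseteq> A"
  shows "Z (as @ xs) = Z (as @ ys)"
  using assms(2-)
proof (induction xs arbitrary: as ys)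
  case (Cons x xs)
  have move: "Z (as @ x # us @ vs) = Z (as @ us @ x # vs)"
    if "length (as @ x # us @ vs) = N" "set (as @ x # us @ vs) \<subseteq> A" for as us vs
    using that
  proof (induction us arbitrary: as)
    case (Cons u us)
    have "Z (as @ x # u # us @ vs) = Z (as @ u # x # us @ vs)" using Cons.prems by (intro swap) auto
    also have "Z ((as @ [u]) @ x # us @ vs) = Z ((as @ [u]) @ us @ x # vs)"
      using Cons.prems by (intro Cons.IH) auto
    then have "Z (as @ u # x # us @ vs) = Z (as @ u # us @ x # vs)" by simp
    finally show ?case by simp
  qed simp
  have "x \<in> set ys" using Cons.prems(1) by (metis list.set_intros(1) set_mset_mset)
  then obtain us vs where ys: "ys = us @ x # vs" by (meson split_list)
  have m: "mset xs = mset (us @ vs)" using Cons.prems(1) ys by simp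
  then have s: "set (us @ vs) = set xs" "length (us @ vs) = length xs" by (metis set_mset_mset, metis size_mset)
  have "Z ((as @ [x]) @ xs) = Z ((as @ [x]) @ (us @ vs))"
    using m Cons.prems by (intro Cons.IH) auto
  then have "Z (as @ x # xs) = Z (as @ x # us @ vs)" by simp
  also have "\<dots> = Z (as @ us @ x # vs)" using Cons.prems s by (intro move) auto
  finally show ?case by (simp add: ys)
qed simp

text \<open>\<open>char\<close> is the characteristic assumption in the form in which it is applied:
  the integers from 1 up to a multiplicity are invertible in \<open>K\<close>.\<close>

locale fat =
  fixes n m t :: nat and q :: "nat \<Rightarrow> nat \<Rightarrow> 'k::field" and \<mu> :: "nat \<Rightarrow> nat"
  assumes n: "n \<ge> 1" and m: "m \<ge> 1"
    and q0: "\<And>i. i \<in> {1..t} \<Longrightarrow> q i 0 = 1"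
    and qn: "\<And>i j. i \<in> {1..t} \<Longrightarrow> j > n \<Longrightarrow> q i j = 0"
    and q_inj: "inj_on q {1..t}"
    and mu: "\<And>i. i \<in> {1..t} \<Longrightarrow> \<mu> i \<ge> 1"
    and char: "\<And>i a. i \<in> {1..t} \<Longrightarrow> 1 \<le> a \<Longrightarrow> a \<le> \<mu> i \<Longrightarrow> (of_nat a :: 'k) \<noteq> 0"
begin

text \<open>Intersecting with \<open>PR n\<close> keeps \<open>I\<close> inside the polynomial ring
  also for \<open>t = 0\<close>, which the locale allows.\<close>

definition I where "I = PR n \<inter> (\<Inter>i\<in>{1..t}. fatI n (q i) (\<mu> i))"

lemma I_iff: "F \<in> I \<longleftrightarrow> F \<in> PR n \<and> (\<forall>i\<in>{1..t}. tau (q i) F \<in> vord (\<mu> i))"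
  by (auto simp: I_def fatI_def)

lemma I_ideal: "ideal I (poly_ring n)"
proof (rule idealI)
  show "ring (poly_ring n :: 'k mpoly ring)" using poly_ring_cring by (rule cring.axioms)
  show "subgroup I (add_monoid (poly_ring n))"
  proof (rule subgroup.intro)
    fix F assume F: "F \<in> I"
    then have "inv\<^bsub>add_monoid (poly_ring n)\<^esub> F = - F"
      by (simp only: a_inv_def[symmetric]) (simp add: I_iff poly_ring_a_inv)
    then show "inv\<^bsub>add_monoid (poly_ring n)\<^esub> F \<in> I"
      using F by (simp add: I_iff tau_simps PR_uminus vord_uminus)
  qed (auto simp: I_iff tau_simps PR_add vord_add)
qed (auto simp: I_iff tau_simps PR_mult vord_mult_left vord_mult_right)

sublocale coord n m I by (rule coord.intro) (rule I_ideal)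

lemma bump_linear:
  assumes "k \<in> {1..t}" "l \<in> {1..t}" "l \<noteq> k"
  obtains L where "L \<in> PR n" "homogeneous 1 L" "tau (q l) L \<in> vord 1" "tau (q k) L - var_poly 0 \<in> vord 1"
proof -
  have "q k \<noteq> q l" using assms q_inj by (auto dest: inj_onD)
  then obtain j where j: "q k j \<noteq> q l j" by auto
  have jn: "j \<le> n" "j \<noteq> 0" using j qn[of k j] qn[of l j] q0[of k] q0[of l] assms by (auto simp: not_le intro: ccontr)
  \<comment> \<open>At \<open>q k\<close> the linear form \<open>yv (q l) j\<close> has the
    \<open>X_0\<close>-coefficient \<open>q k j - q l j\<close>, which \<open>c\<close> normalizes
    to 1.\<close>
  define c where "c = inverse (q k j - q l j)"
  define L where "L = const_poly c * yv (q l) j"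
  have "tau (q k) L = const_poly c * var_poly j + const_poly (c * (q k j - q l j)) * var_poly 0"
    using jn by (simp add: L_def tau_simps yv_def tau_var_def const_poly_simps algebra_simps)
      (simp add: const_poly_simps(1)[symmetric] const_poly_def single_add single_diff algebra_simps mult_single)
  also have "c * (q k j - q l j) = 1" using j by (simp add: c_def)
  finally have "tau (q k) L - var_poly 0 = const_poly c * var_poly j" by (simp add: const_poly_simps)
  moreover have "const_poly c * var_poly j \<in> vord 1" using jn by (intro vord_mult_left var_vord)
  moreover have "tau (q l) L \<in> vord 1"
    unfolding L_def tau_simps tau_yv using jn by (intro vord_mult_left var_vord)
  moreover have "L \<in> PR n" "homogeneous 1 L"
    unfolding L_def using jn homogeneous_yv by (auto intro: PR_mult yv_PR homogeneous_const_mult)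
  ultimately show ?thesis using that by simp
qed

text \<open>Linear forms through the other points give a product \<open>w\<close> that agrees with a
  power of \<open>X_0\<close> at the \<open>k\<close>-th point only to first order. A finite
  geometric sum raises this to order \<open>M\<close> and keeps the factor \<open>w * w\<close>, of
  which one copy goes to each of the two required factors.\<close>

lemma bump:
  "\<exists>S. \<forall>k\<in>{1..t}. \<exists>w w'. w \<in> PR n \<and> w' \<in> PR n
    \<and> tau (q k) (w * w') - var_poly 0 ^ S \<in> vord (\<mu> k)
    \<and> (\<forall>l\<in>{1..t} - {k}. tau (q l) w \<in> vord (\<mu> l) \<and> tau (q l) w' \<in> vord (\<mu> l))
    \<and> homogeneous S (w * w')"
proof -
  \<comment> \<open>An exponent at least as large as every multiplicity. It does not depend on
    \<open>k\<close>, so the degree \<open>S\<close> is the same for all points.\<close>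
  define M where "M = Suc (\<Sum>i\<in>{1..t}. \<mu> i)"
  have M: "\<mu> i \<le> M" if "i \<in> {1..t}" for i
    using member_le_sum[of i "{1..t}" \<mu>] that by (simp add: M_def)
  \<comment> \<open>The degree of \<open>w\<close> below, a product of \<open>M\<close>-th powers of
    \<open>t - 1\<close> linear forms.\<close>
  define a where "a = (t - 1) * M"
  have "\<exists>w w'. w \<in> PR n \<and> w' \<in> PR n
    \<and> tau (q k) (w * w') - var_poly 0 ^ (M * (2 * a)) \<in> vord (\<mu> k)
    \<and> (\<forall>l\<in>{1..t} - {k}. tau (q l) w \<in> vord (\<mu> l) \<and> tau (q l) w' \<in> vord (\<mu> l))
    \<and> homogeneous (M * (2 * a)) (w * w')" if k: "k \<in> {1..t}" for k
  proof -
    let ?A = "{1..t} - {k}"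
    have "\<forall>l\<in>?A. \<exists>L. L \<in> PR n \<and> homogeneous 1 L \<and> tau (q l) L \<in> vord 1 \<and> tau (q k) L - var_poly 0 \<in> vord 1"
      using bump_linear k by (metis DiffD1 DiffD2 singletonI)
    then obtain L where L: "\<And>l. l \<in> ?A \<Longrightarrow> L l \<in> PR n \<and> homogeneous 1 (L l) \<and> tau (q l) (L l) \<in> vord 1
        \<and> tau (q k) (L l) - var_poly 0 \<in> vord 1" by metis
    define w where "w = (\<Prod>l\<in>?A. L l ^ M)"
    have card: "card ?A = t - 1" using k by simp
    have w: "w \<in> PR n" unfolding w_def using L by (intro PR_prod PR_power) auto
    have hw: "homogeneous a w"
    proof -
      have "homogeneous (card A * M) (\<Prod>l\<in>A. L l ^ M)" if "finite A" "A \<subseteq> ?A" for A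
        using that
      proof (induction A)
        case empty
        then show ?case using homogeneous_const[of 1] by (simp add: const_poly_simps)
      next
        case (insert l A)
        then have "homogeneous (M * 1) (L l ^ M)" using L by (intro homogeneous_power) auto
        then show ?case using insert homogeneous_simps(5)[of "M * 1" "L l ^ M" "card A * M" "\<Prod>l\<in>A. L l ^ M"]
          by simp
      qed
      from this[of ?A] show ?thesis unfolding w_def a_def card[symmetric] by simp
    qed
    have wl: "tau (q l) w \<in> vord (\<mu> l)" if "l \<in> ?A" for l
    proof -
      have "tau (q l) (L l ^ M) \<in> vord (M * 1)" using L[OF that] by (simp only: tau_simps) (intro vord_power, auto)
      then have "tau (q l) (L l ^ M) \<in> vord (\<mu> l)" by (rule vord_mono) (use M[of l] that in simp)
      moreover have "w = L l ^ M * (\<Prod>l\<in>?A - {l}. L l ^ M)"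
        unfolding w_def using that by (intro prod.remove) auto
      ultimately show ?thesis by (simp add: tau_simps vord_mult_right)
    qed
    have wk: "tau (q k) w - var_poly 0 ^ a \<in> vord 1"
    proof -
      have "tau (q k) w - (\<Prod>l\<in>?A. var_poly 0 ^ M) \<in> vord 1"
        unfolding w_def tau_prod tau_simps using L by (intro vord_prod_cong vord_power_cong) auto
      moreover have "(\<Prod>l\<in>?A. var_poly 0 ^ M) = (var_poly 0 :: 'k mpoly) ^ a"
        by (simp only: prod_constant card a_def power_mult[symmetric] mult.commute)
      ultimately show ?thesis by simp
    qed
    define X where "X = (var_poly 0 :: 'k mpoly) ^ (2 * a)"
    have XP: "X \<in> PR n" unfolding X_def by (intro PR_power PR_var) simp
    have hX: "homogeneous (2 * a) X"
      unfolding X_def using homogeneous_power[OF homogeneous_var, of "2 * a" 0] by simp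
    have hu: "homogeneous (2 * a) (w * w)" using homogeneous_simps(5)[OF hw hw] by (simp add: mult_2)
    have tX: "tau (q k) X = X" by (simp add: X_def tau_simps tau_var_def)
    have uk: "tau (q k) (X - w * w) \<in> vord 1"
    proof -
      have "tau (q k) w * tau (q k) w - var_poly 0 ^ a * var_poly 0 ^ a \<in> vord 1"
        by (rule vord_mult_cong) (rule wk)+
      then have "- (tau (q k) w * tau (q k) w - X) \<in> vord 1"
        by (intro vord_uminus) (simp add: X_def mult_2 power_add)
      then show ?thesis by (simp add: tau_simps tX)
    qed
    \<comment> \<open>\<open>X - w\<^sup>2\<close> vanishes at the \<open>k\<close>-th point, so \<open>X ^ M - (X - w\<^sup>2) ^ M\<close> is as required and divisible by \<open>w\<^sup>2\<close>.\<close>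
    define h where "h = (\<Sum>i<M. (X - w * w) ^ (M - Suc i) * X ^ i)"
    have hP: "h \<in> PR n" unfolding h_def using XP w by (intro PR_sum PR_mult PR_power PR_diff) auto
    have e: "w * (w * h) = X ^ M - (X - w * w) ^ M"
      using power_diff_sumr2[of X M "X - w * w"] by (simp add: h_def mult.assoc)
    show ?thesis
    proof (intro exI conjI ballI)
      show "w \<in> PR n" by (rule w)
      show "w * h \<in> PR n" using w hP by (rule PR_mult)
      show "tau (q l) w \<in> vord (\<mu> l)" "tau (q l) (w * h) \<in> vord (\<mu> l)" if "l \<in> ?A" for l
        using wl[OF that] by (simp_all add: tau_simps vord_mult_right)
      have "tau (q k) (X - w * w) ^ M \<in> vord (M * 1)" using uk by (rule vord_power)
      then have "tau (q k) (X - w * w) ^ M \<in> vord (\<mu> k)" by (rule vord_mono) (use M[OF k] in simp)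
      then have "- (tau (q k) (X - w * w) ^ M) \<in> vord (\<mu> k)" by (rule vord_uminus)
      moreover have "X ^ M = var_poly 0 ^ (M * (2 * a))" unfolding X_def power_mult[symmetric] by (simp only: mult_ac)
      moreover have "tau (q k) (w * (w * h)) - X ^ M = - (tau (q k) (X - w * w) ^ M)"
        unfolding e by (simp add: tau_simps(2,5) tX)
      ultimately show "tau (q k) (w * (w * h)) - var_poly 0 ^ (M * (2 * a)) \<in> vord (\<mu> k)" by simp
      show "homogeneous (M * (2 * a)) (w * (w * h))"
        unfolding e by (intro homogeneous_simps(4) homogeneous_power hX hu)
    qed
  qed
  then show ?thesis by blast
qed

end

locale bumps = fat n m t q \<mu>
  for n m t :: nat and q :: "nat \<Rightarrow> nat \<Rightarrow> 'k::field" and \<mu> :: "nat \<Rightarrow> nat" +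
  fixes S :: nat and w w' :: "nat \<Rightarrow> 'k mpoly"
  assumes w: "k \<in> {1..t} \<Longrightarrow> w k \<in> PR n" and w': "k \<in> {1..t} \<Longrightarrow> w' k \<in> PR n"
    and wk: "k \<in> {1..t} \<Longrightarrow> tau (q k) (w k * w' k) - var_poly 0 ^ S \<in> vord (\<mu> k)"
    and wl: "\<lbrakk>k \<in> {1..t}; l \<in> {1..t}; l \<noteq> k\<rbrakk> \<Longrightarrow> tau (q l) (w k) \<in> vord (\<mu> l)"
    and wl': "\<lbrakk>k \<in> {1..t}; l \<in> {1..t}; l \<noteq> k\<rbrakk> \<Longrightarrow> tau (q l) (w' k) \<in> vord (\<mu> l)"
    and w_hom: "k \<in> {1..t} \<Longrightarrow> homogeneous S (w k * w' k)"
begin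

abbreviation "e k \<equiv> w k * w' k"
abbreviation "y k \<equiv> yv (q k)"

lemma e_PR: "k \<in> {1..t} \<Longrightarrow> e k \<in> PR n"
  using w w' by (rule PR_mult)

definition gen where
  "gen k \<alpha> J = pform (e k * pw (y k) \<alpha>) (map (y k) (sorted_list_of_set J))"

text \<open>The generators surviving the elimination: in the top local degree \<open>\<mu> k - 1\<close>, some variable of the coefficient
  must come after all the differentials.\<close>

definition good :: "nat \<Rightarrow> nat \<Rightarrow> (nat \<Rightarrow>\<^sub>0 nat) \<Rightarrow> nat set \<Rightarrow> bool" where
  "good r k \<alpha> J \<longleftrightarrow> keys \<alpha> \<subseteq> {..n} \<and> tdeg \<alpha> = r \<and> J \<subseteq> {..n} \<and> card J = m \<and>
    (ydeg \<alpha> + 2 \<le> \<mu> k \<or>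
     ydeg \<alpha> + 1 = \<mu> k \<and> ((\<exists>i\<in>keys \<alpha>. \<forall>j\<in>J. j < i) \<or> ydeg \<alpha> = 0 \<and> J = {0}))"

lemma pw_y_PR: "keys \<alpha> \<subseteq> {..n} \<Longrightarrow> pw (y k) \<alpha> \<in> PR n"
  by (intro pw_PR yv_PR) auto

text \<open>Leibniz rule for \<open>w k * F \<in> I\<close>: the other summand has coefficient \<open>w' k * F \<in> I\<close>. This is why \<open>e k\<close> is
  required to factor.\<close>

lemma pform_bump_zero:
  assumes k: "k \<in> {1..t}" and F: "F \<in> PR n" "tau (q k) F \<in> vord (\<mu> k)"
    and H: "H \<in> PR n" and gs: "set gs \<subseteq> PR n" "Suc (length gs) = m"
  shows "pform (e k * H) (F # gs) = \<zero>\<^bsub>\<Lambda>m\<^esub>"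
proof -
  have wF: "w k * F \<in> I"
    unfolding I_iff
  proof safe
    show "w k * F \<in> PR n" using w[OF k] F(1) by (rule PR_mult)
    show "tau (q i) (w k * F) \<in> vord (\<mu> i)" if "i \<in> {1..t}" for i
      using F(2) wl[OF k that] by (cases "i = k") (auto simp: tau_simps vord_mult_left vord_mult_right)
  qed
  have w'F: "w' k * F \<in> I"
    unfolding I_iff
  proof safe
    show "w' k * F \<in> PR n" using w'[OF k] F(1) by (rule PR_mult)
    show "tau (q i) (w' k * F) \<in> vord (\<mu> i)" if "i \<in> {1..t}" for i
      using F(2) wl'[OF k that] by (cases "i = k") (auto simp: tau_simps vord_mult_left vord_mult_right)
  qed
  have w'H: "w' k * H \<in> PR n" using w'[OF k] H by (rule PR_mult)
  have "\<zero>\<^bsub>\<Lambda>m\<^esub> = pform (w' k * H) ([] @ (w k * F) # gs)"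
    using wF w'H gs by (intro pform_slot_I[symmetric]) auto
  also have "\<dots> = pform (w k * (w' k * H)) ([] @ F # gs) \<oplus>\<^bsub>\<Lambda>m\<^esub> pform (F * (w' k * H)) ([] @ w k # gs)"
    using w[OF k] F w'H gs by (intro pform_slot_mult) auto
  also have "pform (F * (w' k * H)) ([] @ w k # gs) = \<zero>\<^bsub>\<Lambda>m\<^esub>"
    using I_mult(1)[OF w'F H] w[OF k] gs by (intro pform_coeff_I) (auto simp: mult_ac)
  also have "w k * (w' k * H) = e k * H" by (simp add: mult.assoc)
  finally have *: "\<zero>\<^bsub>\<Lambda>m\<^esub> = pform (e k * H) (F # gs) \<oplus>\<^bsub>\<Lambda>m\<^esub> \<zero>\<^bsub>\<Lambda>m\<^esub>" by simp
  have "pform (e k * H) (F # gs) \<in> carrier \<Lambda>m"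
    using w[OF k] w'[OF k] H F gs by (intro pform_closed PR_mult) auto
  then show ?thesis using * by (simp add: diff_forms_eq)
qed

end

section \<open>Spanning the forms of high degree\<close>

lemma diff_eqI: "a = b + c \<Longrightarrow> a - b = c" for a :: "'a::ab_group_add"
  by simp

context coord begin

text \<open>Stated by closure properties, so that the spanning argument can be run for an arbitrary
  such \<open>C\<close>; it is applied to the span of the generators and to that of a graded
  component.\<close>

definition ksubspace where
  "ksubspace C \<longleftrightarrow> C \<subseteq> carrier \<Lambda>m \<and> \<zero>\<^bsub>\<Lambda>m\<^esub> \<in> C \<and> (\<forall>x\<in>C. \<forall>y\<in>C. x \<oplus>\<^bsub>\<Lambda>m\<^esub> y \<in> C)
    \<and> (\<forall>c. \<forall>x\<in>C. base_map n I c \<odot>\<^bsub>\<Lambda>m\<^esub> x \<in> C)"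

lemma base_minus:
  assumes "x \<in> carrier \<Lambda>m"
  shows "base_map n I (- 1) \<odot>\<^bsub>\<Lambda>m\<^esub> x = \<ominus>\<^bsub>\<Lambda>m\<^esub> x"
proof -
  have one: "cls 1 = \<one>\<^bsub>R\<^esub>" using ring_hom_one[OF cls_hom] by simp
  have "cls (const_poly (- 1)) \<oplus>\<^bsub>R\<^esub> cls 1 = cls (const_poly (- 1) + 1)"
    by (rule cls_add) simp_all
  then have "cls (const_poly (- 1)) \<oplus>\<^bsub>R\<^esub> cls 1 = \<zero>\<^bsub>R\<^esub>"
    using cls_zero[OF I_0] by (simp add: const_poly_simps)
  then have "cls (const_poly (- 1)) = \<ominus>\<^bsub>R\<^esub> \<one>\<^bsub>R\<^esub>"
    unfolding one by (intro minus_equality[symmetric]) (auto intro: cls_closed)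
  then show ?thesis
    using L.smult_minus_1[of x] assms unfolding base_map_def diff_forms_eq by simp
qed

lemma pform_slot_scale:
  assumes "F \<in> P" "set (as @ x # bs) \<subseteq> P" "length (as @ x # bs) = m"
  shows "pform F (as @ (const_poly c * x) # bs) = base_map n I c \<odot>\<^bsub>\<Lambda>m\<^esub> pform F (as @ x # bs)"
proof -
  have "pform F (as @ (const_poly c * x) # bs)
    = pform (const_poly c * F) (as @ x # bs) \<oplus>\<^bsub>\<Lambda>m\<^esub> pform (x * F) (as @ const_poly c # bs)"
    using assms by (intro pform_slot_mult) auto
  also have "pform (x * F) (as @ const_poly c # bs) = \<zero>\<^bsub>\<Lambda>m\<^esub>"
    using assms by (intro pform_slot_const) (auto intro: PR_mult)
  also have "pform (const_poly c * F) (as @ x # bs) = base_map n I c \<odot>\<^bsub>\<Lambda>m\<^esub> pform F (as @ x # bs)"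
    using assms by (intro pform_scale) auto
  also have "\<dots> \<oplus>\<^bsub>\<Lambda>m\<^esub> \<zero>\<^bsub>\<Lambda>m\<^esub> = \<dots>"
  proof -
    have "base_map n I c \<in> carrier R" by (simp add: base_map_def cls_closed)
    moreover have "pform F (as @ x # bs) \<in> carrier \<Lambda>m" using assms by (intro pform_closed)
    ultimately show ?thesis unfolding diff_forms_eq by simp
  qed
  finally show ?thesis .
qed

lemma pform_slot_power:
  assumes "H \<in> P" "z \<in> P" "set gs \<subseteq> P" "Suc (length gs) = m"
  shows "pform H (z ^ Suc c # gs) = pform (const_poly (of_nat (Suc c)) * (H * z ^ c)) (z # gs)"
  using assms(1)
proof (induction c arbitrary: H)
  case 0
  then show ?case by (simp add: const_poly_simps)
next
  case (Suc c)
  have "pform H ([] @ (z * z ^ Suc c) # gs)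
      = pform (z * H) ([] @ z ^ Suc c # gs) \<oplus>\<^bsub>\<Lambda>m\<^esub> pform (z ^ Suc c * H) ([] @ z # gs)"
    using Suc.prems assms by (intro pform_slot_mult) (auto intro!: PR_mult PR_power)
  also have "pform (z * H) ([] @ z ^ Suc c # gs) = pform (const_poly (of_nat (Suc c)) * (z * H * z ^ c)) (z # gs)"
    using Suc.IH[of "z * H"] Suc.prems assms by (simp only: append.simps) (simp add: PR_mult)
  also have "\<dots> \<oplus>\<^bsub>\<Lambda>m\<^esub> pform (z ^ Suc c * H) ([] @ z # gs)
      = pform (const_poly (of_nat (Suc c)) * (z * H * z ^ c) + z ^ Suc c * H) (z # gs)"
    using Suc.prems assms by (simp only: append.simps) (intro pform_coeff_add[symmetric] PR_mult PR_power PR_const, auto)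
  also have "const_poly (of_nat (Suc c)) * (z * H * z ^ c) + z ^ Suc c * H
      = const_poly (of_nat (Suc (Suc c))) * (H * z ^ Suc c)"
  proof -
    have "const_poly (of_nat (Suc (Suc c)) :: 'k) = const_poly (of_nat (Suc c)) + 1"
      using const_poly_simps(1)[of "of_nat (Suc c)" "1 :: 'k"] by (simp add: const_poly_simps add_ac)
    then show ?thesis by (simp only:) (simp add: algebra_simps)
  qed
  finally show ?case by simp
qed

context
  fixes C assumes C: "ksubspace C"
begin

lemma C_sub: "x \<in> C \<Longrightarrow> x \<in> carrier \<Lambda>m" and C_zero: "\<zero>\<^bsub>\<Lambda>m\<^esub> \<in> C"
  and C_add: "x \<in> C \<Longrightarrow> y \<in> C \<Longrightarrow> x \<oplus>\<^bsub>\<Lambda>m\<^esub> y \<in> C" and C_scale: "x \<in> C \<Longrightarrow> base_map n I c \<odot>\<^bsub>\<Lambda>m\<^esub> x \<in> C"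
  using C unfolding ksubspace_def by auto

lemma C_cancel:
  assumes "x \<oplus>\<^bsub>\<Lambda>m\<^esub> z \<in> C" "x \<in> C" "z \<in> carrier \<Lambda>m"
  shows "z \<in> C"
proof -
  have x: "x \<in> carrier \<Lambda>m" using assms C_sub by auto
  have "\<ominus>\<^bsub>\<Lambda>m\<^esub> x \<in> C" using C_scale[OF assms(2), of "- 1"] base_minus[OF x] by simp
  then have "\<ominus>\<^bsub>\<Lambda>m\<^esub> x \<oplus>\<^bsub>\<Lambda>m\<^esub> (x \<oplus>\<^bsub>\<Lambda>m\<^esub> z) \<in> C" using assms(1) by (rule C_add)
  moreover have "\<ominus>\<^bsub>\<Lambda>m\<^esub> x \<oplus>\<^bsub>\<Lambda>m\<^esub> (x \<oplus>\<^bsub>\<Lambda>m\<^esub> z) = z"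
    using x assms(3) unfolding diff_forms_eq by (rule L.r_neg1)
  ultimately show ?thesis by metis
qed

text \<open>Polarization of the alternating property shows that the two forms add up to zero, so
  membership in a subspace is insensitive to the order of the slots.\<close>

lemma C_swap:
  assumes "F \<in> P" "set (as @ x # z # bs) \<subseteq> P" "length (as @ x # z # bs) = m"
    and "pform F (as @ x # z # bs) \<in> C"
  shows "pform F (as @ z # x # bs) \<in> C"
proof -
  let ?f = "\<lambda>a b. pform F (as @ a # b # bs)"
  have c: "?f a b \<in> carrier \<Lambda>m" if "a \<in> P" "b \<in> P" for a b
    using that assms by (intro pform_closed) auto
  have xz: "x \<in> P" "z \<in> P" using assms by auto
  have alt: "?f a a = \<zero>\<^bsub>\<Lambda>m\<^esub>" if "a \<in> P" for a
    using that assms by (intro pform_slot_alt) auto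
  have add1: "?f (x + z) a = ?f x a \<oplus>\<^bsub>\<Lambda>m\<^esub> ?f z a" if "a \<in> P" for a
    using that assms by (intro pform_slot_add) auto
  have add2: "?f a (x + z) = ?f a x \<oplus>\<^bsub>\<Lambda>m\<^esub> ?f a z" if "a \<in> P" for a
    using that assms pform_slot_add[of F "as @ [a]" x z bs] by auto
  have "\<zero>\<^bsub>\<Lambda>m\<^esub> = ?f (x + z) (x + z)" using xz by (intro alt[symmetric] PR_add)
  also have "\<dots> = (?f x x \<oplus>\<^bsub>\<Lambda>m\<^esub> ?f x z) \<oplus>\<^bsub>\<Lambda>m\<^esub> (?f z x \<oplus>\<^bsub>\<Lambda>m\<^esub> ?f z z)"
    using xz by (simp only: add1[OF PR_add[OF xz]] add2)
  also have "\<dots> = ?f x z \<oplus>\<^bsub>\<Lambda>m\<^esub> ?f z x"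
    using alt xz c[OF xz] c[OF xz(2,1)] unfolding diff_forms_eq by simp
  finally have "?f x z \<oplus>\<^bsub>\<Lambda>m\<^esub> ?f z x \<in> C" using C_zero by simp
  then show ?thesis using assms(4) c[OF xz(2,1)] by (rule C_cancel)
qed

lemma C_perm:
  assumes F: "F \<in> P" and z: "\<And>j. j \<le> n \<Longrightarrow> z j \<in> P"
    and ks: "mset ks = mset ls" "set ks \<subseteq> {..n}" "length ks = m"
  shows "pform F (map z ks) \<in> C \<longleftrightarrow> pform F (map z ls) \<in> C"
proof -
  have "(\<lambda>ks. pform F (map z ks) \<in> C) ([] @ ks) = (\<lambda>ks. pform F (map z ks) \<in> C) ([] @ ls)"
  proof (rule swap_invariant_mset[where N = m and A = "{..n}"])
    fix as x y bs assume a: "length (as @ x # y # bs) = m" "set (as @ x # y # bs) \<subseteq> {..n}"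
    have s: "set (map z as @ z x # z y # map z bs) \<subseteq> P" "set (map z as @ z y # z x # map z bs) \<subseteq> P"
      using a(2) z by auto
    show "(pform F (map z (as @ x # y # bs)) \<in> C) = (pform F (map z (as @ y # x # bs)) \<in> C)"
      using C_swap[OF F s(1)] C_swap[OF F s(2)] a(1) by auto
  qed (use ks in auto)
  then show ?thesis by simp
qed

lemma C_repeat:
  assumes F: "F \<in> P" and z: "\<And>j. j \<le> n \<Longrightarrow> z j \<in> P"
    and ks: "\<not> distinct ks" "set ks \<subseteq> {..n}" "length ks = m"
  shows "pform F (map z ks) \<in> C"
proof -
  obtain as x bs cs where d: "ks = as @ [x] @ bs @ [x] @ cs" using not_distinct_decomp[OF ks(1)] by blast
  have "mset ks = mset ([] @ x # x # as @ bs @ cs)" by (simp add: d)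
  moreover have "pform F (map z ([] @ x # x # as @ bs @ cs)) = \<zero>\<^bsub>\<Lambda>m\<^esub>"
    using pform_slot_alt[of F "[]" "z x" "map z (as @ bs @ cs)"] F z ks d by auto
  ultimately show ?thesis
    using C_perm[of F z ks "[] @ x # x # as @ bs @ cs"] F z ks(2,3) C_zero by simp
qed

lemma C_coeff_sum:
  assumes "finite A" "\<And>x. x \<in> A \<Longrightarrow> f x \<in> P" "set Gs \<subseteq> P" "length Gs = m"
    and "\<And>x. x \<in> A \<Longrightarrow> pform (f x) Gs \<in> C"
  shows "pform (sum f A) Gs \<in> C"
  using assms(1,2,5)
proof (induction A)
  case empty
  then show ?case using pform_coeff_I[OF I_0 assms(3,4)] C_zero by simp
next
  case (insert a A)
  have "pform (f a + sum f A) Gs = pform (f a) Gs \<oplus>\<^bsub>\<Lambda>m\<^esub> pform (sum f A) Gs"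
    using insert assms by (intro pform_coeff_add PR_sum) auto
  then show ?case using insert by (simp add: C_add)
qed

lemma C_coeff_scale:
  assumes "F \<in> P" "set Gs \<subseteq> P" "length Gs = m" "pform F Gs \<in> C"
  shows "pform (const_poly c * F) Gs \<in> C"
  using pform_scale[OF assms(1-3)] C_scale[OF assms(4)] by simp

lemma C_coeff_unscale:
  assumes "F \<in> P" "set Gs \<subseteq> P" "length Gs = m" "c \<noteq> 0" "pform (const_poly c * F) Gs \<in> C"
  shows "pform F Gs \<in> C"
proof -
  have "pform (const_poly (inverse c) * (const_poly c * F)) Gs \<in> C"
    by (rule C_coeff_scale) (use assms in \<open>simp_all add: PR_mult\<close>)
  moreover have "const_poly (inverse c) * (const_poly c * F) = F"
    using assms(4) by (simp add: mult.assoc[symmetric] const_poly_simps(2)[symmetric] const_poly_simps(3))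
  ultimately show ?thesis by simp
qed

text \<open>The Leibniz rule writes \<open>d(z^\<delta>)\<close> as a combination of the forms
  \<open>z^(\<delta> - i) dz_i\<close>. Only membership is claimed, so multiplicities are not
  tracked; variables already split off are absorbed by \<open>H\<close>.\<close>

lemma C_slot_pw:
  assumes z: "\<And>j. j \<le> n \<Longrightarrow> z j \<in> P" and gs: "set gs \<subseteq> P" "Suc (length gs) = m"
    and "H \<in> P" "keys \<delta> \<subseteq> {..n}"
    and "\<And>i. i \<in> keys \<delta> \<Longrightarrow> pform (H * pw z (\<delta> - single i 1)) (z i # gs) \<in> C"
  shows "pform H (pw z \<delta> # gs) \<in> C"
  using assms(4-)
proof (induction "tdeg \<delta>" arbitrary: \<delta> H)
  case 0
  then have "keys \<delta> = {}"
    by (fastforce simp: tdeg_def lin_ext_def in_keys_iff)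
  then have "pw z \<delta> = const_poly 1" by (simp add: const_poly_simps)
  then have "pform H ([] @ pw z \<delta> # gs) = \<zero>\<^bsub>\<Lambda>m\<^esub>"
    using pform_slot_const[of H "[]" gs 1] gs 0 by simp
  then show ?case using C_zero by simp
next
  case (Suc s)
  have "\<delta> \<noteq> 0" using Suc.hyps(2) by auto
  then obtain i where i: "i \<in> keys \<delta>" by (metis all_not_in_conv keys_eq_empty)
  let ?\<epsilon> = "\<delta> - single i 1"
  have \<delta>: "\<delta> = ?\<epsilon> + single i 1" using i by (rule keys_diff_single)
  have k\<epsilon>: "keys ?\<epsilon> \<subseteq> keys \<delta>" by (auto simp: in_keys_iff lookup_minus)
  have i_n: "i \<le> n" using i Suc.prems by auto
  have zi: "z i \<in> P" using z i_n by auto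
  have p\<epsilon>: "pw z ?\<epsilon> \<in> P" using k\<epsilon> Suc.prems by (intro pw_PR z) auto
  have "pform H ([] @ (pw z ?\<epsilon> * z i) # gs)
      = pform (pw z ?\<epsilon> * H) ([] @ z i # gs) \<oplus>\<^bsub>\<Lambda>m\<^esub> pform (z i * H) ([] @ pw z ?\<epsilon> # gs)"
    using Suc.prems gs zi p\<epsilon> by (intro pform_slot_mult) auto
  moreover have "pform (pw z ?\<epsilon> * H) ([] @ z i # gs) \<in> C"
    using Suc.prems(3)[OF i] by (simp add: mult.commute)
  moreover have "pform (z i * H) (pw z ?\<epsilon> # gs) \<in> C"
  proof (rule Suc.hyps(1))
    show "s = tdeg ?\<epsilon>" using Suc.hyps(2) arg_cong[OF \<delta>, of tdeg] by simp
    show "z i * H \<in> P" using zi Suc.prems by (intro PR_mult)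
    show "keys ?\<epsilon> \<subseteq> {..n}" using k\<epsilon> Suc.prems by auto
    fix i' assume i': "i' \<in> keys ?\<epsilon>"
    have eq: "\<delta> - single i' 1 = (?\<epsilon> - single i' 1) + single i 1"
      using i i' by (intro poly_mapping_eqI) (auto simp: lookup_add lookup_minus lookup_single when_def in_keys_iff)
    have "pform (H * pw z (\<delta> - single i' 1)) (z i' # gs) \<in> C"
      using Suc.prems(3) i' k\<epsilon> by blast
    then show "pform (z i * H * pw z (?\<epsilon> - single i' 1)) (z i' # gs) \<in> C"
      unfolding eq pw_add pw_single by (simp add: mult_ac)
  qed
  moreover have "pw z \<delta> = pw z ?\<epsilon> * z i" by (subst \<delta>) (simp only: pw_add pw_single power_one_right)
  ultimately show ?case using C_add by simp
qed

text \<open>A slot \<open>z' j\<close> is expanded into \<open>z j\<close> and a multiple of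
  \<open>z 0\<close>, one slot at a time; \<open>ks\<close> records the slots already expanded. This
  serves to pass between the \<open>X_j\<close> and the local coordinates, in both
  directions.\<close>

lemma C_slots_change:
  assumes F: "F \<in> P" and z: "\<And>j. j \<le> n \<Longrightarrow> z j \<in> P"
    and z': "\<And>j. j \<le> n \<Longrightarrow> z' j = z j + const_poly (c j) * z 0"
    and all: "\<And>ks. set ks \<subseteq> {..n} \<Longrightarrow> length ks = m \<Longrightarrow> pform F (map z ks) \<in> C"
    and js: "set (ks @ js) \<subseteq> {..n}" "length (ks @ js) = m"
  shows "pform F (map z ks @ map z' js) \<in> C"
  using js
proof (induction js arbitrary: ks)
  case Nil
  then show ?case using all by simp
next
  case (Cons j js)
  have IH: "pform F (map z ks @ z i # map z' js) \<in> C" if "i \<le> n" for i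
    using Cons.IH[of "ks @ [i]"] Cons.prems that by simp
  have z0: "z 0 \<in> P" by (rule z) simp
  have z'P: "z' l \<in> P" if "l \<le> n" for l
    unfolding z'[OF that] by (rule PR_add[OF z[OF that] PR_mult[OF PR_const z0]])
  have sub: "set (map z ks) \<subseteq> P" "set (map z' js) \<subseteq> P" "z j \<in> P" "const_poly (c j) * z 0 \<in> P"
    using Cons.prems z z'P z0 by (auto intro: PR_mult)
  have "pform F (map z ks @ map z' (j # js))
      = pform F (map z ks @ (z j + const_poly (c j) * z 0) # map z' js)"
    using Cons.prems z'[of j] by simp
  also have "\<dots> = pform F (map z ks @ z j # map z' js)
      \<oplus>\<^bsub>\<Lambda>m\<^esub> pform F (map z ks @ (const_poly (c j) * z 0) # map z' js)"
    by (rule pform_slot_add) (use F Cons.prems sub in simp_all)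
  also have "pform F (map z ks @ (const_poly (c j) * z 0) # map z' js)
      = base_map n I (c j) \<odot>\<^bsub>\<Lambda>m\<^esub> pform F (map z ks @ z 0 # map z' js)"
    by (rule pform_slot_scale) (use F Cons.prems sub z0 in simp_all)
  finally show ?case
    using IH[of j] IH[of 0] Cons.prems C_add C_scale by auto
qed

end

end

text \<open>\<open>C\<close> is any subspace containing the surviving generators whose monomial has
  degree \<open>r\<close>; the aim is that it contains every form with coefficient of degree
  \<open>r + S\<close>.\<close>

locale spanning = bumps +
  fixes r :: nat and C
  assumes C: "ksubspace C"
    and gen_mem: "\<And>k \<alpha> J. k \<in> {1..t} \<Longrightarrow> good r k \<alpha> J \<Longrightarrow> gen k \<alpha> J \<in> C"
begin

lemma y_PR: "j \<le> n \<Longrightarrow> y k j \<in> PR n"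
  by (rule yv_PR)

lemma e_mult_PR: "k \<in> {1..t} \<Longrightarrow> G \<in> PR n \<Longrightarrow> e k * G \<in> PR n"
  by (rule PR_mult[OF e_PR])

lemma gen_list:
  assumes k: "k \<in> {1..t}" and g: "good r k \<alpha> (set ks)" and ks: "distinct ks" "length ks = m"
  shows "pform (e k * pw (y k) \<alpha>) (map (y k) ks) \<in> C"
proof -
  have s: "set ks \<subseteq> {..n}" "keys \<alpha> \<subseteq> {..n}" using g by (auto simp: good_def)
  have "mset (sorted_list_of_set (set ks)) = mset ks"
    using ks by (simp add: sorted_list_of_set_sort_remdups distinct_remdups_id)
  then show ?thesis
    using C_perm[OF C, of "e k * pw (y k) \<alpha>" "y k" ks "sorted_list_of_set (set ks)"] gen_mem[OF k g]
      s ks e_PR[OF k] pw_y_PR[OF s(2)] y_PR unfolding gen_def by (simp add: PR_mult)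
qed

text \<open>If \<open>y^\<alpha> dy_J\<close> does not survive, one relation suffices to rewrite it:
  \<open>d(y_p y^\<alpha>) dy_K\<close>, with the power of \<open>y_0\<close> kept outside the
  differential, \<open>p\<close> the maximum of \<open>J\<close> and \<open>K\<close> the rest of
  \<open>J\<close>. All other terms are surviving generators or have a repeated differential, so the
  rewriting ends after one step.\<close>

lemma span_local:
  assumes k: "k \<in> {1..t}" and \<alpha>: "keys \<alpha> \<subseteq> {..n}" "tdeg \<alpha> = r" "ydeg \<alpha> < \<mu> k"
    and ks: "set ks \<subseteq> {..n}" "length ks = m"
  shows "pform (e k * pw (y k) \<alpha>) (map (y k) ks) \<in> C"
proof (cases "distinct ks")
  case False
  then show ?thesis using e_mult_PR[OF k pw_y_PR[OF \<alpha>(1)]] ks by (intro C_repeat[OF C] y_PR) auto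
next
  case dist: True
  let ?J = "set ks"
  have card: "card ?J = m" using dist ks by (simp add: distinct_card)
  show ?thesis
  proof (cases "good r k \<alpha> ?J")
    case True
    then show ?thesis using k dist ks by (intro gen_list)
  next
    case bad: False
    then have yd: "ydeg \<alpha> + 1 = \<mu> k" and nex: "\<not> (\<exists>i\<in>keys \<alpha>. \<forall>j\<in>?J. j < i)"
        and nz: "\<not> (ydeg \<alpha> = 0 \<and> ?J = {0})"
      using \<alpha> ks card unfolding good_def by auto
    have "?J \<noteq> {}" using card m by auto
    define p where "p = Max ?J"
    have p: "p \<in> ?J" "\<And>j. j \<in> ?J \<Longrightarrow> j \<le> p" using \<open>?J \<noteq> {}\<close> by (auto simp: p_def)
    have pn: "p \<le> n" using p ks by auto
    have le: "i \<le> p" if i: "i \<in> keys \<alpha>" for i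
    proof (rule ccontr)
      assume "\<not> i \<le> p"
      then have "\<forall>j\<in>?J. j < i" using p(2) by fastforce
      then show False using nex i by blast
    qed
    \<comment> \<open>For \<open>p = 0\<close> one would have \<open>J = {0}\<close> and
      \<open>y^\<alpha>\<close> a power of \<open>y_0\<close>, which is the excepted
      generator.\<close>
    have p0: "p \<noteq> 0"
    proof
      assume "p = 0"
      then have "?J = {0}" using p by auto
      moreover have "keys \<alpha> \<subseteq> {0}" using le \<open>p = 0\<close> by auto
      ultimately show False using nz ydeg_0_iff by auto
    qed
    obtain us vs where split: "ks = us @ p # vs" using p(1) by (meson split_list)
    define ls where "ls = us @ vs"
    have ls: "set ls = ?J - {p}" "distinct ls" "Suc (length ls) = m" "set ls \<subseteq> {..n}"
      using dist ks split by (auto simp: ls_def)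
    \<comment> \<open>The exponent is split as
      \<open>\<alpha> = \<delta> + single p c + single 0 a\<close>. The power of \<open>y_0\<close>
      stays in the coefficient, and the part to be differentiated,
      \<open>y_p^(c+1) y^\<delta>\<close>, has local degree exactly \<open>\<mu> k\<close>.\<close>
    define a where "a = lookup \<alpha> 0"
    define \<beta> where "\<beta> = \<alpha> - single 0 a"
    have \<alpha>_eq: "\<alpha> = \<beta> + single 0 a"
      by (intro poly_mapping_eqI) (auto simp: \<beta>_def a_def lookup_add lookup_minus lookup_single when_def)
    have \<beta>: "keys \<beta> \<subseteq> keys \<alpha> - {0}"
      by (auto simp: \<beta>_def a_def in_keys_iff lookup_minus lookup_single when_def)
    define c where "c = lookup \<beta> p"
    define \<delta> where "\<delta> = \<beta> - single p c"
    have \<beta>_eq: "\<beta> = \<delta> + single p c"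
      by (intro poly_mapping_eqI) (auto simp: \<delta>_def c_def lookup_add lookup_minus lookup_single when_def)
    have \<delta>: "keys \<delta> \<subseteq> keys \<beta> - {p}"
      by (auto simp: \<delta>_def c_def in_keys_iff lookup_minus lookup_single when_def)
    have keys_n: "keys \<beta> \<subseteq> {..n}" "keys \<delta> \<subseteq> {..n}" using \<alpha>(1) \<beta> \<delta> by auto
    have ydeg_sum: "ydeg \<delta> + c + 1 = \<mu> k" using yd p0 by (simp add: \<alpha>_eq \<beta>_eq)
    let ?y = "y k" and ?gs = "map (y k) ls"
    have gs: "set ?gs \<subseteq> PR n" "Suc (length ?gs) = m" using ls y_PR by auto
    let ?A = "e k * ?y 0 ^ a"
    have AP: "?A \<in> PR n" by (intro e_mult_PR[OF k] PR_power y_PR) simp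
    have yp: "?y p \<in> PR n" using y_PR pn .
    have p\<delta>: "pw ?y \<delta> \<in> PR n" using keys_n by (intro pw_y_PR)
    \<comment> \<open>Expanding \<open>0 = d?F\<close>, the summand \<open>d(?y p ^ Suc c)\<close> is the given form up to a unit; the summands from
      \<open>pw ?y \<delta>\<close> contain \<open>?y p\<close> in the coefficient and only smaller indices in the differentials, so they are good.\<close>
    let ?F = "?y p ^ Suc c * pw ?y \<delta>"
    have F: "?F \<in> PR n" using yp p\<delta> by (intro PR_mult PR_power)
    have eqF: "tau (q k) ?F = pw var_poly (single p (Suc c) + \<delta>)"
      by (simp only: tau_simps tau_pw tau_yv pw_add pw_single)
    have "ydeg (single p (Suc c) + \<delta>) = \<mu> k" using p0 ydeg_sum by simp
    then have Fv: "tau (q k) ?F \<in> vord (\<mu> k)"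
      unfolding eqF by (metis pw_var_vord)
    have "pform ?A (?F # ?gs) = \<zero>\<^bsub>\<Lambda>m\<^esub>"
      using y_PR[of 0] k F Fv gs by (intro pform_bump_zero PR_power) auto
    moreover have "pform ?A ([] @ ?F # ?gs)
      = pform (?y p ^ Suc c * ?A) ([] @ pw ?y \<delta> # ?gs) \<oplus>\<^bsub>\<Lambda>m\<^esub> pform (pw ?y \<delta> * ?A) ([] @ ?y p ^ Suc c # ?gs)"
      by (intro pform_slot_mult AP) (use PR_power[OF yp, of "Suc c"] p\<delta> gs in \<open>simp_all del: power_Suc\<close>)
    moreover have "pform (?y p ^ Suc c * ?A) (pw ?y \<delta> # ?gs) \<in> C"
    proof (rule C_slot_pw[OF C y_PR gs])
      show "?y p ^ Suc c * ?A \<in> PR n" by (rule PR_mult[OF PR_power[OF yp] AP])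
      show "keys \<delta> \<subseteq> {..n}" by (rule keys_n)
      fix i assume i: "i \<in> keys \<delta>"
      have in_\<alpha>: "i \<in> keys \<alpha>" "i \<noteq> 0" "i \<noteq> p" using i \<beta> \<delta> by auto
      have i_n: "i \<le> n" using i keys_n by auto
      have ip: "i < p" using le[OF in_\<alpha>(1)] in_\<alpha>(3) by simp
      define \<alpha>' where "\<alpha>' = single p (Suc c) + single 0 a + (\<delta> - single i 1)"
      have \<delta>i: "\<delta> = (\<delta> - single i 1) + single i 1" using i by (rule keys_diff_single)
      have eq: "?y p ^ Suc c * ?A * pw ?y (\<delta> - single i 1) = e k * pw ?y \<alpha>'"
        by (simp only: \<alpha>'_def pw_add pw_single mult_ac)
      have "keys (\<delta> - single i 1) \<subseteq> keys \<delta>"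
        by (auto simp: in_keys_iff lookup_minus)
      then have k\<alpha>': "keys \<alpha>' \<subseteq> {..n}"
        using keys_n pn unfolding \<alpha>'_def
        by (intro order.trans[OF keys_add] Un_least) auto
      have t\<alpha>': "tdeg \<alpha>' = r"
        using \<alpha>(2) arg_cong[OF \<delta>i, of tdeg] by (simp add: \<alpha>_eq \<beta>_eq \<alpha>'_def)
      have y\<alpha>': "ydeg \<alpha>' + 1 = \<mu> k"
        using ydeg_sum arg_cong[OF \<delta>i, of ydeg] p0 in_\<alpha>(2) by (simp add: \<alpha>'_def)
      have pk: "p \<in> keys \<alpha>'"
        by (simp add: \<alpha>'_def in_keys_iff lookup_add)
      have "pform (e k * pw ?y \<alpha>') (map ?y (i # ls)) \<in> C"
      proof (cases "i \<in> set ls")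
        case True
        then show ?thesis using e_mult_PR[OF k pw_y_PR[OF k\<alpha>']] ls i_n by (intro C_repeat[OF C] y_PR) auto
      next
        case False
        have "\<forall>j\<in>set (i # ls). j < p" using ip ls(1) p(2) by fastforce
        moreover have "card (set (i # ls)) = m" using False ls by (subst distinct_card) auto
        ultimately have "good r k \<alpha>' (set (i # ls))"
          using k\<alpha>' t\<alpha>' y\<alpha>' pk ls i_n unfolding good_def by auto
        then show ?thesis using False ls k by (intro gen_list) auto
      qed
      then show "pform (?y p ^ Suc c * ?A * pw ?y (\<delta> - single i 1)) (?y i # ?gs) \<in> C"
        unfolding eq by simp
    qed
    moreover have cl: "pform (pw ?y \<delta> * ?A) (?y p ^ Suc c # ?gs) \<in> carrier \<Lambda>m"
      using gs by (intro pform_closed PR_mult p\<delta> AP) (auto intro!: PR_power yp PR_mult)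
    ultimately have "pform (pw ?y \<delta> * ?A) (?y p ^ Suc c # ?gs) \<in> C"
      using C_zero[OF C] by (intro C_cancel[OF C _ _ cl]) auto
    then have *: "pform (const_poly (of_nat (Suc c)) * (pw ?y \<delta> * ?A * ?y p ^ c)) (?y p # ?gs) \<in> C"
      unfolding pform_slot_power[OF PR_mult[OF p\<delta> AP] yp gs, of c] .
    \<comment> \<open>Division by \<open>c + 1\<close>, which is at most \<open>\<mu> k\<close> by
      \<open>ydeg_sum\<close> and hence invertible.\<close>
    have "pform (pw ?y \<delta> * ?A * ?y p ^ c) (?y p # ?gs) \<in> C"
    proof (rule C_coeff_unscale[OF C _ _ _ _ *])
      show "pw ?y \<delta> * ?A * ?y p ^ c \<in> PR n" by (rule PR_mult[OF PR_mult[OF p\<delta> AP] PR_power[OF yp]])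
      show "set (?y p # ?gs) \<subseteq> PR n" "length (?y p # ?gs) = m" using yp gs by simp_all
    qed (use char[OF k, of "Suc c"] ydeg_sum in simp)
    moreover have "pw ?y \<delta> * ?A * ?y p ^ c = e k * pw ?y \<alpha>"
      by (simp only: \<alpha>_eq \<beta>_eq pw_add pw_single mult_ac)
    ultimately have "pform (e k * pw ?y \<alpha>) (map ?y (p # ls)) \<in> C" by simp
    moreover have "mset (p # ls) = mset ks" by (simp add: split ls_def)
    moreover have "pform (e k * pw ?y \<alpha>) (map ?y (p # ls)) \<in> C \<longleftrightarrow> pform (e k * pw ?y \<alpha>) (map ?y ks) \<in> C"
      using e_mult_PR[OF k pw_y_PR[OF \<alpha>(1)]] ls pn by (intro C_perm[OF C] y_PR) (auto simp: split ls_def)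
    ultimately show ?thesis by blast
  qed
qed

text \<open>Chinese remaindering: modulo \<open>I\<close>, \<open>F\<close> is the sum of the
  \<open>e k * G k\<close>, where \<open>G k\<close> is the Taylor polynomial of \<open>F\<close> at
  the \<open>k\<close>-th point up to order \<open>\<mu> k - 1\<close>, divided by
  \<open>y_0^S\<close>. The division makes up for \<open>e k\<close> being \<open>X_0^S\<close>
  rather than 1 near that point.\<close>

lemma span_all:
  assumes F: "F \<in> PR n" "homogeneous (r + S) F" and js: "set js \<subseteq> {..n}" "length js = m"
    and big: "\<And>k. k \<in> {1..t} \<Longrightarrow> \<mu> k \<le> r"
  shows "pform F (map var_poly js) \<in> C"
proof -
  define low where "low k = {\<alpha> \<in> keys (tau (q k) F). ydeg \<alpha> < \<mu> k}" for k
  have fin: "finite (low k)" for k by (simp add: low_def)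
  let ?c = "\<lambda>k \<alpha>. lookup (tau (q k) F) \<alpha>" and ?s = "single 0 S :: nat \<Rightarrow>\<^sub>0 nat"
  define G where "G k = (\<Sum>\<alpha>\<in>low k. const_poly (?c k \<alpha>) * pw (y k) (\<alpha> - ?s))" for k
  have low: "keys (\<alpha> - ?s) \<subseteq> {..n} \<and> tdeg (\<alpha> - ?s) = r \<and> ydeg (\<alpha> - ?s) < \<mu> k \<and> \<alpha> = (\<alpha> - ?s) + ?s"
    if \<alpha>: "\<alpha> \<in> low k" and k: "k \<in> {1..t}" for \<alpha> k
  proof -
    have key: "\<alpha> \<in> keys (tau (q k) F)" "ydeg \<alpha> < \<mu> k" using \<alpha> by (auto simp: low_def)
    have "tdeg \<alpha> = r + S" using key homogeneous_tau[OF F(2)] by (auto simp: homogeneous_tdeg)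
    \<comment> \<open>A term of total degree \<open>r + S\<close> and local degree below
      \<open>\<mu> k \<le> r\<close> contains \<open>y_0\<close> at least \<open>S\<close> times, so
      the division in \<open>G\<close> is exact.\<close>
    then have "S \<le> lookup \<alpha> 0" using tdeg_ydeg[of \<alpha>] big[OF k] key by simp
    then have eq: "\<alpha> = (\<alpha> - ?s) + ?s"
      by (intro poly_mapping_eqI) (auto simp: lookup_add lookup_minus lookup_single when_def)
    moreover have "keys (\<alpha> - ?s) \<subseteq> keys \<alpha>" by (auto simp: in_keys_iff lookup_minus)
    moreover have "keys \<alpha> \<subseteq> {..n}" using tau_PR[OF F(1), of "q k"] key unfolding PR_iff by auto
    moreover have "tdeg (\<alpha> - ?s) = r" using \<open>tdeg \<alpha> = r + S\<close> arg_cong[OF eq, of tdeg] by simp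
    moreover have "ydeg (\<alpha> - ?s) < \<mu> k" using key arg_cong[OF eq, of ydeg] by simp
    ultimately show ?thesis by blast
  qed
  have GP: "G k \<in> PR n" if "k \<in> {1..t}" for k
    unfolding G_def using low that by (intro PR_sum PR_mult PR_const pw_y_PR) auto
  have diff: "F - (\<Sum>k\<in>{1..t}. e k * G k) \<in> I"
    unfolding I_iff
  proof safe
    show "F - (\<Sum>k\<in>{1..t}. e k * G k) \<in> PR n" using F GP by (intro PR_diff PR_sum e_mult_PR)
    fix k assume k: "k \<in> {1..t}"
    have y0: "tau (q k) (y k 0) = var_poly 0" by (simp add: tau_yv)
    have "F = (\<Sum>\<alpha>\<in>keys (tau (q k) F). const_poly (?c k \<alpha>) * pw (y k) \<alpha>)" by (rule y_expansion)
    also have "\<dots> = (\<Sum>\<alpha>\<in>low k. const_poly (?c k \<alpha>) * pw (y k) \<alpha>)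
        + (\<Sum>\<alpha>\<in>keys (tau (q k) F) - low k. const_poly (?c k \<alpha>) * pw (y k) \<alpha>)"
      by (subst add.commute, intro sum.subset_diff) (auto simp: low_def)
    also have "(\<Sum>\<alpha>\<in>low k. const_poly (?c k \<alpha>) * pw (y k) \<alpha>) = y k 0 ^ S * G k"
      unfolding G_def sum_distrib_left
    proof (intro sum.cong refl)
      fix \<alpha> assume "\<alpha> \<in> low k"
      then have "pw (y k) \<alpha> = pw (y k) (\<alpha> - ?s) * y k 0 ^ S"
        using low k by (metis pw_add pw_single)
      then show "const_poly (?c k \<alpha>) * pw (y k) \<alpha> = y k 0 ^ S * (const_poly (?c k \<alpha>) * pw (y k) (\<alpha> - ?s))"
        by (simp add: mult_ac)
    qed
    finally have "tau (q k) F = tau (q k) (y k 0 ^ S * G k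
        + (\<Sum>\<alpha>\<in>keys (tau (q k) F) - low k. const_poly (?c k \<alpha>) * pw (y k) \<alpha>))" by simp
    also have "\<dots> = var_poly 0 ^ S * tau (q k) (G k)
        + (\<Sum>\<alpha>\<in>keys (tau (q k) F) - low k. const_poly (?c k \<alpha>) * pw var_poly \<alpha>)"
      by (simp only: tau_simps y0 tau_sum tau_pw tau_yv)
    finally have "tau (q k) F - var_poly 0 ^ S * tau (q k) (G k)
        = (\<Sum>\<alpha>\<in>keys (tau (q k) F) - low k. const_poly (?c k \<alpha>) * pw var_poly \<alpha>)"
      by (rule diff_eqI)
    also have "\<dots> \<in> vord (\<mu> k)"
      by (intro vord_sum vord_mult_left vord_mono[OF pw_var_vord]) (auto simp: low_def)
    finally have 1: "tau (q k) F - var_poly 0 ^ S * tau (q k) (G k) \<in> vord (\<mu> k)" .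
    have 2: "(tau (q k) (e k) - var_poly 0 ^ S) * tau (q k) (G k) \<in> vord (\<mu> k)"
      using wk[OF k] by (rule vord_mult_right)
    have 3: "(\<Sum>l\<in>{1..t} - {k}. tau (q k) (e l * G l)) \<in> vord (\<mu> k)"
      using wl k by (intro vord_sum) (auto simp: tau_simps intro!: vord_mult_right)
    have "(\<Sum>l\<in>{1..t}. tau (q k) (e l * G l)) = tau (q k) (e k * G k) + (\<Sum>l\<in>{1..t} - {k}. tau (q k) (e l * G l))"
      using k by (intro sum.remove) auto
    \<comment> \<open>Three errors remain at the \<open>k\<close>-th point: the Taylor remainder,
      the deviation of \<open>e k\<close> from \<open>X_0^S\<close>, and the contributions of the
      other points.\<close>
    then have "tau (q k) (F - (\<Sum>k\<in>{1..t}. e k * G k)) = (tau (q k) F - var_poly 0 ^ S * tau (q k) (G k))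
        - (tau (q k) (e k) - var_poly 0 ^ S) * tau (q k) (G k) - (\<Sum>l\<in>{1..t} - {k}. tau (q k) (e l * G l))"
      unfolding tau_simps(2) tau_sum by (simp add: tau_simps(4) algebra_simps)
    then show "tau (q k) (F - (\<Sum>k\<in>{1..t}. e k * G k)) \<in> vord (\<mu> k)"
      using vord_diff[OF vord_diff[OF 1 2] 3] by simp
  qed
  have js_PR: "set (map var_poly js) \<subseteq> PR n" using js PR_var by auto
  have "pform F (map var_poly js) = pform (\<Sum>k\<in>{1..t}. e k * G k) (map var_poly js)"
    using F diff GP by (intro pform_cong PR_sum e_mult_PR)
  also have "\<dots> \<in> C"
  proof (rule C_coeff_sum[OF C])
    fix k assume k: "k \<in> {1..t}"
    show "e k * G k \<in> PR n" using e_PR[OF k] GP[OF k] by (rule PR_mult)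
    have "pform (\<Sum>\<alpha>\<in>low k. const_poly (?c k \<alpha>) * (e k * pw (y k) (\<alpha> - ?s))) (map var_poly js) \<in> C"
    proof (rule C_coeff_sum[OF C fin])
      fix \<alpha> assume \<alpha>: "\<alpha> \<in> low k"
      have eP: "e k * pw (y k) (\<alpha> - ?s) \<in> PR n" using low[OF \<alpha> k] by (intro e_mult_PR[OF k] pw_y_PR) auto
      then show "const_poly (?c k \<alpha>) * (e k * pw (y k) (\<alpha> - ?s)) \<in> PR n" by (rule PR_mult[OF PR_const])
      \<comment> \<open>The differentials \<open>dX_j\<close> are expanded in the local coordinates
        of this particular point.\<close>
      have "pform (e k * pw (y k) (\<alpha> - ?s)) (map (y k) [] @ map var_poly js) \<in> C"
      proof (rule C_slots_change[OF C eP y_PR, where c = "\<lambda>j. if j = 0 then 0 else q k j"])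
        show "var_poly j = y k j + const_poly (if j = 0 then 0 else q k j) * y k 0" for j
          by (simp add: yv_def const_poly_simps)
        show "pform (e k * pw (y k) (\<alpha> - ?s)) (map (y k) ks) \<in> C" if "set ks \<subseteq> {..n}" "length ks = m" for ks
          using k that low[OF \<alpha> k] by (intro span_local) auto
      qed (use js in simp_all)
      then show "pform (const_poly (?c k \<alpha>) * (e k * pw (y k) (\<alpha> - ?s))) (map var_poly js) \<in> C"
        using eP js js_PR by (intro C_coeff_scale[OF C]) auto
    qed (use js js_PR in auto)
    moreover have "(\<Sum>\<alpha>\<in>low k. const_poly (?c k \<alpha>) * (e k * pw (y k) (\<alpha> - ?s))) = e k * G k"
      unfolding G_def sum_distrib_left by (intro sum.cong refl) (simp add: mult_ac)
    ultimately show "pform (e k * G k) (map var_poly js) \<in> C" by simp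
  qed (use js js_PR in auto)
  finally show ?thesis .
qed

end

section \<open>Functionals separating the generators\<close>

lemma jac_transpose_zero:
  assumes "length (x # as @ x # bs) = length L"
  shows "jac L (x # as @ x # bs) = 0"
proof -
  have "jac L ([] @ x # as @ x # bs) = 0"
  proof (rule alternating_lists[where C = UNIV and m = "length L"])
    show "jac L (as @ x # y # bs) = - jac L (as @ y # x # bs)" if "length (as @ x # y # bs) = length L"
      for as x y bs using that by (rule jac_swap)
    show "jac L (as @ x # x # bs) = 0" if "length (as @ x # x # bs) = length L"
      for as x bs using that by (rule jac_alt)
  qed (use assms in auto)
  then show ?thesis by simp
qed

text \<open>Needed for the Leibniz rule of \<open>dF dG_1 ... dG_m\<close> in a slot: expanding
  \<open>d(x f) dy + d(y f) dx\<close> leaves the cross terms \<open>f (dx dy + dy dx)\<close>, with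
  one entry in front and the other at an arbitrary place.\<close>

lemma jac_swap_first:
  assumes "length (x # as @ z # bs) = length L"
  shows "jac L (x # as @ z # bs) + jac L (z # as @ x # bs) = 0"
proof -
  have "0 = jac L ((x + z) # as @ (x + z) # bs)" using assms by (intro jac_transpose_zero[symmetric]) simp
  also have "\<dots> = jac L (x # as @ (x + z) # bs) + jac L (z # as @ (x + z) # bs)"
    using jac_add[of "[]" x "as @ (x + z) # bs" L z] assms by simp
  also have "jac L (x # as @ (x + z) # bs) = jac L (x # as @ x # bs) + jac L (x # as @ z # bs)"
    using jac_add[of "x # as" x bs L z] assms by simp
  also have "jac L (z # as @ (x + z) # bs) = jac L (z # as @ x # bs) + jac L (z # as @ z # bs)"
    using jac_add[of "z # as" x bs L z] assms by simp
  also have "jac L (x # as @ x # bs) = 0" using assms by (intro jac_transpose_zero) simp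
  also have "jac L (z # as @ z # bs) = 0" using assms by (intro jac_transpose_zero) simp
  finally show ?thesis by simp
qed

context fat begin

lemma pmultider_jac:
  assumes k: "k \<in> {1..t}" and L: "length L = m" and \<gamma>: "ydeg \<gamma> < \<mu> k" "ydeg \<gamma> + 2 \<le> \<mu> k \<or> L = [0]"
  shows "pmultider n m I (\<lambda>F Gs. lookup (tau (q k) F * jac L (map (tau (q k)) Gs)) \<gamma>)"
    (is "pmultider n m I ?\<psi>")
proof (intro pmultider.intro pmultider_axioms.intro coord_axioms, goal_cases)
  case (1 f f' gs)
  then show ?case by (simp add: tau_simps distrib_right lookup_add)
next
  case (2 c f gs)
  then show ?case by (simp add: tau_simps mult.assoc coeff_const_mult)
next
  case (3 f as x y bs)
  then show ?case using L by (simp add: tau_simps jac_add distrib_left lookup_add)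
next
  case (4 f as x y bs)
  then show ?case using L by (simp add: tau_simps jac_mult distrib_left lookup_add mult_ac)
next
  case (5 f as c bs)
  then show ?case using L by (simp add: tau_simps jac_const)
next
  case (6 f as x bs)
  then show ?case using L by (simp add: jac_alt)
next
  case (7 f gs)
  then have "tau (q k) f \<in> vord (\<mu> k)" using k by (simp add: I_iff)
  then have "tau (q k) f * jac L (map (tau (q k)) gs) \<in> vord (\<mu> k)" by (rule vord_mult_right)
  then show ?case using \<gamma>(1) by (rule vord_lookup)
next
  case (8 f as x bs)
  then have x: "tau (q k) x \<in> vord (\<mu> k)" using k by (simp add: I_iff)
  show ?case
  proof (cases "L = [0]")
    case True
    then have "as = []" "bs = []" using L 8 by auto
    moreover have "jac [0] [tau (q k) x] = pderiv_mpoly 0 (tau (q k) x)"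
      by (subst jac_Cons) (simp_all add: jac_def)
    ultimately have "tau (q k) f * jac L (map (tau (q k)) (as @ x # bs)) \<in> vord (\<mu> k)"
      using True x by (simp add: vord_mult_left vord_pd0)
    then show ?thesis using \<gamma>(1) by (rule vord_lookup)
  next
    case False
    have "jac L (map (tau (q k)) as @ tau (q k) x # map (tau (q k)) bs) \<in> vord (\<mu> k - 1)"
      using x 8 L by (intro jac_vord) auto
    then have "tau (q k) f * jac L (map (tau (q k)) (as @ x # bs)) \<in> vord (\<mu> k - 1)"
      by (simp add: vord_mult_left)
    then show ?thesis by (rule vord_lookup) (use False \<gamma> in auto)
  qed
qed

text \<open>These are the coefficients of the exterior derivative of \<open>F dG_1 ... dG_m\<close>.
  The coefficient \<open>F\<close> now also loses one order, hence the bound on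
  \<open>\<gamma>\<close>; in exchange, terms of order \<open>\<mu> k - 1\<close> in
  \<open>F\<close> become visible.\<close>

lemma pmultider_jac_Cons:
  assumes k: "k \<in> {1..t}" and L: "length L = Suc m" and \<gamma>: "ydeg \<gamma> + 1 < \<mu> k"
  shows "pmultider n m I (\<lambda>F Gs. lookup (jac L (map (tau (q k)) (F # Gs))) \<gamma>)"
proof (intro pmultider.intro pmultider_axioms.intro coord_axioms, goal_cases)
  case (1 f f' gs)
  then show ?case
    using L jac_add[of "[]" "tau (q k) f" "map (tau (q k)) gs" L "tau (q k) f'"] by (simp add: tau_simps lookup_add)
next
  case (2 c f gs)
  then show ?case
    using L jac_mult[of "[]" "const_poly c" "map (tau (q k)) gs" L "tau (q k) f"]
      jac_const[of "[]" "map (tau (q k)) gs" L c]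
    by (simp add: tau_simps lookup_add coeff_const_mult)
next
  case (3 f as x y bs)
  then show ?case
    using L jac_add[of "tau (q k) f # map (tau (q k)) as" "tau (q k) x" "map (tau (q k)) bs" L "tau (q k) y"]
    by (simp add: tau_simps lookup_add)
next
  case (4 f as x y bs)
  let ?t = "tau (q k)"
  let ?j = "\<lambda>u v. jac L (u # map ?t as @ v # map ?t bs)"
  have *: "?j f1 (x1 * y1) = x1 * ?j f1 y1 + y1 * ?j f1 x1" for f1 x1 y1
    using L 4 jac_mult[of "f1 # map ?t as" x1 "map ?t bs" L y1] by simp
  have **: "?j (x1 * f1) y1 = x1 * ?j f1 y1 + f1 * ?j x1 y1" for f1 x1 y1
    using L 4 jac_mult[of "[]" x1 "map ?t as @ y1 # map ?t bs" L f1] by simp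
  have sw: "?j (?t x) (?t y) + ?j (?t y) (?t x) = 0" using L 4 by (intro jac_swap_first) simp
  have "?t f * ?j (?t x) (?t y) + ?t f * ?j (?t y) (?t x) = 0"
    using sw by (simp add: distrib_left[symmetric])
  then have "?j (?t f) (?t x * ?t y) = ?j (?t x * ?t f) (?t y) + ?j (?t y * ?t f) (?t x)"
    unfolding * ** by (simp add: algebra_simps)
  then show ?case by (simp add: tau_simps lookup_add[symmetric])
next
  case (5 f as c bs)
  then show ?case
    using L jac_const[of "tau (q k) f # map (tau (q k)) as" "map (tau (q k)) bs" L c] by (simp add: tau_simps)
next
  case (6 f as x bs)
  then show ?case
    using L jac_alt[of "tau (q k) f # map (tau (q k)) as" "tau (q k) x" "map (tau (q k)) bs" L] by simp
next
  case (7 f gs)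
  then have "tau (q k) f \<in> vord (\<mu> k)" using k by (simp add: I_iff)
  then have "jac L ([] @ tau (q k) f # map (tau (q k)) gs) \<in> vord (\<mu> k - 1)" using 7 L by (intro jac_vord) auto
  then have "jac L (map (tau (q k)) (f # gs)) \<in> vord (\<mu> k - 1)" by simp
  then show ?case by (rule vord_lookup) (use \<gamma> in simp)
next
  case (8 f as x bs)
  then have "tau (q k) x \<in> vord (\<mu> k)" using k by (simp add: I_iff)
  then have "jac L ((tau (q k) f # map (tau (q k)) as) @ tau (q k) x # map (tau (q k)) bs) \<in> vord (\<mu> k - 1)"
    using 8 L by (intro jac_vord) auto
  then have "jac L (map (tau (q k)) (f # as @ x # bs)) \<in> vord (\<mu> k - 1)" by simp
  then show ?case by (rule vord_lookup) (use \<gamma> in simp)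
qed

end

section \<open>Values of Jacobian minors on the coordinate functions\<close>

lemma sorted_remove:
  assumes "sorted_wrt (<) L" "b < length L"
  shows "take b L @ drop (Suc b) L = sorted_list_of_set (set L - {L ! b})" and "sorted_wrt (<) (take b L @ drop (Suc b) L)"
proof -
  have L: "L = take b L @ L ! b # drop (Suc b) L" using assms by (simp add: id_take_nth_drop[symmetric])
  have s: "sorted_wrt (<) (take b L @ L ! b # drop (Suc b) L)" using assms(1) L by simp
  then show s': "sorted_wrt (<) (take b L @ drop (Suc b) L)" by (simp add: sorted_wrt_append)
  have "set L = insert (L ! b) (set (take b L @ drop (Suc b) L))" by (subst L) auto
  moreover have "L ! b \<notin> set (take b L @ drop (Suc b) L)" using s by (auto simp: sorted_wrt_append)
  ultimately have "set L - {L ! b} = set (take b L @ drop (Suc b) L)" by auto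
  then show "take b L @ drop (Suc b) L = sorted_list_of_set (set L - {L ! b})"
    using s' by (metis sorted_list_of_set.idem_if_sorted_distinct strict_sorted_iff)
qed

lemma jac_var_sets:
  assumes "finite J" "finite J'" "card J = card J'"
  shows "jac (sorted_list_of_set J) (map var_poly (sorted_list_of_set J')) = (if J = J' then 1 else 0)"
proof -
  have "sorted_list_of_set J = sorted_list_of_set J' \<longleftrightarrow> J = J'"
    using assms(1,2) by (metis set_sorted_list_of_set)
  then show ?thesis using jac_vars[of "sorted_list_of_set J" "sorted_list_of_set J'"] assms by simp
qed

text \<open>The coefficient of \<open>dX_L\<close> in \<open>dF dX_J\<close>. At most one summand
  survives, the one that removes from \<open>L\<close> the single index missing in
  \<open>J\<close>.\<close>

lemma jac_dvar_sets:
  fixes F :: "'k::comm_ring_1 mpoly"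
  assumes "finite L" "finite J" "card L = Suc (card J)"
  shows "jac (sorted_list_of_set L) (F # map var_poly (sorted_list_of_set J)) =
    (\<Sum>b<card L. if J = L - {sorted_list_of_set L ! b} then (- 1) ^ b * pderiv_mpoly (sorted_list_of_set L ! b) F else 0)"
proof -
  let ?L = "sorted_list_of_set L"
  have "jac ?L (F # map var_poly (sorted_list_of_set J)) =
      (\<Sum>b<length ?L. (- 1) ^ b * pderiv_mpoly (?L ! b) F * jac (take b ?L @ drop (Suc b) ?L) (map var_poly (sorted_list_of_set J)))"
    using assms by (intro jac_Cons) simp
  also have "\<dots> = (\<Sum>b<card L. if J = L - {?L ! b} then (- 1) ^ b * pderiv_mpoly (?L ! b) F else 0)"
  proof (intro sum.cong)
    fix b assume "b \<in> {..<card L}"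
    then have b: "b < length ?L" by simp
    have "?L ! b \<in> L" using nth_mem[OF b] assms by simp
    then have c: "card (L - {?L ! b}) = card J" using assms by simp
    have "jac (take b ?L @ drop (Suc b) ?L) (map var_poly (sorted_list_of_set J))
        = (if L - {?L ! b} = J then 1 else (0 :: 'k mpoly))"
      using sorted_remove(1)[OF _ b] assms jac_var_sets[of "L - {?L ! b}" J] c by simp
    then show "(- 1) ^ b * pderiv_mpoly (?L ! b) F * jac (take b ?L @ drop (Suc b) ?L) (map var_poly (sorted_list_of_set J))
        = (if J = L - {?L ! b} then (- 1) ^ b * pderiv_mpoly (?L ! b) F else 0)" by auto
  qed simp
  finally show ?thesis .
qed

section \<open>Dual functionals for the surviving generators\<close>

context bumps begin

text \<open>The functionals dual to generators of type 1 may also be nonzero on generators of type 0, but not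
  conversely.\<close>

definition deg_type :: "nat \<Rightarrow> (nat \<Rightarrow>\<^sub>0 nat) \<Rightarrow> nat set \<Rightarrow> nat" where
  "deg_type k \<alpha> J = (if ydeg \<alpha> + 1 = \<mu> k \<and> J \<noteq> {0} then 1 else 0)"

lemma good_finite: "good r k \<alpha> J \<Longrightarrow> finite J"
  unfolding good_def using finite_subset by blast

abbreviation "jac_form k \<gamma> L \<equiv> (\<lambda>F Gs. lookup (tau (q k) F * jac L (map (tau (q k)) Gs)) \<gamma>)"
abbreviation "jac_dform k \<gamma> L \<equiv> (\<lambda>F Gs. lookup (jac L (map (tau (q k)) (F # Gs))) \<gamma>)"

lemma jac_form_other:
  assumes "tau (q k) F \<in> vord (\<mu> k)" "ydeg \<gamma> < \<mu> k"
  shows "jac_form k \<gamma> L F Gs = 0"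
  using vord_lookup[OF vord_mult_right[OF assms(1)] assms(2)] by simp

lemma jac_dform_other:
  assumes "tau (q k) F \<in> vord (\<mu> k)" "ydeg \<gamma> + 1 < \<mu> k" "length L = Suc (length Gs)"
  shows "jac_dform k \<gamma> L F Gs = 0"
  using vord_lookup[OF jac_vord[of "[]" "tau (q k) F" "map (tau (q k)) Gs" L "\<mu> k"], of \<gamma>] assms by simp

text \<open>Near its own point a generator has a monomial as coefficient, up to a remainder
  \<open>Q\<close> that the functionals do not see because they read orders below
  \<open>\<mu> k\<close>.\<close>

lemma tau_gen_same:
  assumes "k \<in> {1..t}"
  obtains Q where "Q \<in> vord (\<mu> k)"
    "tau (q k) (e k * pw (y k) \<alpha>) = single (\<alpha> + single 0 S) 1 + Q"
proof (rule that)
  let ?Q = "(tau (q k) (e k) - var_poly 0 ^ S) * pw var_poly \<alpha>"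
  show "?Q \<in> vord (\<mu> k)" using wk[OF assms] by (rule vord_mult_right)
  show "tau (q k) (e k * pw (y k) \<alpha>) = single (\<alpha> + single 0 S) 1 + ?Q"
    by (simp add: single_const_pw const_poly_simps pw_add tau_simps tau_pw tau_yv algebra_simps)
qed

lemma tau_gen_other:
  assumes "k \<in> {1..t}" "l \<in> {1..t}" "l \<noteq> k"
  shows "tau (q k) (e l * pw (y l) \<alpha>) \<in> vord (\<mu> k)"
  unfolding tau_simps using wl[OF assms(2,1)] assms(3) by (auto intro!: vord_mult_right)

lemma map_tau_y: "map (tau (q k)) (map (y k) js) = map var_poly js"
  by (simp add: tau_yv)

text \<open>Reading the coefficient of \<open>X_0^S X^\<alpha> dX_J\<close> yields a functional dual
  to the generator in the strict sense: it vanishes on all others, of either type.\<close>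

lemma ex_dual_jac:
  assumes k: "k \<in> {1..t}" and g: "good r k \<alpha> J" "deg_type k \<alpha> J = 0"
  shows "\<exists>\<psi>. pmultider n m I \<psi> \<and> (\<forall>l\<in>{1..t}. \<forall>\<beta> K. good r l \<beta> K \<longrightarrow>
    \<psi> (e l * pw (y l) \<beta>) (map (y l) (sorted_list_of_set K)) = (if l = k \<and> \<beta> = \<alpha> \<and> K = J then 1 else 0))"
proof (intro exI conjI ballI allI impI)
  let ?\<gamma> = "\<alpha> + single 0 S" and ?L = "sorted_list_of_set J"
  have card: "card J = m" using g by (simp add: good_def)
  \<comment> \<open>Type 0 in the top local degree occurs for \<open>J = {0}\<close> only, where the
    second alternative of \<open>pmultider_jac\<close> applies.\<close>
  have \<gamma>: "ydeg ?\<gamma> < \<mu> k" "ydeg ?\<gamma> + 2 \<le> \<mu> k \<or> ?L = [0]"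
    using g mu[OF k] unfolding good_def deg_type_def by (auto split: if_splits)
  show "pmultider n m I (jac_form k ?\<gamma> ?L)" using k \<gamma> card by (intro pmultider_jac) auto
  fix l \<beta> K assume l: "l \<in> {1..t}" and gl: "good r l \<beta> K"
  let ?F = "e l * pw (y l) \<beta>" and ?Gs = "map (y l) (sorted_list_of_set K)"
  show "jac_form k ?\<gamma> ?L ?F ?Gs = (if l = k \<and> \<beta> = \<alpha> \<and> K = J then 1 else 0)"
  proof (cases "l = k")
    case False
    then show ?thesis using tau_gen_other[OF k l False] \<gamma>(1) by (subst jac_form_other) auto
  next
    case True
    obtain Q where Q: "Q \<in> vord (\<mu> k)"
      "tau (q k) (e k * pw (y k) \<beta>) = single (\<beta> + single 0 S) 1 + Q"
      using k by (rule tau_gen_same)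
    have Q0: "lookup (Q * G) ?\<gamma> = 0" for G
      using vord_lookup[OF vord_mult_right[OF Q(1)] \<gamma>(1)] .
    have j: "jac ?L (map (tau (q k)) ?Gs) = (if J = K then 1 else 0)"
      unfolding True map_tau_y using good_finite[OF g(1)] good_finite[OF gl] g gl
      by (intro jac_var_sets) (auto simp: good_def)
    show ?thesis
      unfolding True Q(2) j[unfolded True] distrib_right lookup_add Q0
      by (auto simp: lookup_single when_def)
  qed
qed

text \<open>The functional reads the leading term of \<open>d(y^\<alpha> dy_J)\<close>, in which the
  largest variable \<open>y_p\<close> of \<open>y^\<alpha>\<close> becomes a differential. Another
  generator \<open>y^\<beta> dy_K\<close> at this point has the same term only if it arises by
  trading \<open>p\<close> for some \<open>l\<close> in \<open>J\<close>:
  \<open>\<beta> = \<alpha> - p + l\<close>, and \<open>K\<close> is \<open>J\<close> with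
  \<open>l\<close> replaced by \<open>p\<close>. In the top local degree such a generator does not
  survive, since no variable of \<open>y^\<beta>\<close> exceeds \<open>p\<close>. For
  \<open>l = 0\<close> the local degree drops and the generator has type 0, so the system is
  triangular rather than diagonal.\<close>

lemma ex_dual_jac_Cons:
  assumes k: "k \<in> {1..t}" and g: "good r k \<alpha> J" "deg_type k \<alpha> J = 1"
  shows "\<exists>\<psi>. pmultider n m I \<psi>
    \<and> \<psi> (e k * pw (y k) \<alpha>) (map (y k) (sorted_list_of_set J)) \<noteq> 0
    \<and> (\<forall>l\<in>{1..t}. \<forall>\<beta> K. good r l \<beta> K \<longrightarrow> \<psi> (e l * pw (y l) \<beta>) (map (y l) (sorted_list_of_set K)) \<noteq> 0
        \<longrightarrow> (l = k \<and> \<beta> = \<alpha> \<and> K = J) \<or> deg_type l \<beta> K = 0)"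
proof -
  have yd: "ydeg \<alpha> + 1 = \<mu> k" "J \<noteq> {0}" using g(2) by (auto simp: deg_type_def split: if_splits)
  have card: "card J = m" using g by (simp add: good_def)
  then have Jne: "J \<noteq> {}" using m by auto
  obtain i where i: "i \<in> keys \<alpha>" "\<And>j. j \<in> J \<Longrightarrow> j < i" using g yd by (auto simp: good_def)
  define p where "p = Max (keys \<alpha>)"
  have "keys \<alpha> \<noteq> {}" using i by auto
  then have p: "p \<in> keys \<alpha>" and pmax: "\<And>j. j \<in> keys \<alpha> \<Longrightarrow> j \<le> p"
    by (auto simp: p_def)
  have Jp: "j < p" if "j \<in> J" for j using i(2)[OF that] pmax[OF i(1)] by simp
  then have pJ: "p \<notin> J" by auto
  have p0: "p \<noteq> 0" using Jne Jp by auto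
  \<comment> \<open>The exponent of the leading term after differentiating by \<open>y_p\<close>;
    \<open>single 0 S\<close> comes from \<open>e k\<close>.\<close>
  define \<gamma> where "\<gamma> = \<alpha> - single p 1 + single 0 S"
  have \<alpha>_eq: "\<alpha> = \<alpha> - single p 1 + single p 1" using p by (rule keys_diff_single)
  have "ydeg (\<alpha> - single p 1) + 1 = ydeg \<alpha>" using arg_cong[OF \<alpha>_eq, of ydeg] p0 by simp
  then have yg: "ydeg \<gamma> + 1 < \<mu> k" using yd by (simp add: \<gamma>_def)
  have shift: "\<gamma> + single p 1 = \<alpha> + single 0 S"
    unfolding \<gamma>_def by (subst (2) \<alpha>_eq) (simp only: add_ac)
  define Ls where "Ls = insert p J"
  have Ls: "finite Ls" "card Ls = Suc m" using good_finite[OF g(1)] pJ card by (auto simp: Ls_def)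
  let ?L = "sorted_list_of_set Ls"
  let ?\<psi> = "jac_dform k \<gamma> ?L"
  have val: "?\<psi> (e k * pw (y k) \<beta>) (map (y k) (sorted_list_of_set K)) =
      (\<Sum>b<Suc m. if K = Ls - {?L ! b} then (- 1) ^ b *
        (if \<beta> + single 0 S = \<gamma> + single (?L ! b) 1
         then of_nat (lookup (\<beta> + single 0 S) (?L ! b)) else 0) else 0)"
    if gl: "good r k \<beta> K" for \<beta> K
  proof -
    have cK: "card K = m" "finite K" using gl good_finite by (auto simp: good_def)
    let ?\<beta> = "\<beta> + single 0 S"
    obtain Q where Q: "Q \<in> vord (\<mu> k)" "tau (q k) (e k * pw (y k) \<beta>) = single ?\<beta> 1 + Q"
      using k by (rule tau_gen_same)
    have "?\<psi> (e k * pw (y k) \<beta>) (map (y k) (sorted_list_of_set K))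
        = lookup (jac ?L ([] @ (single ?\<beta> 1 + Q) # map var_poly (sorted_list_of_set K))) \<gamma>"
      by (simp only: list.map(2) Q(2) map_tau_y append.simps)
    also have "\<dots> = lookup (jac ?L (single ?\<beta> 1 # map var_poly (sorted_list_of_set K))) \<gamma>
        + lookup (jac ?L ([] @ Q # map var_poly (sorted_list_of_set K))) \<gamma>"
      using Ls cK by (subst jac_add) (simp_all add: lookup_add)
    also have "lookup (jac ?L ([] @ Q # map var_poly (sorted_list_of_set K))) \<gamma> = 0"
      using Q(1) yg Ls cK by (intro vord_lookup[OF jac_vord[OF _ Q(1)]]) auto
    also have "jac ?L (single ?\<beta> 1 # map var_poly (sorted_list_of_set K)) =
        (\<Sum>b<card Ls. if K = Ls - {?L ! b} then (- 1) ^ b * pderiv_mpoly (?L ! b) (single ?\<beta> (1::'k)) else 0)"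
      using Ls cK by (intro jac_dvar_sets) auto
    finally have *: "?\<psi> (e k * pw (y k) \<beta>) (map (y k) (sorted_list_of_set K)) =
        (\<Sum>b<Suc m. if K = Ls - {?L ! b} then lookup ((- 1) ^ b * pderiv_mpoly (?L ! b) (single ?\<beta> (1::'k))) \<gamma> else 0)"
      unfolding Ls(2) by (simp add: lookup_sum if_distrib[of "\<lambda>x. lookup x \<gamma>"] cong: if_cong del: sum.lessThan_Suc list.map)
    have co: "lookup ((- 1) ^ b * pderiv_mpoly c (single ?\<beta> (1::'k))) \<gamma>
        = (- 1) ^ b * (if ?\<beta> = \<gamma> + single c 1 then of_nat (lookup ?\<beta> c) else 0)" for b c
    proof -
      have "(- 1) ^ b = (const_poly ((- 1) ^ b) :: 'k mpoly)"
        by (induction b) (simp_all add: const_poly_simps)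
      then have "lookup ((- 1) ^ b * pderiv_mpoly c (single ?\<beta> (1::'k))) \<gamma>
          = (- 1) ^ b * lookup (pderiv_mpoly c (single ?\<beta> (1::'k))) \<gamma>"
        by (simp only: coeff_const_mult)
      also have "lookup (pderiv_mpoly c (single ?\<beta> (1::'k))) \<gamma>
          = (if ?\<beta> = \<gamma> + single c 1 then of_nat (lookup ?\<beta> c) else 0)"
      proof (cases "c \<in> keys ?\<beta>")
        case True
        then have "?\<beta> - single c 1 = \<gamma> \<longleftrightarrow> ?\<beta> = \<gamma> + single c 1"
          using keys_diff_single[OF True] by (metis add_diff_cancel_right')
        then show ?thesis by (simp add: pd_single lookup_single when_def)
      next
        case False
        have "?\<beta> \<noteq> \<gamma> + single c 1"
        proof
          assume eq: "?\<beta> = \<gamma> + single c 1"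
          have "lookup ?\<beta> c = lookup \<gamma> c + 1" unfolding eq by (simp add: lookup_add)
          then show False using False by (simp add: in_keys_iff)
        qed
        then show ?thesis using False by (simp add: pd_single in_keys_iff)
      qed
      finally show ?thesis .
    qed
    show ?thesis unfolding * co by (rule refl)
  qed
  have pm: "pmultider n m I ?\<psi>" using k Ls yg by (intro pmultider_jac_Cons) auto
  have nth_in: "?L ! b \<in> Ls" if "b < Suc m" for b
    using nth_mem[of b ?L] that Ls by simp
  have nonzero: "?\<psi> (e k * pw (y k) \<alpha>) (map (y k) (sorted_list_of_set J)) \<noteq> 0"
  proof -
    have "p \<in> set ?L" unfolding set_sorted_list_of_set[OF Ls(1)] by (simp add: Ls_def)
    then obtain b0 where b0: "b0 < Suc m" "?L ! b0 = p" using Ls by (metis in_set_conv_nth length_sorted_list_of_set)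
    have eq: "J = Ls - {?L ! b} \<longleftrightarrow> b = b0" if "b < Suc m" for b
    proof
      assume J: "J = Ls - {?L ! b}"
      have "p \<notin> Ls - {?L ! b}" using pJ unfolding J[symmetric] .
      then have "?L ! b = p" by (simp add: Ls_def)
      then show "b = b0" using nth_eq_iff_index_eq[of ?L b b0] b0 that Ls by simp
    next
      assume "b = b0"
      then show "J = Ls - {?L ! b}" using b0 pJ by (auto simp: Ls_def)
    qed
    have "?\<psi> (e k * pw (y k) \<alpha>) (map (y k) (sorted_list_of_set J)) =
      (\<Sum>b<Suc m. if b = b0 then (- 1) ^ b * of_nat (lookup (\<alpha> + single 0 S) p) else 0)"
      unfolding val[OF g(1)]
    proof (intro sum.cong refl)
      fix b assume "b \<in> {..<Suc m}"
      then have iff: "J = Ls - {?L ! b} \<longleftrightarrow> b = b0" using eq by blast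
      show "(if J = Ls - {?L ! b} then (- 1) ^ b *
          (if \<alpha> + single 0 S = \<gamma> + single (?L ! b) 1
           then of_nat (lookup (\<alpha> + single 0 S) (?L ! b)) else 0) else 0)
        = (if b = b0 then (- 1) ^ b * of_nat (lookup (\<alpha> + single 0 S) p) else 0)"
        unfolding iff using b0(2) shift by (cases "b = b0") simp_all
    qed
    also have "\<dots> = (- 1) ^ b0 * of_nat (lookup \<alpha> p)"
      using b0 p0 by (simp add: lookup_add lookup_single)
    \<comment> \<open>The value is, up to sign, the exponent of \<open>y_p\<close> in
      \<open>y^\<alpha>\<close>, a number between 1 and \<open>\<mu> k\<close>; the characteristic
      enters here too.\<close>
    also have "\<dots> \<noteq> 0"
    proof -
      have "1 \<le> lookup \<alpha> p" using p by (simp add: in_keys_iff)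
      moreover have "lookup \<alpha> p \<le> \<mu> k"
      proof -
        have "lookup \<alpha> p \<le> ydeg \<alpha>"
          using member_le_sum[of p "keys \<alpha>" "\<lambda>j. if j = 0 then 0 else lookup \<alpha> j"] p p0
          by (simp add: ydeg_def lin_ext_def)
        then show ?thesis using yd by simp
      qed
      ultimately show ?thesis using char[OF k, of "lookup \<alpha> p"] by simp
    qed
    finally show ?thesis .
  qed
  have tri: "(l = k \<and> \<beta> = \<alpha> \<and> K = J) \<or> deg_type l \<beta> K = 0"
    if l: "l \<in> {1..t}" and gl: "good r l \<beta> K" and nz: "?\<psi> (e l * pw (y l) \<beta>) (map (y l) (sorted_list_of_set K)) \<noteq> 0"
    for l \<beta> K
  proof (cases "l = k")
    case False
    have "card K = m" using gl by (simp add: good_def)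
    then have "?\<psi> (e l * pw (y l) \<beta>) (map (y l) (sorted_list_of_set K)) = 0"
      using tau_gen_other[OF k l False] yg Ls by (intro jac_dform_other) auto
    then show ?thesis using nz by simp
  next
    case True
    have gk: "good r k \<beta> K" using gl True by simp
    from nz[unfolded True val[OF gk]] obtain b where b: "b < Suc m" "K = Ls - {?L ! b}"
        "\<beta> + single 0 S = \<gamma> + single (?L ! b) 1"
      by (rule sum.not_neutral_contains_not_neutral) (auto split: if_splits)
    let ?l = "?L ! b"
    have lL: "?l \<in> Ls" using nth_in b by blast
    have "(\<beta> + single p 1) + single 0 S = (\<alpha> + single ?l 1) + single 0 S"
      using b(3) shift by (metis (no_types, lifting) add.assoc add.commute)
    then have \<beta>: "\<beta> + single p 1 = \<alpha> + single ?l 1" by (rule add_right_imp_eq)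
    show ?thesis
    proof (cases "?l = p")
      case True
      then show ?thesis using \<beta> b(2) pJ \<open>l = k\<close> by (auto simp: Ls_def)
    next
      case lp: False
      then have lJ: "?l \<in> J" using lL by (auto simp: Ls_def)
      have pK: "p \<in> K" using b(2) lp by (auto simp: Ls_def)
      have "ydeg \<beta> + 1 \<noteq> \<mu> k \<or> K = {0}"
      proof (rule ccontr)
        assume "\<not> (ydeg \<beta> + 1 \<noteq> \<mu> k \<or> K = {0})"
        then obtain i where i: "i \<in> keys \<beta>" "\<And>j. j \<in> K \<Longrightarrow> j < i" using gk by (auto simp: good_def)
        have "i \<in> keys (\<alpha> + single ?l 1)"
          unfolding \<beta>[symmetric] using i(1) by (simp add: in_keys_iff lookup_add)
        then have "i \<in> keys \<alpha> \<or> i = ?l"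
          using keys_add[of \<alpha> "single ?l 1"] by (auto split: if_splits)
        then have "i \<le> p" using pmax Jp[OF lJ] by auto
        then show False using i(2)[OF pK] by simp
      qed
      then show ?thesis using \<open>l = k\<close> by (auto simp: deg_type_def)
    qed
  qed
  show ?thesis
    by (rule exI[of _ ?\<psi>], intro conjI ballI allI impI) (rule pm, rule nonzero, rule tri)
qed

end

section \<open>Counting the generators\<close>

definition monomials :: "nat \<Rightarrow> nat \<Rightarrow> (nat \<Rightarrow>\<^sub>0 nat) set" where
  "monomials n s = {\<beta>. keys \<beta> \<subseteq> {1..n} \<and> tdeg \<beta> = s}"

lemma monomials_deg_0: "monomials n 0 = {0}"
proof -
  have "\<beta> = 0" if "tdeg \<beta> = 0" for \<beta>
  proof -
    have "keys \<beta> = {}" using that by (fastforce simp: tdeg_def lin_ext_def in_keys_iff)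
    then show ?thesis by simp
  qed
  then show ?thesis by (auto simp: monomials_def)
qed

lemma monomials_no_vars: "monomials 0 (Suc s) = {}"
  by (auto simp: monomials_def)

lemma monomials_last:
  "{\<beta> \<in> monomials (Suc n) (Suc s). Suc n \<in> keys \<beta>} = (\<lambda>\<beta>. \<beta> + single (Suc n) 1) ` monomials (Suc n) s"
proof (intro equalityI subsetI)
  fix \<beta> assume "\<beta> \<in> {\<beta> \<in> monomials (Suc n) (Suc s). Suc n \<in> keys \<beta>}"
  then have \<beta>: "keys \<beta> \<subseteq> {1..Suc n}" "tdeg \<beta> = Suc s" "Suc n \<in> keys \<beta>"
    by (auto simp: monomials_def)
  have eq: "\<beta> = (\<beta> - single (Suc n) 1) + single (Suc n) 1"
    using \<beta>(3) by (rule keys_diff_single)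
  have "keys (\<beta> - single (Suc n) 1) \<subseteq> keys \<beta>"
    by (auto simp: in_keys_iff lookup_minus)
  then have "\<beta> - single (Suc n) 1 \<in> monomials (Suc n) s"
    using \<beta> arg_cong[OF eq, of tdeg] by (auto simp: monomials_def)
  then show "\<beta> \<in> (\<lambda>\<beta>. \<beta> + single (Suc n) 1) ` monomials (Suc n) s"
    using eq by blast
next
  fix \<beta> assume "\<beta> \<in> (\<lambda>\<beta>. \<beta> + single (Suc n) 1) ` monomials (Suc n) s"
  then obtain \<gamma> where g: "\<beta> = \<gamma> + single (Suc n) 1" "keys \<gamma> \<subseteq> {1..Suc n}" "tdeg \<gamma> = s"
    by (auto simp: monomials_def)
  have "keys \<beta> \<subseteq> {1..Suc n}"
    unfolding g(1) using g(2) by (intro order.trans[OF keys_add] Un_least) auto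
  then show "\<beta> \<in> {\<beta> \<in> monomials (Suc n) (Suc s). Suc n \<in> keys \<beta>}"
    using g by (auto simp: monomials_def in_keys_iff lookup_add)
qed

lemma monomials_not_last:
  "{\<beta> \<in> monomials (Suc n) s. Suc n \<notin> keys \<beta>} = monomials n s"
  by (auto simp: monomials_def subset_iff le_Suc_eq)

text \<open>Pascal's rule: monomials either omit the last variable or are multiples of it.\<close>

lemma finite_card_monomials:
  "finite (monomials n s)" "card (monomials (Suc n) s) = (n + s) choose s"
proof -
  have fin: "finite (monomials n s)" for n s
  proof (induction n arbitrary: s)
    case 0
    show ?case by (cases s) (simp_all add: monomials_deg_0 monomials_no_vars)
  next
    case (Suc n)
    show ?case
    proof (induction s)
      case (Suc s)
      have "monomials (Suc n) (Suc s) = monomials n (Suc s) \<union> (\<lambda>\<beta>. \<beta> + single (Suc n) 1) ` monomials (Suc n) s"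
        using monomials_last[of n s] monomials_not_last[of n "Suc s"] by blast
      then show ?case using Suc \<open>\<And>s. finite (monomials n s)\<close> by simp
    qed (simp add: monomials_deg_0)
  qed
  show "finite (monomials n s)" by (rule fin)
  have rec: "card (monomials (Suc n) (Suc s)) = card (monomials n (Suc s)) + card (monomials (Suc n) s)" for n s
  proof -
    have "monomials (Suc n) (Suc s) = monomials n (Suc s) \<union> (\<lambda>\<beta>. \<beta> + single (Suc n) 1) ` monomials (Suc n) s"
      using monomials_last[of n s] monomials_not_last[of n "Suc s"] by blast
    moreover have "monomials n (Suc s) \<inter> (\<lambda>\<beta>. \<beta> + single (Suc n) 1) ` monomials (Suc n) s = {}"
      using monomials_last[of n s] monomials_not_last[of n "Suc s"] by blast
    moreover have "inj_on (\<lambda>\<beta>. \<beta> + single (Suc n) 1) (monomials (Suc n) s)"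
      by (auto intro: inj_onI)
    ultimately show ?thesis using fin by (simp add: card_Un_disjoint card_image)
  qed
  show "card (monomials (Suc n) s) = (n + s) choose s"
  proof (induction n arbitrary: s)
    case 0
    show ?case
    proof (induction s)
      case (Suc s)
      then show ?case by (simp add: rec monomials_no_vars)
    qed (simp add: monomials_deg_0)
  next
    case (Suc n)
    show ?case
    proof (induction s)
      case (Suc s)
      then show ?case using \<open>\<And>s. card (monomials (Suc n) s) = (n + s) choose s\<close>[of "Suc s"] by (simp add: rec)
    qed (simp add: monomials_deg_0)
  qed
qed

text \<open>For \<open>s = \<mu> - 1 > 0\<close> these are the surviving generators of top local
  degree with the power of \<open>y_0\<close> removed. The index \<open>0\<close> is excluded from
  \<open>\<beta>\<close> but allowed in \<open>J\<close>, as \<open>dy_0\<close> remains a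
  differential.\<close>

definition topset :: "nat \<Rightarrow> nat \<Rightarrow> nat \<Rightarrow> ((nat \<Rightarrow>\<^sub>0 nat) \<times> nat set) set" where
  "topset n m s = {(\<beta>, J). \<beta> \<in> monomials n s \<and> J \<subseteq> {..n} \<and> card J = m \<and> (\<exists>i\<in>keys \<beta>. \<forall>j\<in>J. j < i)}"

text \<open>If the last variable divides the monomial, the condition on \<open>J\<close> says just
  that \<open>J\<close> avoids \<open>n + 1\<close>; otherwise \<open>n + 1\<close> occurs neither
  in the monomial nor in \<open>J\<close>.\<close>

lemma topset_rec:
  "topset (Suc n) m (Suc s) = topset n m (Suc s) \<union>
    ((\<lambda>\<beta>. \<beta> + single (Suc n) 1) ` monomials (Suc n) s) \<times> {J. J \<subseteq> {..n} \<and> card J = m}"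
  (is "?L = ?A \<union> ?B \<times> ?C")
proof (intro equalityI subsetI)
  fix x assume "x \<in> ?L"
  then obtain \<beta> J i where x: "x = (\<beta>, J)" "\<beta> \<in> monomials (Suc n) (Suc s)" "J \<subseteq> {..Suc n}" "card J = m"
      "i \<in> keys \<beta>" "\<forall>j\<in>J. j < i" by (auto simp: topset_def)
  have "i \<le> Suc n" using x by (auto simp: monomials_def)
  then have J: "J \<subseteq> {..n}" using x(6) by fastforce
  show "x \<in> ?A \<union> ?B \<times> ?C"
  proof (cases "Suc n \<in> keys \<beta>")
    case True
    then have "\<beta> \<in> ?B" using x(2) monomials_last[of n s] by blast
    then show ?thesis using x J by simp
  next
    case False
    then have "\<beta> \<in> monomials n (Suc s)" using x(2) monomials_not_last[of n "Suc s"] by blast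
    then have "x \<in> ?A" using x J by (auto simp: topset_def)
    then show ?thesis by simp
  qed
next
  fix x assume "x \<in> ?A \<union> ?B \<times> ?C"
  then show "x \<in> ?L"
  proof
    assume "x \<in> ?A"
    then show ?thesis using monomials_not_last[of n "Suc s"] by (auto simp: topset_def)
  next
    assume x: "x \<in> ?B \<times> ?C"
    then obtain \<beta> J where "x = (\<beta>, J)" "\<beta> \<in> monomials (Suc n) (Suc s)" "Suc n \<in> keys \<beta>" "J \<subseteq> {..n}" "card J = m"
      using monomials_last[of n s] by blast
    then show ?thesis by (auto simp: topset_def intro!: bexI[of _ "Suc n"])
  qed
qed

text \<open>For \<open>m + 1\<close> differentials and \<open>s + 1 = \<mu> - 1\<close> this is the
  term \<open>\<delta>\<close> of the formula, with the lower indices of two binomials replaced by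
  their complements. In this form only upper indices depend on \<open>n\<close>, and the induction
  on \<open>n\<close> is by Pascal's rule.\<close>

lemma card_topset:
  "finite (topset n m (Suc s))"
  "card (topset n (Suc m) (Suc s)) = (s + m + 1 choose (m + 1)) * (n + s choose (s + m + 2)) + (s + m choose m) * (n + s choose (s + m + 1))"
proof -
  have fC: "finite {J. J \<subseteq> {..n} \<and> card J = m}" for n m :: nat
    by (rule finite_subset[of _ "Pow {..n}"]) auto
  show fin: "finite (topset n m (Suc s))" for n m
  proof (induction n)
    case 0
    show ?case by (simp add: topset_def monomials_no_vars)
  next
    case (Suc n)
    then show ?case unfolding topset_rec using fC finite_card_monomials(1) by simp
  qed
  show "card (topset n (Suc m) (Suc s)) = (s + m + 1 choose (m + 1)) * (n + s choose (s + m + 2)) + (s + m choose m) * (n + s choose (s + m + 1))"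
  proof (induction n)
    case 0
    show ?case by (simp add: topset_def monomials_no_vars binomial_eq_0)
  next
    case (Suc n)
    let ?B = "(\<lambda>\<beta>. \<beta> + single (Suc n) 1) ` monomials (Suc n) s" and ?C = "{J. J \<subseteq> {..n} \<and> card J = Suc m}"
    have "topset n (Suc m) (Suc s) \<inter> ?B \<times> ?C = {}"
      using monomials_last[of n s] monomials_not_last[of n "Suc s"] by (auto simp: topset_def)
    then have "card (topset (Suc n) (Suc m) (Suc s)) = card (topset n (Suc m) (Suc s)) + card (?B \<times> ?C)"
      unfolding topset_rec using fin fC finite_card_monomials(1) by (intro card_Un_disjoint) auto
    also have "card (?B \<times> ?C) = (n + s choose s) * (Suc n choose Suc m)"
    proof -
      have "card ?B = (n + s choose s)"
        by (subst card_image) (auto intro: inj_onI simp: finite_card_monomials)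
      moreover have "card ?C = (Suc n choose Suc m)" using n_subsets[of "{..n}" "Suc m"] by simp
      ultimately show ?thesis by (simp add: card_cartesian_product)
    qed
    also have "(n + s choose s) * (Suc n choose Suc m) =
        (s + m + 1 choose (m + 1)) * (n + s choose (s + m + 1)) + (s + m choose m) * (n + s choose (s + m))"
    proof -
      \<comment> \<open>Trinomial revision turns the number of new pairs into the two terms by which
        Pascal's rule increases the claimed expression.\<close>
      have *: "(s + l choose l) * (n + s choose (s + l)) = (n + s choose s) * (n choose l)" for l
      proof (cases "l \<le> n")
        case True
        have "(n + s choose (s + l)) * ((s + l) choose s) = (n + s choose s) * (n choose l)"
          using choose_mult[of s "s + l" "n + s"] True by simp
        moreover have "(s + l choose l) = (s + l choose s)" using binomial_symmetric[of l "s + l"] by simp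
        ultimately show ?thesis by (simp add: mult.commute)
      qed (simp add: binomial_eq_0)
      show ?thesis using *[of "m + 1"] *[of m] by (simp add: distrib_left add.commute)
    qed
    finally have "card (topset (Suc n) (Suc m) (Suc s)) =
        ((s + m + 1 choose (m + 1)) * (n + s choose (s + m + 2)) + (s + m choose m) * (n + s choose (s + m + 1)))
        + ((s + m + 1 choose (m + 1)) * (n + s choose (s + m + 1)) + (s + m choose m) * (n + s choose (s + m)))"
      unfolding Suc .
    also have "\<dots> = (s + m + 1 choose (m + 1)) * (Suc n + s choose (s + m + 2)) + (s + m choose m) * (Suc n + s choose (s + m + 1))"
    proof -
      have "(Suc n + s choose (s + m + 2)) = (n + s choose (s + m + 1)) + (n + s choose (s + m + 2))"
        by simp
      moreover have "(Suc n + s choose (s + m + 1)) = (n + s choose (s + m)) + (n + s choose (s + m + 1))" by simp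
      ultimately show ?thesis by (simp only: distrib_left add_ac)
    qed
    finally show ?case .
  qed
qed

text \<open>\<open>good\<close> with the point replaced by its multiplicity, the only datum of the
  point that the count depends on.\<close>

definition goodset :: "nat \<Rightarrow> nat \<Rightarrow> nat \<Rightarrow> nat \<Rightarrow> ((nat \<Rightarrow>\<^sub>0 nat) \<times> nat set) set" where
  "goodset n m \<mu> r = {(\<alpha>, J). keys \<alpha> \<subseteq> {..n} \<and> tdeg \<alpha> = r \<and> J \<subseteq> {..n} \<and> card J = m \<and>
    (ydeg \<alpha> + 2 \<le> \<mu> \<or>
     ydeg \<alpha> + 1 = \<mu> \<and> ((\<exists>i\<in>keys \<alpha>. \<forall>j\<in>J. j < i) \<or> ydeg \<alpha> = 0 \<and> J = {0}))}"

text \<open>Filling up with \<open>y_0\<close> to total degree \<open>r\<close> is reversible, so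
  the number of monomials of a given local degree does not depend on \<open>r\<close> once
  \<open>r\<close> is large enough.\<close>

lemma homogenize:
  assumes "s \<le> r"
  shows "bij_betw (\<lambda>\<beta>. \<beta> + single 0 (r - s)) (monomials n s)
    {\<alpha>. keys \<alpha> \<subseteq> {..n} \<and> tdeg \<alpha> = r \<and> ydeg \<alpha> = s}"
  unfolding bij_betw_def
proof (intro conjI equalityI subsetI)
  show "inj_on (\<lambda>\<beta>. \<beta> + single 0 (r - s)) (monomials n s)" by (auto intro: inj_onI)
next
  fix \<alpha> assume "\<alpha> \<in> (\<lambda>\<beta>. \<beta> + single 0 (r - s)) ` monomials n s"
  then obtain \<beta> where \<beta>: "\<alpha> = \<beta> + single 0 (r - s)" "keys \<beta> \<subseteq> {1..n}" "tdeg \<beta> = s"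
    by (auto simp: monomials_def)
  have "lookup \<beta> 0 = 0" using \<beta>(2) by (metis atLeastAtMost_iff in_keys_iff not_one_le_zero subsetD)
  then have "ydeg \<beta> = s" using tdeg_ydeg[of \<beta>] \<beta> by simp
  moreover have "keys \<alpha> \<subseteq> {..n}"
    unfolding \<beta>(1) using \<beta>(2) by (intro order.trans[OF keys_add] Un_least) auto
  ultimately show "\<alpha> \<in> {\<alpha>. keys \<alpha> \<subseteq> {..n} \<and> tdeg \<alpha> = r \<and> ydeg \<alpha> = s}"
    using \<beta> assms by simp
next
  fix \<alpha> assume "\<alpha> \<in> {\<alpha>. keys \<alpha> \<subseteq> {..n} \<and> tdeg \<alpha> = r \<and> ydeg \<alpha> = s}"
  then have \<alpha>: "keys \<alpha> \<subseteq> {..n}" "tdeg \<alpha> = r" "ydeg \<alpha> = s" by auto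
  let ?\<beta> = "\<alpha> - single 0 (r - s)"
  have l0: "lookup \<alpha> 0 = r - s" using tdeg_ydeg[of \<alpha>] \<alpha> by simp
  then have eq: "\<alpha> = ?\<beta> + single 0 (r - s)"
    by (intro poly_mapping_eqI) (auto simp: lookup_add lookup_minus lookup_single when_def)
  have "keys ?\<beta> \<subseteq> keys \<alpha> - {0}"
    using l0 by (auto simp: in_keys_iff lookup_minus lookup_single when_def)
  then have "keys ?\<beta> \<subseteq> {1..n}" using \<alpha>(1) by (auto simp: subset_iff Suc_le_eq)
  moreover have "tdeg ?\<beta> = s" using arg_cong[OF eq, of tdeg] \<alpha> assms by simp
  ultimately show "\<alpha> \<in> (\<lambda>\<beta>. \<beta> + single 0 (r - s)) ` monomials n s"
    using eq by (auto simp: monomials_def)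
qed

lemma card_homogenize:
  assumes "s \<le> r"
  shows "finite {\<alpha>. keys \<alpha> \<subseteq> {..n} \<and> tdeg \<alpha> = r \<and> ydeg \<alpha> = s}"
    "card {\<alpha>. keys \<alpha> \<subseteq> {..n} \<and> tdeg \<alpha> = r \<and> ydeg \<alpha> = s} = card (monomials n s)"
  using bij_betw_finite[OF homogenize[OF assms, of n]] bij_betw_same_card[OF homogenize[OF assms, of n]]
    finite_card_monomials(1)[of n s] by auto

text \<open>Below the top local degree the differentials are unrestricted. In the top degree the
  case \<open>\<mu> = 1\<close> is special: no variable besides \<open>y_0\<close> occurs, and only
  \<open>dy_0\<close> remains.\<close>

lemma card_goodset:
  assumes n: "n \<ge> 1" and m: "m \<ge> 1" and \<mu>: "\<mu> \<ge> 1" "\<mu> \<le> r"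
  shows "finite (goodset n m \<mu> r)"
    and "card (goodset n m \<mu> r) = (Suc n choose m) * (\<Sum>s<\<mu> - 1. (n - 1 + s) choose s)
      + (if \<mu> = 1 then (if m = 1 then 1 else 0) else card (topset n m (\<mu> - 1)))"
proof -
  define M where "M s = {\<alpha>. keys \<alpha> \<subseteq> {..n} \<and> tdeg \<alpha> = r \<and> ydeg \<alpha> = s}" for s
  define Js where "Js = {J. J \<subseteq> {..n} \<and> card J = m}"
  define Tp where "Tp = {(\<alpha>, J). \<alpha> \<in> M (\<mu> - 1) \<and> J \<in> Js \<and> ((\<exists>i\<in>keys \<alpha>. \<forall>j\<in>J. j < i) \<or> \<mu> = 1 \<and> J = {0})}"
  have finJ: "finite Js" unfolding Js_def by (rule finite_subset[of _ "Pow {..n}"]) auto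
  have finM: "finite (M s)" if "s < \<mu>" for s unfolding M_def using that \<mu> by (intro card_homogenize) auto
  have split: "goodset n m \<mu> r = (\<Union>s<\<mu> - 1. M s \<times> Js) \<union> Tp"
    using \<mu> unfolding goodset_def M_def Js_def Tp_def by (auto simp: less_diff_conv)
  have finT: "finite Tp"
    by (rule finite_subset[of _ "M (\<mu> - 1) \<times> Js"]) (use finJ finM \<mu> in \<open>auto simp: Tp_def\<close>)
  have finU: "finite (\<Union>s<\<mu> - 1. M s \<times> Js)" using finJ finM by auto
  show "finite (goodset n m \<mu> r)" unfolding split using finT finU by simp
  have "card (goodset n m \<mu> r) = card (\<Union>s<\<mu> - 1. M s \<times> Js) + card Tp"
    unfolding split using finT finU by (intro card_Un_disjoint) (auto simp: Tp_def M_def)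
  also have "card (\<Union>s<\<mu> - 1. M s \<times> Js) = (\<Sum>s<\<mu> - 1. card (M s \<times> Js))"
    using finM finJ by (intro card_UN_disjoint) (auto simp: M_def)
  also have "\<dots> = (\<Sum>s<\<mu> - 1. (Suc n choose m) * ((n - 1 + s) choose s))"
  proof (intro sum.cong refl)
    fix s assume s: "s \<in> {..<\<mu> - 1}"
    have "card (M s) = card (monomials n s)" unfolding M_def using s \<mu> by (intro card_homogenize) auto
    also have "\<dots> = (n - 1 + s) choose s" using finite_card_monomials(2)[of "n - 1" s] n by simp
    finally show "card (M s \<times> Js) = (Suc n choose m) * ((n - 1 + s) choose s)"
      using n_subsets[of "{..n}" m] by (simp add: card_cartesian_product Js_def)
  qed
  also have "\<dots> = (Suc n choose m) * (\<Sum>s<\<mu> - 1. (n - 1 + s) choose s)" by (simp add: sum_distrib_left)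
  also have "card Tp = (if \<mu> = 1 then (if m = 1 then 1 else 0) else card (topset n m (\<mu> - 1)))"
  proof (cases "\<mu> = 1")
    case True
    have "M 0 = (\<lambda>\<beta>. \<beta> + single 0 r) ` monomials n 0"
      using homogenize[of 0 r n] unfolding bij_betw_def M_def by simp
    then have M0: "M 0 = {single 0 r}" by (simp add: monomials_deg_0)
    have "(\<alpha>, J) \<in> Tp \<longleftrightarrow> m = 1 \<and> \<alpha> = single 0 r \<and> J = {0}" for \<alpha> J
    proof
      assume "(\<alpha>, J) \<in> Tp"
      then have a: "\<alpha> = single 0 r" "J \<in> Js" "(\<exists>i\<in>keys \<alpha>. \<forall>j\<in>J. j < i) \<or> J = {0}"
        using True M0 by (auto simp: Tp_def)
      have "J \<noteq> {}" using a(2) m by (auto simp: Js_def)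
      then have "J = {0}" using a(1,3) by (auto split: if_splits)
      then show "m = 1 \<and> \<alpha> = single 0 r \<and> J = {0}" using a by (auto simp: Js_def)
    next
      assume "m = 1 \<and> \<alpha> = single 0 r \<and> J = {0}"
      then show "(\<alpha>, J) \<in> Tp" using True M0 by (auto simp: Tp_def Js_def)
    qed
    then have "Tp = (if m = 1 then {(single 0 r, {0})} else {})" by auto
    then show ?thesis using True by simp
  next
    case False
    let ?h = "\<lambda>\<beta>. \<beta> + single (0::nat) (r - (\<mu> - 1))"
    have h: "bij_betw ?h (monomials n (\<mu> - 1)) (M (\<mu> - 1))"
      unfolding M_def using \<mu> by (intro homogenize) auto
    \<comment> \<open>An index exceeding the nonempty set \<open>J\<close> is positive, so the power
      of \<open>y_0\<close> does not affect the condition.\<close>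
    have keys: "(\<exists>i\<in>keys (?h \<beta>). \<forall>j\<in>J. j < i) \<longleftrightarrow> (\<exists>i\<in>keys \<beta>. \<forall>j\<in>J. j < i)" if "J \<in> Js" for \<beta> J
    proof -
      have "J \<noteq> {}" using that m by (auto simp: Js_def)
      then have "i \<noteq> 0" if "\<forall>j\<in>J. j < i" for i using that by auto
      moreover have "i \<in> keys (?h \<beta>) \<longleftrightarrow> i \<in> keys \<beta>" if "i \<noteq> 0" for i
        using that by (simp add: in_keys_iff lookup_add lookup_single)
      ultimately show ?thesis by blast
    qed
    have "Tp = (\<lambda>(\<beta>, J). (?h \<beta>, J)) ` topset n m (\<mu> - 1)"
    proof (intro equalityI subsetI)
      fix x assume "x \<in> Tp"
      then obtain \<alpha> J where x: "x = (\<alpha>, J)" "\<alpha> \<in> M (\<mu> - 1)" "J \<in> Js" "\<exists>i\<in>keys \<alpha>. \<forall>j\<in>J. j < i"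
        using False by (auto simp: Tp_def)
      obtain \<beta> where \<beta>: "\<beta> \<in> monomials n (\<mu> - 1)" "\<alpha> = ?h \<beta>" using x(2) h by (auto simp: bij_betw_def)
      then have "(\<beta>, J) \<in> topset n m (\<mu> - 1)" using x keys[OF x(3), of \<beta>] by (auto simp: topset_def Js_def)
      then show "x \<in> (\<lambda>(\<beta>, J). (?h \<beta>, J)) ` topset n m (\<mu> - 1)" using x(1) \<beta>(2) by force
    next
      fix x assume "x \<in> (\<lambda>(\<beta>, J). (?h \<beta>, J)) ` topset n m (\<mu> - 1)"
      then obtain \<beta> J where x: "x = (?h \<beta>, J)" "(\<beta>, J) \<in> topset n m (\<mu> - 1)" by auto
      have J: "J \<in> Js" and \<beta>: "\<beta> \<in> monomials n (\<mu> - 1)" and ex: "\<exists>i\<in>keys \<beta>. \<forall>j\<in>J. j < i"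
        using x(2) by (auto simp: topset_def Js_def)
      have "?h \<beta> \<in> M (\<mu> - 1)" using h \<beta> by (auto simp: bij_betw_def)
      then show "x \<in> Tp" using x(1) J ex keys[OF J, of \<beta>] unfolding Tp_def by blast
    qed
    moreover have "inj_on (\<lambda>(\<beta>, J). (?h \<beta>, J)) (topset n m (\<mu> - 1))" by (auto intro!: inj_onI)
    ultimately show ?thesis using False by (simp add: card_image)
  qed
  finally show "card (goodset n m \<mu> r) = (Suc n choose m) * (\<Sum>s<\<mu> - 1. (n - 1 + s) choose s)
      + (if \<mu> = 1 then (if m = 1 then 1 else 0) else card (topset n m (\<mu> - 1)))" .
qed

lemma binom_of_nat [simp]: "binom (int a) (int b) = a choose b"
  by (simp add: binom_def binomial_eq_0)

lemma binom_eq_0: "b < 0 \<or> a < b \<Longrightarrow> binom a b = 0"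
  by (simp add: binom_def)

lemma card_goodset_formula:
  assumes n: "n \<ge> 1" and m: "m \<in> {1..n + 1}" and \<mu>: "\<mu> \<ge> 1" "\<mu> \<le> r"
  shows "card (goodset n m \<mu> r) =
    (if m = 1 then binom (int n + int \<mu> - 1) (int n) + (\<mu> - 1) * binom (int n + int \<mu> - 1) (int n - 1)
     else if m \<le> n then binom (int n + 1) (int m) * binom (int n + int \<mu> - 2) (int n)
       + (binom (int m + int \<mu> - 2) (int m) * binom (int n + int \<mu> - 2) (int n - int m - 1)
         + binom (int m + int \<mu> - 3) (int m - 1) * binom (int n + int \<mu> - 2) (int n - int m))
     else binom (int n + int \<mu> - 2) (int n))"
proof (cases "\<mu> = 1")
  case True
  \<comment> \<open>For \<open>\<mu> = 1\<close> the sum over lower degrees is empty, and every term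
    of the formula vanishes except \<open>binom n n\<close> in the case
    \<open>m = 1\<close>.\<close>
  have "card (goodset n m \<mu> r) = (if m = 1 then 1 else 0)"
    using card_goodset(2)[OF n _ \<mu>, of m] m True by simp
  moreover have "binom (int n - 1) (int n) = 0" "binom (int m - 1) (int m) = 0" "binom (int m - 2) (int m - 1) = 0"
    by (simp_all add: binom_eq_0)
  moreover have "binom (int n) (int n) = 1" by simp
  ultimately show ?thesis using True by (auto simp: algebra_simps)
next
  case False
  \<comment> \<open>The largest local degree in which the differentials are unrestricted.\<close>
  define s where "s = \<mu> - 2"
  have s: "\<mu> = s + 2" using False \<mu> by (simp add: s_def)
  obtain m' where m': "m = Suc m'" using m by (cases m) auto
  have low: "(\<Sum>k<\<mu> - 1. (n - 1 + k) choose k) = (n + s choose n)"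
  proof -
    have "(\<Sum>k<\<mu> - 1. (n - 1 + k) choose k) = (\<Sum>k\<le>s. (n - 1 + k) choose k)"
      by (intro sum.cong) (auto simp: s)
    also have "\<dots> = (Suc (n - 1 + s) choose s)" by (rule sum_choose_lower)
    also have "\<dots> = (n + s choose n)" using n binomial_symmetric[of s "n + s"] by simp
    finally show ?thesis .
  qed
  have total: "card (goodset n m \<mu> r) = (Suc n choose m) * (n + s choose n) +
      ((s + m' + 1 choose (m' + 1)) * (n + s choose (s + m' + 2)) + (s + m' choose m') * (n + s choose (s + m' + 1)))"
    using card_goodset(2)[OF n _ \<mu>, of m] m low card_topset(2)[of n m' s] by (simp add: s m')
  have b2: "int n + int \<mu> - 2 = int (n + s)" and b1: "int n + int \<mu> - 1 = int (n + s + 1)"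
    and bn: "int n - 1 = int (n - 1)" using s n by auto
  consider "m = 1" | "1 < m" "m \<le> n" | "m = n + 1" using m by fastforce
  then show ?thesis
  proof cases
    case 1
    \<comment> \<open>The general count also holds for \<open>m = 1\<close>; this absorption
      identity brings it into the form stated for that case.\<close>
    have e1: "(s + 1) * (n + s choose (s + 1)) = n * (n + s choose s)"
      using binomial_absorb_comp[of "n + s" s] binomial_absorption[of s "n + s"] Suc_times_binomial_eq[of "n + s - 1" s] n
      by (metis Suc_eq_plus1 add_diff_cancel_right' mult.commute binomial_absorption)
    have sym: "(n + s choose n) = (n + s choose s)" using binomial_symmetric[of n "n + s"] by simp
    have t1: "(n + s + 1 choose n) = (n + s choose s) + (n + s choose (s + 1))"
    proof -
      have "(n + s + 1 choose n) = (n + s + 1 choose (s + 1))" using binomial_symmetric[of n "n + s + 1"] by simp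
      then show ?thesis by simp
    qed
    have t2: "(n + s + 1 choose (n - 1)) = (n + s choose (s + 1)) + (n + s choose (s + 2))"
    proof -
      have "(n + s + 1 choose (n - 1)) = (n + s + 1 choose (s + 2))"
        using binomial_symmetric[of "n - 1" "n + s + 1"] n by simp
      then show ?thesis by simp
    qed
    have "card (goodset n m \<mu> r) = (n + 1) * (n + s choose s) + ((s + 1) * (n + s choose (s + 2)) + (n + s choose (s + 1)))"
      using total 1 m' sym by simp
    also have "\<dots> = (n + s + 1 choose n) + (\<mu> - 1) * (n + s + 1 choose (n - 1))"
      unfolding t1 t2 s using e1 by (simp add: algebra_simps)
    finally show ?thesis using 1 unfolding b1 bn binom_of_nat by simp
  next
    case 2
    have i1: "int n + 1 = int (Suc n)" and i2: "int m + int \<mu> - 2 = int (s + m' + 1)"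
      and i3: "int m + int \<mu> - 3 = int (s + m')" and i4: "int m - 1 = int m'" and i5: "int m = int (m' + 1)"
      and i6: "int n - int m = int (n - m)" using s m' 2 by auto
    \<comment> \<open>For \<open>m = n\<close> the lower index is \<open>-1\<close>, and the
      complementary index \<open>s + m' + 2 = n + s + 1\<close> is out of range as well.\<close>
    have r1: "binom (int (n + s)) (int n - int m - 1) = (n + s choose (s + m' + 2))"
    proof (cases "m < n")
      case True
      have "int n - int m - 1 = int (n - m - 1)" using True by simp
      moreover have "(n + s choose (n - m - 1)) = (n + s choose (s + m' + 2))"
        using binomial_symmetric[of "n - m - 1" "n + s"] True m' by simp
      ultimately show ?thesis by (simp only: binom_of_nat)
    next
      case False
      then show ?thesis using 2 m' by (simp add: binom_eq_0 binomial_eq_0)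
    qed
    have r2: "(n + s choose (n - m)) = (n + s choose (s + m' + 1))"
      using binomial_symmetric[of "n - m" "n + s"] 2 m' by simp
    have "card (goodset n m \<mu> r) = binom (int n + 1) (int m) * binom (int n + int \<mu> - 2) (int n)
       + (binom (int m + int \<mu> - 2) (int m) * binom (int n + int \<mu> - 2) (int n - int m - 1)
         + binom (int m + int \<mu> - 3) (int m - 1) * binom (int n + int \<mu> - 2) (int n - int m))"
      unfolding b2 r1 unfolding i1 i2 i3 i4 i6 binom_of_nat r2 unfolding i5 binom_of_nat total by (simp add: m')
    then show ?thesis using 2 by simp
  next
    case 3
    \<comment> \<open>For \<open>m = n + 1\<close> the differentials use every index, so nothing
      survives in the top local degree.\<close>
    then have "card (goodset n m \<mu> r) = (n + s choose n)" using total m' by (simp add: binomial_eq_0)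
    then show ?thesis using 3 n unfolding b2 binom_of_nat by simp
  qed
qed

section \<open>Hilbert polynomials\<close>

text \<open>Applying \<open>l b\<close> to a vanishing combination isolates the coefficient of
  \<open>w b\<close> once those of smaller rank are known to vanish, so induction on the rank proves
  independence. Distinct elements of equal rank do not interact.\<close>

lemma dim_of_dual_family:
  fixes V :: "('k::field, 'v, 'x) module_scheme" and w :: "'b \<Rightarrow> 'v" and rk :: "'b \<Rightarrow> nat"
  assumes V: "vectorspace class_ring V" and G: "G \<subseteq> carrier V" and B: "finite B"
    and w: "\<And>b. b \<in> B \<Longrightarrow> w b \<in> LinearCombinations.module.span class_ring V G"
    and gen: "G \<subseteq> LinearCombinations.module.span class_ring V (w ` B)"
    and add: "\<And>b x y. \<lbrakk>b \<in> B; x \<in> carrier V; y \<in> carrier V\<rbrakk> \<Longrightarrow> l b (x \<oplus>\<^bsub>V\<^esub> y) = l b x + (l b y :: 'k)"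
    and smult: "\<And>b c x. \<lbrakk>b \<in> B; x \<in> carrier V\<rbrakk> \<Longrightarrow> l b (c \<odot>\<^bsub>V\<^esub> x) = c * l b x"
    and diag: "\<And>b. b \<in> B \<Longrightarrow> l b (w b) \<noteq> 0"
    and tri: "\<And>b b'. \<lbrakk>b \<in> B; b' \<in> B; l b (w b') \<noteq> 0\<rbrakk> \<Longrightarrow> b' = b \<or> rk b' < rk b"
  defines "W \<equiv> V\<lparr>carrier := LinearCombinations.module.span class_ring V G\<rparr>"
  shows "vectorspace class_ring W \<and> vectorspace.fin_dim class_ring W \<and> vectorspace.dim class_ring W = card B"
proof -
  interpret V: vectorspace class_ring V by (rule V)
  have sub: "submodule class_ring (V.span G) V" by (rule V.span_is_submodule) (rule G)
  have subs: "subspace class_ring (V.span G) V" by (rule V.span_is_subspace) (rule G)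
  have spanG: "V.span G \<subseteq> carrier V" by (rule V.span_is_subset2) (rule G)
  have wB: "w ` B \<subseteq> V.span G" "w ` B \<subseteq> carrier V" using w spanG by auto
  interpret W: vectorspace class_ring W unfolding W_def by (rule V.subspace_is_vs) (rule subs)
  \<comment> \<open>Equal images of distinct elements would force strict rank inequalities in both
    directions.\<close>
  have inj: "inj_on w B"
  proof (rule inj_onI)
    fix b b' assume bb: "b \<in> B" "b' \<in> B" "w b = w b'"
    have "b' = b \<or> rk b' < rk b" using bb diag[of b] by (intro tri) auto
    moreover have "b = b' \<or> rk b < rk b'" using bb diag[of b'] by (intro tri) auto
    ultimately show "b = b'" by auto
  qed
  have l0: "l b \<zero>\<^bsub>V\<^esub> = 0" if "b \<in> B" for b
  proof -
    have "l b \<zero>\<^bsub>V\<^esub> + l b \<zero>\<^bsub>V\<^esub> = l b \<zero>\<^bsub>V\<^esub> + 0"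
      using add[OF that, of "\<zero>\<^bsub>V\<^esub>" "\<zero>\<^bsub>V\<^esub>"] by (simp only: V.zero_closed V.l_zero add_0_right)
    then show ?thesis by (simp only: add_left_cancel)
  qed
  have lsum: "l b (finsum V f A) = (\<Sum>x\<in>A. l b (f x))" if "b \<in> B" "finite A" "f \<in> A \<rightarrow> carrier V" for b f and A :: "'v set"
    using that(2,3)
  proof (induction A)
    case empty
    then show ?case using l0[OF that(1)] by simp
  next
    case (insert x A)
    then have "finsum V f (insert x A) = f x \<oplus>\<^bsub>V\<^esub> finsum V f A" by (intro V.finsum_insert) auto
    then show ?case using insert that(1) by (simp add: add V.finsum_closed Pi_def)
  qed
  have li: "V.lin_indpt (w ` B)"
  proof (rule V.finite_lin_indpt2)
    show "finite (w ` B)" using B by simp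
    show "w ` B \<subseteq> carrier V" by (rule wB)
    fix a :: "'v \<Rightarrow> 'k" assume a: "V.lincomb a (w ` B) = \<zero>\<^bsub>V\<^esub>"
    have eq: "(\<Sum>b'\<in>B. a (w b') * l b (w b')) = 0" if b: "b \<in> B" for b
    proof -
      have "0 = l b (V.lincomb a (w ` B))" using a l0[OF b] by simp
      also have "\<dots> = (\<Sum>x\<in>w ` B. l b (a x \<odot>\<^bsub>V\<^esub> x))"
        unfolding V.lincomb_def using wB B b by (intro lsum) auto
      also have "\<dots> = (\<Sum>x\<in>w ` B. a x * l b x)"
        using wB b by (intro sum.cong refl smult) auto
      also have "\<dots> = (\<Sum>b'\<in>B. a (w b') * l b (w b'))" using inj by (simp add: sum.reindex)
      finally show ?thesis by simp
    qed
    have "a (w b) = 0" if "b \<in> B" for b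
      using that
    proof (induction "rk b" arbitrary: b rule: less_induct)
      case less
      have "(\<Sum>b'\<in>B. a (w b') * l b (w b')) = (\<Sum>b'\<in>B. if b' = b then a (w b) * l b (w b) else 0)"
      proof (intro sum.cong refl)
        fix b' assume b': "b' \<in> B"
        show "a (w b') * l b (w b') = (if b' = b then a (w b) * l b (w b) else 0)"
        proof (cases "b' = b \<or> l b (w b') = 0")
          case False
          then have "rk b' < rk b" using tri[OF less.prems b'] by auto
          then show ?thesis using less.hyps[OF _ b'] False by simp
        qed auto
      qed
      also have "\<dots> = a (w b) * l b (w b)" using less.prems B by simp
      finally show ?case using eq[OF less.prems] diag[OF less.prems] by simp
    qed
    then show "\<forall>v\<in>w ` B. a v = \<zero>\<^bsub>class_ring\<^esub>" by simp
  qed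
  have basis: "W.basis (w ` B)"
    unfolding W.basis_def
  proof (intro conjI)
    show "W.lin_indpt (w ` B)" using V.span_li_not_depend(2)[OF wB(1) sub] li unfolding W_def by simp
    have "W.span (w ` B) = V.span (w ` B)" using V.span_li_not_depend(1)[OF wB(1) sub] unfolding W_def by simp
    also have "\<dots> = V.span G"
    proof
      show "V.span (w ` B) \<subseteq> V.span G" using wB(1) sub by (rule V.span_is_subset)
      show "V.span G \<subseteq> V.span (w ` B)"
        using gen V.span_is_submodule[OF wB(2)] by (rule V.span_is_subset)
    qed
    finally show "W.gen_set (w ` B)" by (simp add: W_def)
    show "w ` B \<subseteq> carrier W" using wB by (simp add: W_def)
  qed
  have "W.fin_dim" unfolding W.fin_dim_def
    using basis B unfolding W.basis_def by (intro exI[of _ "w ` B"] conjI finite_imageI) simp_all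
  moreover have "W.dim = card B" using W.dim_basis[OF _ basis] B inj by (simp add: card_image)
  ultimately show ?thesis using W.vectorspace_axioms by simp
qed

section \<open>The graded components as vector spaces\<close>

context coord begin

abbreviation "Vm \<equiv> restrict_scalars (base_map n I) \<Lambda>m"

lemma restrict_scalars_simps:
  "carrier (restrict_scalars \<phi> M) = carrier M" "\<zero>\<^bsub>restrict_scalars \<phi> M\<^esub> = \<zero>\<^bsub>M\<^esub>"
  "x \<oplus>\<^bsub>restrict_scalars \<phi> M\<^esub> y = x \<oplus>\<^bsub>M\<^esub> y" "c \<odot>\<^bsub>restrict_scalars \<phi> M\<^esub> x = \<phi> c \<odot>\<^bsub>M\<^esub> x"
  by (simp_all add: restrict_scalars_def)

lemma base_simps:
  "base_map n I c \<in> carrier R"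
  "base_map n I (a + b) = base_map n I a \<oplus>\<^bsub>R\<^esub> base_map n I b"
  "base_map n I (a * b) = base_map n I a \<otimes>\<^bsub>R\<^esub> base_map n I b"
  "base_map n I 1 = \<one>\<^bsub>R\<^esub>"
  using ring_hom_one[OF cls_hom]
  by (simp_all add: base_map_def cls_closed cls_add cls_mult const_poly_simps)

lemma Vm_vectorspace: "vectorspace class_ring Vm"
proof (rule vectorspace.intro)
  show "field (class_ring :: 'k ring)" by (rule class_field)
  show "module class_ring Vm"
  proof (rule moduleI)
    show "cring (class_ring :: 'k ring)" by (rule domain.axioms(1)) (rule field.axioms(1), rule class_field)
    show "abelian_group Vm"
    proof (rule abelian_groupI, unfold restrict_scalars_simps diff_forms_eq)
      fix x assume "x \<in> carrier X.\<Lambda>"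
      then show "\<exists>y\<in>carrier X.\<Lambda>. y \<oplus>\<^bsub>X.\<Lambda>\<^esub> x = \<zero>\<^bsub>X.\<Lambda>\<^esub>"
        by (intro bexI[of _ "\<ominus>\<^bsub>X.\<Lambda>\<^esub> x"]) (auto simp: L.l_neg)
    qed (auto simp: L.a_ac)
  qed (auto simp: restrict_scalars_simps diff_forms_eq base_simps L.smult_l_distr L.smult_r_distr L.smult_assoc1)
qed

lemma span_ksubspace:
  assumes "G \<subseteq> carrier \<Lambda>m"
  shows "ksubspace (LinearCombinations.module.span class_ring Vm G)"
proof -
  interpret V: vectorspace class_ring Vm by (rule Vm_vectorspace)
  have G: "G \<subseteq> carrier Vm" using assms by (simp add: restrict_scalars_simps)
  interpret S: LinearCombinations.submodule class_ring "V.span G" Vm by (rule V.span_is_submodule) (rule G)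
  show ?thesis
    unfolding ksubspace_def
    using S.subset S.zero_closed S.m_closed S.smult_closed by (auto simp: restrict_scalars_simps)
qed

definition comp_gens where
  "comp_gens s = {pform F (map var_poly js) | F js. F \<in> P \<and> homogeneous s F \<and> length js = m \<and> set js \<subseteq> {..n}}"

lemma comp_gens_carrier: "comp_gens s \<subseteq> carrier \<Lambda>m"
proof
  fix x assume "x \<in> comp_gens s"
  then obtain F js where x: "x = pform F (map var_poly js)" "F \<in> P" "length js = m" "set js \<subseteq> {..n}"
    unfolding comp_gens_def by blast
  have "set (map var_poly js) \<subseteq> P" using x(4) PR_var by auto
  then show "x \<in> carrier \<Lambda>m" unfolding x(1) using x by (intro pform_closed) simp_all
qed

lemma diff_forms_comp_eq:
  "diff_forms_comp n I m (s + m) = Vm\<lparr>carrier := LinearCombinations.module.span class_ring Vm (comp_gens s)\<rparr>"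
proof -
  have dx: "map (dx n I) js = map (kaehler_d class_ring (base_map n I) R) (map cls (map var_poly js))" for js
    by (simp add: dx_def)
  have "{r \<odot>\<^bsub>\<Lambda>m\<^esub> wedge R (one_forms n I) (map (dx n I) js) | r js e.
      e + m = s + m \<and> r \<in> coord_comp n I e \<and> length js = m \<and> set js \<subseteq> {..n}} = comp_gens s"
    unfolding comp_gens_def pform_def form_def coord_comp_def one_forms_def dx diff_forms_eq by auto
  then show ?thesis unfolding diff_forms_comp_def Let_def by simp
qed

end

section \<open>Dimension of a component of high degree\<close>

context bumps begin

lemma good_goodset: "good r k \<alpha> J \<longleftrightarrow> (\<alpha>, J) \<in> goodset n m (\<mu> k) r"
  by (simp add: good_def goodset_def)

text \<open>The coefficient is homogeneous of degree \<open>S + r\<close>, and the differentials of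
  the local coordinates are combinations of the \<open>dX_j\<close>.\<close>

lemma gen_in_span:
  assumes k: "k \<in> {1..t}" and g: "good r k \<alpha> J"
  shows "gen k \<alpha> J \<in> LinearCombinations.module.span class_ring Vm (comp_gens (S + r))"
proof -
  interpret V: vectorspace class_ring Vm by (rule Vm_vectorspace)
  let ?C = "V.span (comp_gens (S + r))"
  have C: "ksubspace ?C" by (rule span_ksubspace) (rule comp_gens_carrier)
  have sub: "comp_gens (S + r) \<subseteq> ?C"
    by (rule V.in_own_span) (use comp_gens_carrier in \<open>simp add: restrict_scalars_simps\<close>)
  let ?F = "e k * pw (y k) \<alpha>"
  have \<alpha>: "keys \<alpha> \<subseteq> {..n}" "tdeg \<alpha> = r" "J \<subseteq> {..n}" "card J = m" using g by (auto simp: good_def)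
  have F: "?F \<in> PR n" by (rule PR_mult[OF e_PR[OF k] pw_y_PR[OF \<alpha>(1)]])
  have hom: "homogeneous (S + r) ?F"
    using homogeneous_simps(5)[OF w_hom[OF k] homogeneous_pw[of "y k" \<alpha>, OF homogeneous_yv]] \<alpha>(2) by simp
  have "pform ?F (map var_poly [] @ map (y k) (sorted_list_of_set J)) \<in> ?C"
  proof (rule C_slots_change[OF C F, where c = "\<lambda>j. if j = 0 then 0 else - q k j"])
    show "var_poly j \<in> PR n" if "j \<le> n" for j using that by (rule PR_var)
    show "y k j = var_poly j + const_poly (if j = 0 then 0 else - q k j) * var_poly 0" for j
      by (simp add: yv_def const_poly_simps)
    show "pform ?F (map var_poly ks) \<in> ?C" if "set ks \<subseteq> {..n}" "length ks = m" for ks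
      using sub F hom that unfolding comp_gens_def by blast
  qed (use good_finite[OF g] \<alpha> in simp_all)
  then show ?thesis unfolding gen_def by simp
qed

lemma dim_component:
  assumes r: "\<And>k. k \<in> {1..t} \<Longrightarrow> \<mu> k \<le> r"
  shows "vectorspace class_ring (diff_forms_comp n I m (S + r + m))
    \<and> vectorspace.fin_dim class_ring (diff_forms_comp n I m (S + r + m))
    \<and> vectorspace.dim class_ring (diff_forms_comp n I m (S + r + m)) = (\<Sum>k=1..t. card (goodset n m (\<mu> k) r))"
proof -
  interpret V: vectorspace class_ring Vm by (rule Vm_vectorspace)
  \<comment> \<open>Triples keep generators at different points apart, so the count is a sum over
    the points.\<close>
  define B where "B = (SIGMA k:{1..t}. goodset n m (\<mu> k) r)"
  define v where "v b = (case b of (k, \<alpha>, J) \<Rightarrow> gen k \<alpha> J)" for b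
  define rk where "rk b = (case b of (k, \<alpha>, J) \<Rightarrow> deg_type k \<alpha> J)" for b
  have finB: "finite B" unfolding B_def using card_goodset(1)[OF n m] mu r by auto
  have B: "b \<in> B \<Longrightarrow> \<exists>k \<alpha> J. b = (k, \<alpha>, J) \<and> k \<in> {1..t} \<and> good r k \<alpha> J" for b
    unfolding B_def good_goodset by auto
  \<comment> \<open>Everything required of the functional for \<open>b\<close>, packed into one
    predicate so that a family can be chosen.\<close>
  define dual where "dual b l \<longleftrightarrow> (\<forall>x\<in>carrier Vm. \<forall>z\<in>carrier Vm. l (x \<oplus>\<^bsub>Vm\<^esub> z) = l x + (l z :: 'k))
      \<and> (\<forall>c. \<forall>x\<in>carrier Vm. l (c \<odot>\<^bsub>Vm\<^esub> x) = c * l x)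
      \<and> l (v b) \<noteq> 0 \<and> (\<forall>b'\<in>B. l (v b') \<noteq> 0 \<longrightarrow> b' = b \<or> rk b' < rk b)" for b l
  have ex_dual: "\<exists>l. dual b l" if b: "b \<in> B" for b
  proof -
    obtain k \<alpha> J where b_eq: "b = (k, \<alpha>, J)" and k: "k \<in> {1..t}" and g: "good r k \<alpha> J" using B[OF b] by blast
    have "\<exists>\<psi>. pmultider n m I \<psi>
      \<and> \<psi> (e k * pw (y k) \<alpha>) (map (y k) (sorted_list_of_set J)) \<noteq> 0
      \<and> (\<forall>l\<in>{1..t}. \<forall>\<beta> K. good r l \<beta> K \<longrightarrow> \<psi> (e l * pw (y l) \<beta>) (map (y l) (sorted_list_of_set K)) \<noteq> 0
          \<longrightarrow> (l = k \<and> \<beta> = \<alpha> \<and> K = J) \<or> deg_type l \<beta> K < deg_type k \<alpha> J)"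
    proof (cases "deg_type k \<alpha> J = 0")
      case True
      from ex_dual_jac[OF k g True] obtain \<psi> where \<psi>: "pmultider n m I \<psi>" "\<forall>l\<in>{1..t}. \<forall>\<beta> K. good r l \<beta> K \<longrightarrow>
          \<psi> (e l * pw (y l) \<beta>) (map (y l) (sorted_list_of_set K)) = (if l = k \<and> \<beta> = \<alpha> \<and> K = J then 1 else 0)"
        by blast
      show ?thesis
        by (rule exI[of _ \<psi>]) (use \<psi> k g in \<open>auto split: if_splits\<close>)
    next
      case False
      then have d1: "deg_type k \<alpha> J = 1" by (simp add: deg_type_def split: if_splits)
      then show ?thesis using ex_dual_jac_Cons[OF k g d1] by auto
    qed
    then obtain \<psi> where \<psi>: "pmultider n m I \<psi>"
      "\<psi> (e k * pw (y k) \<alpha>) (map (y k) (sorted_list_of_set J)) \<noteq> 0"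
      "\<And>l \<beta> K. \<lbrakk>l \<in> {1..t}; good r l \<beta> K; \<psi> (e l * pw (y l) \<beta>) (map (y l) (sorted_list_of_set K)) \<noteq> 0\<rbrakk>
          \<Longrightarrow> (l = k \<and> \<beta> = \<alpha> \<and> K = J) \<or> deg_type l \<beta> K < deg_type k \<alpha> J"
      by blast
    interpret M: pmultider n m I \<psi> by (rule \<psi>(1))
    obtain l where l: "\<And>Y Z. Y \<in> carrier \<Lambda>m \<Longrightarrow> Z \<in> carrier \<Lambda>m \<Longrightarrow> l (Y \<oplus>\<^bsub>\<Lambda>m\<^esub> Z) = l Y + l Z"
      "\<And>c Z. Z \<in> carrier \<Lambda>m \<Longrightarrow> l (base_map n I c \<odot>\<^bsub>\<Lambda>m\<^esub> Z) = c * l Z"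
      "\<And>F Gs. F \<in> PR n \<Longrightarrow> set Gs \<subseteq> PR n \<Longrightarrow> length Gs = m \<Longrightarrow> l (pform F Gs) = \<psi> F Gs"
      using M.functional by blast
    have val: "l (v (j, \<beta>, K)) = \<psi> (e j * pw (y j) \<beta>) (map (y j) (sorted_list_of_set K))"
      if "j \<in> {1..t}" "good r j \<beta> K" for j \<beta> K
    proof -
      have K: "keys \<beta> \<subseteq> {..n}" "K \<subseteq> {..n}" "card K = m" "finite K"
        using that(2) good_finite by (auto simp: good_def)
      have "set (map (y j) (sorted_list_of_set K)) \<subseteq> PR n" using K(2,4) by (auto intro!: yv_PR)
      then show ?thesis
        unfolding v_def gen_def using K PR_mult[OF e_PR[OF that(1)] pw_y_PR[OF K(1)]] by (simp add: l(3))
    qed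
    have "l (v b) \<noteq> 0" unfolding b_eq val[OF k g] by (rule \<psi>(2))
    moreover have "b' = b \<or> rk b' < rk b" if b': "b' \<in> B" "l (v b') \<noteq> 0" for b'
    proof -
      obtain j \<beta> K where b'_eq: "b' = (j, \<beta>, K)" and j: "j \<in> {1..t}" and gj: "good r j \<beta> K" using B[OF b'(1)] by blast
      have "\<psi> (e j * pw (y j) \<beta>) (map (y j) (sorted_list_of_set K)) \<noteq> 0"
        using b'(2) unfolding b'_eq val[OF j gj] .
      then show ?thesis using \<psi>(3)[OF j gj] by (auto simp: b'_eq b_eq rk_def)
    qed
    ultimately show ?thesis
      using l(1,2) unfolding dual_def by (intro exI[of _ l]) (simp add: restrict_scalars_simps)
  qed
  define l where "l b = (SOME l. dual b l)" for b
  have l: "dual b (l b)" if "b \<in> B" for b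
    using someI_ex[OF ex_dual[OF that]] unfolding l_def .
  have vB: "v b \<in> V.span (comp_gens (S + r))" if "b \<in> B" for b
    using B[OF that] gen_in_span by (auto simp: v_def)
  have G: "comp_gens (S + r) \<subseteq> carrier Vm" using comp_gens_carrier by (simp add: restrict_scalars_simps)
  have vB_carrier: "v ` B \<subseteq> carrier Vm" using vB V.span_is_subset2[OF G] by auto
  have gen: "comp_gens (S + r) \<subseteq> V.span (v ` B)"
  proof
    fix x assume "x \<in> comp_gens (S + r)"
    then obtain F js where x: "x = pform F (map var_poly js)" "F \<in> PR n" "homogeneous (S + r) F" "length js = m" "set js \<subseteq> {..n}"
      unfolding comp_gens_def by blast
    \<comment> \<open>The subspace \<open>C\<close> of the spanning argument is the span of the
      generators themselves.\<close>
    interpret SP: spanning n m t q \<mu> S w w' r "V.span (v ` B)"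
    proof (unfold_locales)
      show "ksubspace (V.span (v ` B))" by (rule span_ksubspace) (use vB_carrier in \<open>simp add: restrict_scalars_simps\<close>)
      show "gen k \<alpha> J \<in> V.span (v ` B)" if "k \<in> {1..t}" "good r k \<alpha> J" for k \<alpha> J
      proof -
        have "(k, \<alpha>, J) \<in> B" using that unfolding B_def good_goodset by simp
        then have "v (k, \<alpha>, J) \<in> v ` B" by (rule imageI)
        then show ?thesis using V.in_own_span[OF vB_carrier] by (auto simp: v_def)
      qed
    qed
    show "x \<in> V.span (v ` B)" unfolding x(1)
      by (rule SP.span_all) (use x r in \<open>simp_all add: add.commute\<close>)
  qed
  have "card B = (\<Sum>k=1..t. card (goodset n m (\<mu> k) r))" unfolding B_def by (rule card_SigmaI) (use card_goodset(1)[OF n m] mu r in auto)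
  moreover have "vectorspace class_ring (Vm\<lparr>carrier := V.span (comp_gens (S + r))\<rparr>) \<and>
      vectorspace.fin_dim class_ring (Vm\<lparr>carrier := V.span (comp_gens (S + r))\<rparr>) \<and>
      vectorspace.dim class_ring (Vm\<lparr>carrier := V.span (comp_gens (S + r))\<rparr>) = card B"
  proof (rule dim_of_dual_family[where w = v and l = l and rk = rk, OF Vm_vectorspace G finB vB gen])
    fix b x z c assume b: "b \<in> B"
    show "x \<in> carrier Vm \<Longrightarrow> z \<in> carrier Vm \<Longrightarrow> l b (x \<oplus>\<^bsub>Vm\<^esub> z) = l b x + l b z"
      "x \<in> carrier Vm \<Longrightarrow> l b (c \<odot>\<^bsub>Vm\<^esub> x) = c * l b x" "l b (v b) \<noteq> 0" using l[OF b] unfolding dual_def by blast+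
    show "b' \<in> B \<Longrightarrow> l b (v b') \<noteq> 0 \<Longrightarrow> b' = b \<or> rk b' < rk b" for b' using l[OF b] unfolding dual_def by blast
  qed
  ultimately show ?thesis unfolding diff_forms_comp_eq by simp
qed

end

theorem theorem7p12:
  fixes n t m :: nat
    and p :: "nat \<Rightarrow> (nat \<Rightarrow> 'k::field) set"
    and \<mu> :: "nat \<Rightarrow> nat"
  assumes "n \<ge> 1" and "t \<ge> 1"
    and "perfect_field TYPE('k)"
    and "\<And>i. i \<in> {1..t} \<Longrightarrow> p i \<in> proj_space n"
    and "inj_on p {1..t}"
    and "\<And>i. i \<in> {1..t} \<Longrightarrow> \<mu> i \<ge> 1"
    and "\<And>i v. i \<in> {1..t} \<Longrightarrow> v \<in> p i \<Longrightarrow> v 0 \<noteq> 0"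
    and "m \<in> {1..n + 1}"
    and "CHAR('k) = 0 \<or> CHAR('k) > Max (\<mu> ` {1..t})"
  defines "\<delta> \<equiv> \<lambda>i. binom (int m + int (\<mu> i) - 2) (int m) * binom (int n + int (\<mu> i) - 2) (int n - int m - 1)
                 + binom (int m + int (\<mu> i) - 3) (int m - 1) * binom (int n + int (\<mu> i) - 2) (int n - int m)"
  shows "has_HP class_ring (diff_forms_comp n (fat_point_ideal n t p \<mu>) m)
    (if m = 1 then
       \<Sum>i=1..t. binom (int n + int (\<mu> i) - 1) (int n)
                + (\<mu> i - 1) * binom (int n + int (\<mu> i) - 1) (int n - 1)
     else if m \<le> n then
       \<Sum>i=1..t. binom (int n + 1) (int m) * binom (int n + int (\<mu> i) - 2) (int n) + \<delta> i
     else
       \<Sum>i=1..t. binom (int n + int (\<mu> i) - 2) (int n))"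
    (is "has_HP _ _ ?c")
proof -
  have "\<forall>i\<in>{1..t}. \<exists>q. q 0 = 1 \<and> (\<forall>j>n. q j = 0) \<and> p i = {(\<lambda>j. c * q j) | c. c \<noteq> 0}"
  proof
    fix i assume i: "i \<in> {1..t}"
    show "\<exists>q. q 0 = 1 \<and> (\<forall>j>n. q j = 0) \<and> p i = {(\<lambda>j. c * q j) | c. c \<noteq> 0}"
    proof (rule proj_space_normal[OF assms(4)[OF i]])
      show "v 0 \<noteq> 0" if "v \<in> p i" for v by (rule assms(7)[OF i that])
    qed blast
  qed
  from bchoice[OF this] obtain q
    where q_all: "\<forall>i\<in>{1..t}. q i 0 = 1 \<and> (\<forall>j>n. q i j = 0) \<and> p i = {(\<lambda>j. c * q i j) | c. c \<noteq> 0}" ..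
  have q: "i \<in> {1..t} \<Longrightarrow> q i 0 = 1" "\<lbrakk>i \<in> {1..t}; j > n\<rbrakk> \<Longrightarrow> q i j = 0"
      "i \<in> {1..t} \<Longrightarrow> p i = {(\<lambda>j. c * q i j) | c. c \<noteq> 0}" for i j using q_all by blast+
  have mu_max: "\<mu> i \<le> Max (\<mu> ` {1..t})" if "i \<in> {1..t}" for i using that by simp
  interpret fat n m t q \<mu>
  proof
    show "n \<ge> 1" "m \<ge> 1" using assms(1,8) by auto
    show "q i 0 = 1" if "i \<in> {1..t}" for i by (rule q(1)[OF that])
    show "q i j = 0" if "i \<in> {1..t}" "j > n" for i j by (rule q(2)[OF that])
    show "inj_on q {1..t}"
    proof (rule inj_onI)
      fix i j assume ij: "i \<in> {1..t}" "j \<in> {1..t}" "q i = q j"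
      then have "p i = p j" using q(3)[of i] q(3)[of j] by simp
      then show "i = j" using assms(5) ij by (auto dest: inj_onD)
    qed
    show "\<mu> i \<ge> 1" if "i \<in> {1..t}" for i using assms(6) that by blast
    \<comment> \<open>A positive integer that is zero in \<open>K\<close> is a multiple of the
      characteristic, which is then nonzero and exceeds every multiplicity.\<close>
    show "(of_nat a :: 'k) \<noteq> 0" if "i \<in> {1..t}" "1 \<le> a" "a \<le> \<mu> i" for i a
    proof
      assume "(of_nat a :: 'k) = 0"
      then have dvd: "CHAR('k) dvd a" by (simp add: of_nat_eq_0_iff_char_dvd)
      then have "CHAR('k) \<noteq> 0" using that by auto
      then have "CHAR('k) > a" using assms(9) mu_max[OF that(1)] that by linarith
      then show False using dvd that(2) by (auto dest: dvd_imp_le)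
    qed
  qed
  have ideal_eq: "fat_point_ideal n t p \<mu> = I"
  proof -
    have "fat_point_ideal n t p \<mu> = (\<Inter>i\<in>{1..t}. fatI n (q i) (\<mu> i))"
      unfolding fat_point_ideal_def using fatI_eq_power[OF q(1) q(3)] by simp
    \<comment> \<open>As \<open>t \<ge> 1\<close>, the intersection runs over a nonempty family and
      is therefore contained in \<open>PR n\<close>.\<close>
    also have "\<dots> = I" using assms(2) unfolding I_def fatI_def by auto
    finally show ?thesis .
  qed
  obtain S where S: "\<forall>k\<in>{1..t}. \<exists>w w'. w \<in> PR n \<and> w' \<in> PR n
    \<and> tau (q k) (w * w') - var_poly 0 ^ S \<in> vord (\<mu> k)
    \<and> (\<forall>l\<in>{1..t} - {k}. tau (q l) w \<in> vord (\<mu> l) \<and> tau (q l) w' \<in> vord (\<mu> l))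
    \<and> homogeneous S (w * w')" using bump by blast
  then obtain w w' where w: "\<And>k. k \<in> {1..t} \<Longrightarrow> w k \<in> PR n \<and> w' k \<in> PR n
    \<and> tau (q k) (w k * w' k) - var_poly 0 ^ S \<in> vord (\<mu> k)
    \<and> (\<forall>l\<in>{1..t} - {k}. tau (q l) (w k) \<in> vord (\<mu> l) \<and> tau (q l) (w' k) \<in> vord (\<mu> l))
    \<and> homogeneous S (w k * w' k)" by metis
  interpret bumps n m t q \<mu> S w w'
    by unfold_locales (use w in auto)
  \<comment> \<open>Degree \<open>i\<close> has coefficients of degree \<open>i - m = S + r\<close>:
    \<open>S\<close> is taken up by the \<open>e k\<close>, and \<open>r\<close> has to be at least
    every multiplicity for the Taylor terms and the count to be in the stable range.\<close>
  have dim: "vectorspace class_ring (diff_forms_comp n I m i)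
      \<and> vectorspace.fin_dim class_ring (diff_forms_comp n I m i)
      \<and> vectorspace.dim class_ring (diff_forms_comp n I m i) = ?c"
    if i: "i \<ge> S + Max (\<mu> ` {1..t}) + m" for i
  proof -
    define r where "r = i - S - m"
    have ir: "i = S + r + m" and rM: "Max (\<mu> ` {1..t}) \<le> r" using i by (auto simp: r_def)
    have r: "\<mu> k \<le> r" if "k \<in> {1..t}" for k using mu_max[OF that] rM by simp
    have "(\<Sum>k=1..t. card (goodset n m (\<mu> k) r)) = ?c"
      using card_goodset_formula[OF assms(1,8) assms(6) r] by (simp add: \<delta>_def)
    then show ?thesis using dim_component[OF r] unfolding ir by simp
  qed
  show ?thesis
    unfolding has_HP_def ideal_eq eventually_sequentially using dim by blast
qed

end
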